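(* Let the standing assumptions in the context hold. Assume that $\inf_{\mathscr P_\mu(\mathcal X\times\mathcal Y)}\mathcal J<+\infty$ and that for all $n\in\mathbb N$ there exist $0<C_n<+\infty$ and a measurable family $(\nu_n^y)_{y\in\mathcal Y}\subset\mathscr P(\mathcal Y)$ such that for all $y,y'\in\mathcal Y$ and all $(x,y,\nu)\in\operatorname{dom}\Phi$ $$\mathcal H(\nu_n^y,\nu_n^{y'})\le C_n(1+L(y)+L(y'))\quad\text{and}\quad\int_{\mathcal Y}\Phi(x,z,\nu)\,d\nu_n^y(z)\xrightarrow[n\to\infty]{}\Phi(x,y,\nu).$$ Then, with full $\mathbb P$-probability, there are sequences of Nash equilibria for the closed-loop $N$-player games, described by transportation plans $(\gamma_N)_{N\in\mathbb N}$, converging in the narrow topology, up to a subsequence, to a Cournot--Nash equilibrium $\gamma\in\mathscr P_\mu(\mathcal X\times\mathcal Y)$ for the cost $\Phi$ and distribution of types $\mu$. Assume in addition that $H\in\mathscr C_b(\mathcal Y\times\mathcal Y)$ (bounded and continuous). Then, with full $\mathbb P$-probability, for any sequence of Nash equilibria of the closed-loop $N$-player games, encoded by $$\gamma_N=\frac1N\sum_{i=1}^N\delta_{x_i}\otimes\nu_{i,N}\in\mathscr P_{\mu_N(\omega)}(\mathcal X\times\mathcal Y)$$ and converging to $\gamma$ in the narrow topology of $\mathscr P(\mathcal X\times\mathcal Y)$, it holds that $\gamma\in\mathscr P_\mu(\mathcal X\times\mathcal Y)$ and $\gamma$ is a Cournot--Nash equilibrium for the cost $\Phi$ and distribution of types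 $\mu$.
   Context: Standing assumptions: $\mathcal X,\mathcal Y$ are Polish spaces; $\mu\in\mathscr P(\mathcal X)$ (Borel probability measures) is atomless; $c:\mathcal X\times\mathcal Y\to[0,+\infty]$, $L:\mathcal Y\to[0,+\infty]$, $H:\mathcal Y\times\mathcal Y\to[0,+\infty]$ are lower semi-continuous; $H$ is symmetric; $\{L\le\kappa\}$ is compact for every $\kappa>0$. $(\Omega,\mathcal F,\mathbb P)$ is a probability space carrying an i.i.d. sequence $(X_i)_{i\in\mathbb N}$ of $\mathcal X$-valued random variables with law $\mu$. Notation: $\mathcal L(\nu)=\int L\,d\nu$, $\mathcal H(\nu,\bar\nu)=\int H\,d\nu\otimes\bar\nu$; for $m\in\mathscr P(\mathcal X)$, $\mathscr P_m(\mathcal X\times\mathcal Y)$ is the set of $\gamma\in\mathscr P(\mathcal X\times\mathcal Y)$ with first marginal $m$; for $\gamma\in\mathscr P_\mu(\mathcal X\times\mathcal Y)$ with second marginal $\nu$, $\mathcal J(\gamma)=\int c\,d\gamma+\mathcal L(\nu)+\mathcal H(\nu,\nu)$. $\Phi(x,y,\nu)=c(x,y)+L(y)+2\int_{\mathcal Y}H(y,y')\,d\nu(y')$ and $\operatorname{dom}\Phi=\{\Phi<+\infty\}$. A family $(\nu^y)_{y\in\mathcal Y}\subset\mathscr P(\mathcal Y)$ is measurable if $y\mapsto\nu^y(B)$ is Borel for every Borel $B\subset\mathcal Y$. The narrow topology is that of duality with bounded continuous functions. Cournot--Nash equilibrium: $\gamma\in\mathscr P(\mathcal X\times\mathcal Y)$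 with first marginal $\mu$ and $\gamma(\{(x,y): y\in\operatorname{argmin}_{y'\in\mathcal Y}\Phi(x,y',\nu)\})=1$, $\nu$ being the second marginal of $\gamma$. Closed-loop game: for $\omega\in\Omega$ put $x_i=X_i(\omega)$ and $\mu_N(\omega)=\frac1N\sum_{i=1}^N\delta_{x_i}$. Player $i\in\{1,\dots,N\}$ chooses $\nu_i\in\mathscr P(\mathcal Y)$ to minimize $$J_{\omega,i}(\nu_i,\nu_{-i})=\int_{\mathcal Y}c(x_i,y)\,d\nu_i(y)+\mathcal L(\nu_i)+\frac2N\sum_{j\ne i}\mathcal H(\nu_i,\nu_j).$$ A profile $(\nu_i)_{i=1}^N$ is a Nash equilibrium if $J_{\omega,i}(\nu_i,\nu_{-i})\le J_{\omega,i}(\bar\nu_i,\nu_{-i})$ for all $i$ and all $\bar\nu_i\in\mathscr P(\mathcal Y)$; it is described by the transportation plan $\gamma_N=\frac1N\sum_{i=1}^N\delta_{x_i}\otimes\nu_i$ (a bijective correspondence between profiles and $\mathscr P_{\mu_N(\omega)}(\mathcal X\times\mathcal Y)$ when the $x_i$ are pairwise distinct, which holds $\mathbb P$-a.s.). *)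

theory Defs
  imports "HOL-Probability.Probability"
begin

definition lsc :: "('a::topological_space \<Rightarrow> ennreal) \<Rightarrow> bool" where
  "lsc f \<longleftrightarrow> (\<forall>a. open {x. a < f x})"

definition atomless :: "'a measure \<Rightarrow> bool" where
  "atomless M \<longleftrightarrow> (\<forall>A\<in>sets M. 0 < emeasure M A \<longrightarrow>
     (\<exists>B\<in>sets M. B \<subseteq> A \<and> 0 < emeasure M B \<and> emeasure M B < emeasure M A))"

definition borel_probs :: "'a::topological_space measure set" where
  "borel_probs = {M. prob_space M \<and> sets M = sets borel}"

text \<open>The plans have the Borel sigma-algebra of the product space, which for second countable
  factors is the product sigma-algebra (\<open>borel_prod\<close>).\<close>

definition plans :: "'a::topological_space measure \<Rightarrow> ('a \<times> 'b::topological_space) measure set" where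
  "plans m = {\<gamma> \<in> borel_probs. distr \<gamma> borel fst = m}"

definition snd_marginal :: "('a \<times> 'b::topological_space) measure \<Rightarrow> 'b measure" where
  "snd_marginal \<gamma> = distr \<gamma> borel snd"

definition narrow_conv :: "(nat \<Rightarrow> 'a::topological_space measure) \<Rightarrow> 'a measure \<Rightarrow> bool" where
  "narrow_conv M M' \<longleftrightarrow> (\<forall>f::'a \<Rightarrow> real. continuous_on UNIV f \<and> bounded (range f) \<longrightarrow>
     (\<lambda>n. \<integral>x. f x \<partial>M n) \<longlonglongrightarrow> (\<integral>x. f x \<partial>M'))"

definition measurable_family :: "('b::topological_space \<Rightarrow> 'b measure) \<Rightarrow> bool" where
  "measurable_family \<kappa> \<longleftrightarrow> (\<forall>y. \<kappa> y \<in> borel_probs) \<and>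
     (\<forall>B\<in>sets borel. (\<lambda>y. emeasure (\<kappa> y) B) \<in> borel_measurable borel)"

definition Lcal :: "('b \<Rightarrow> ennreal) \<Rightarrow> 'b measure \<Rightarrow> ennreal" where
  "Lcal L \<nu> = (\<integral>\<^sup>+y. L y \<partial>\<nu>)"

definition Hcal :: "('b \<times> 'b \<Rightarrow> ennreal) \<Rightarrow> 'b measure \<Rightarrow> 'b measure \<Rightarrow> ennreal" where
  "Hcal H \<nu> \<nu>' = (\<integral>\<^sup>+z. H z \<partial>(\<nu> \<Otimes>\<^sub>M \<nu>'))"

definition Jcal :: "('a \<times> 'b \<Rightarrow> ennreal) \<Rightarrow> ('b::topological_space \<Rightarrow> ennreal) \<Rightarrow> ('b \<times> 'b \<Rightarrow> ennreal)
    \<Rightarrow> ('a \<times> 'b) measure \<Rightarrow> ennreal" where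
  "Jcal c L H \<gamma> = (\<integral>\<^sup>+z. c z \<partial>\<gamma>) + Lcal L (snd_marginal \<gamma>)
     + Hcal H (snd_marginal \<gamma>) (snd_marginal \<gamma>)"

definition Phi :: "('a \<times> 'b \<Rightarrow> ennreal) \<Rightarrow> ('b \<Rightarrow> ennreal) \<Rightarrow> ('b \<times> 'b \<Rightarrow> ennreal)
    \<Rightarrow> 'a \<Rightarrow> 'b \<Rightarrow> 'b measure \<Rightarrow> ennreal" where
  "Phi c L H x y \<nu> = c (x, y) + L y + 2 * (\<integral>\<^sup>+y'. H (y, y') \<partial>\<nu>)"

definition argmin :: "('b \<Rightarrow> ennreal) \<Rightarrow> 'b set" where
  "argmin f = {y. \<forall>y'. f y \<le> f y'}"

definition cournot_nash :: "('a::topological_space \<times> 'b::topological_space \<Rightarrow> ennreal) \<Rightarrow>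
    ('b \<Rightarrow> ennreal) \<Rightarrow> ('b \<times> 'b \<Rightarrow> ennreal) \<Rightarrow> 'a measure \<Rightarrow> ('a \<times> 'b) measure \<Rightarrow> bool" where
  "cournot_nash c L H \<mu> \<gamma> \<longleftrightarrow> \<gamma> \<in> plans \<mu> \<and>
     emeasure \<gamma> {(x, y). y \<in> argmin (\<lambda>y'. Phi c L H x y' (snd_marginal \<gamma>))} = 1"

text \<open>In the \<open>N\<close>-player game the players are \<open>1, \<dots>, N\<close>; the values of \<open>x\<close> and of a
  profile \<open>\<nu>\<close> outside \<open>{1..N}\<close> are irrelevant.\<close>

definition player_cost :: "('a \<times> 'b \<Rightarrow> ennreal) \<Rightarrow> ('b \<Rightarrow> ennreal) \<Rightarrow> ('b \<times> 'b \<Rightarrow> ennreal)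
    \<Rightarrow> (nat \<Rightarrow> 'a) \<Rightarrow> nat \<Rightarrow> nat \<Rightarrow> (nat \<Rightarrow> 'b measure) \<Rightarrow> ennreal" where
  "player_cost c L H x N i \<nu> = (\<integral>\<^sup>+y. c (x i, y) \<partial>\<nu> i) + Lcal L (\<nu> i)
     + (2 / of_nat N) * (\<Sum>j\<in>{1..N} - {i}. Hcal H (\<nu> i) (\<nu> j))"

definition nash_equilibrium :: "('a \<times> 'b::topological_space \<Rightarrow> ennreal) \<Rightarrow> ('b \<Rightarrow> ennreal) \<Rightarrow>
    ('b \<times> 'b \<Rightarrow> ennreal) \<Rightarrow> (nat \<Rightarrow> 'a) \<Rightarrow> nat \<Rightarrow> (nat \<Rightarrow> 'b measure) \<Rightarrow> bool" where
  "nash_equilibrium c L H x N \<nu> \<longleftrightarrow> (\<forall>i\<in>{1..N}. \<nu> i \<in> borel_probs) \<and>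
     (\<forall>i\<in>{1..N}. \<forall>\<nu>'\<in>borel_probs.
        player_cost c L H x N i \<nu> \<le> player_cost c L H x N i (\<nu>(i := \<nu>')))"

text \<open>The average of the Borel measures \<open>m 1, \<dots>, m N\<close>.\<close>

definition average :: "nat \<Rightarrow> (nat \<Rightarrow> 'a::topological_space measure) \<Rightarrow> 'a measure" where
  "average N m = measure_of UNIV (sets borel) (\<lambda>A. (\<Sum>i=1..N. emeasure (m i) A) / of_nat N)"

definition empirical :: "nat \<Rightarrow> (nat \<Rightarrow> 'a::topological_space) \<Rightarrow> 'a measure" where
  "empirical N x = average N (\<lambda>i. return borel (x i))"

definition profile_plan :: "nat \<Rightarrow> (nat \<Rightarrow> 'a::topological_space) \<Rightarrow> (nat \<Rightarrow> 'b::topological_space measure)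
    \<Rightarrow> ('a \<times> 'b) measure" where
  "profile_plan N x \<nu> = average N (\<lambda>i. return borel (x i) \<Otimes>\<^sub>M \<nu> i)"

lemma sets_average [simp]: "sets (average N m) = sets borel"
  unfolding average_def by (simp add: sets.sigma_sets_eq[of borel, simplified])

lemma emeasure_average:
  assumes "\<And>i. i \<in> {1..N} \<Longrightarrow> sets (m i) = sets borel" and A: "A \<in> sets borel"
  shows "emeasure (average N m) A = (\<Sum>i=1..N. emeasure (m i) A) / of_nat N"
proof (rule emeasure_measure_of[OF average_def])
  show "positive (sets (average N m)) (\<lambda>A. (\<Sum>i=1..N. emeasure (m i) A) / of_nat N)"
    by (simp add: positive_def)
  show "countably_additive (sets (average N m)) (\<lambda>A. (\<Sum>i=1..N. emeasure (m i) A) / of_nat N)"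
  proof (rule countably_additiveI)
    fix F :: "nat \<Rightarrow> 'a set"
    assume F: "range F \<subseteq> sets (average N m)" "disjoint_family F"
    have "(\<Sum>k. (\<Sum>i=1..N. emeasure (m i) (F k)) / of_nat N)
        = (\<Sum>i=1..N. \<Sum>k. emeasure (m i) (F k)) / of_nat N"
      by (simp add: divide_ennreal_def ennreal_suminf_multc suminf_sum)
    also have "(\<Sum>i=1..N. \<Sum>k. emeasure (m i) (F k)) = (\<Sum>i=1..N. emeasure (m i) (\<Union>k. F k))"
      using F assms(1) by (intro sum.cong refl suminf_emeasure) auto
    finally show "(\<Sum>k. (\<Sum>i=1..N. emeasure (m i) (F k)) / of_nat N)
        = (\<Sum>i=1..N. emeasure (m i) (\<Union>(range F))) / of_nat N" .
  qed
qed (use A in auto)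

lemma average_borel_probs:
  assumes "N \<ge> 1" "\<And>i. i \<in> {1..N} \<Longrightarrow> m i \<in> borel_probs"
  shows "average N m \<in> borel_probs"
proof -
  have "emeasure (m i) UNIV = 1" if "i \<in> {1..N}" for i
    using assms(2)[OF that] prob_space.emeasure_space_1[of "m i"] sets_eq_imp_space_eq[of "m i" borel]
    by (auto simp: borel_probs_def)
  then have "emeasure (average N m) UNIV = 1"
    using assms by (subst emeasure_average) 
      (auto simp: borel_probs_def intro!: ennreal_divide_self simp: of_nat_less_top)
  moreover have "space (average N m) = UNIV"
    using sets_eq_imp_space_eq[OF sets_average] by simp
  ultimately show ?thesis by (auto simp: borel_probs_def intro!: prob_spaceI)
qed

text \<open>A plan associated with a profile has the empirical measure of the types as first marginal.\<close>

lemma profile_plan_in_plans: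
  fixes x :: "nat \<Rightarrow> 'a::second_countable_topology"
    and \<nu> :: "nat \<Rightarrow> 'b::second_countable_topology measure"
  assumes N: "N \<ge> 1" and \<nu>: "\<And>i. i \<in> {1..N} \<Longrightarrow> \<nu> i \<in> borel_probs"
  shows "profile_plan N x \<nu> \<in> plans (empirical N x)"
proof -
  let ?p = "\<lambda>i. return borel (x i) \<Otimes>\<^sub>M \<nu> i"
  have sp: "sets (?p i) = sets borel" if "i \<in> {1..N}" for i
  proof -
    have "sets (?p i) = sets (borel \<Otimes>\<^sub>M borel)"
      using \<nu>[OF that] by (intro sets_pair_measure_cong) (auto simp: borel_probs_def)
    then show ?thesis by (simp only: borel_prod)
  qed
  have pp: "?p i \<in> borel_probs" if "i \<in> {1..N}" for i
  proof -
    interpret A: prob_space "return borel (x i)" by (rule prob_space_return) simp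
    interpret B: prob_space "\<nu> i" using \<nu>[OF that] by (simp add: borel_probs_def)
    interpret pair_prob_space "return borel (x i)" "\<nu> i" ..
    show ?thesis using sp[OF that] prob_space_axioms by (simp add: borel_probs_def)
  qed
  have "distr (profile_plan N x \<nu>) borel fst = empirical N x"
  proof (rule measure_eqI)
    fix A assume "A \<in> sets (distr (profile_plan N x \<nu>) borel (fst :: 'a \<times> 'b \<Rightarrow> 'a))"
    then have A: "A \<in> sets borel" by simp
    have fstm: "(fst :: 'a \<times> 'b \<Rightarrow> 'a) \<in> borel_measurable borel"
      by (intro borel_measurable_continuous_onI continuous_intros)
    have AU: "A \<times> (UNIV :: 'b set) \<in> sets borel"
      using A unfolding borel_prod[symmetric] by (intro pair_measureI) auto
    have spc: "space (profile_plan N x \<nu>) = UNIV"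
      unfolding profile_plan_def using sets_eq_imp_space_eq[OF sets_average] by simp
    have "fst -` A \<inter> space (profile_plan N x \<nu>) = A \<times> UNIV" using spc by auto
    then have "emeasure (distr (profile_plan N x \<nu>) borel fst) A = emeasure (profile_plan N x \<nu>) (A \<times> UNIV)"
      using A fstm by (subst emeasure_distr)
        (simp_all add: profile_plan_def cong: measurable_cong_sets)
    also have "\<dots> = (\<Sum>i=1..N. emeasure (?p i) (A \<times> UNIV)) / of_nat N"
      unfolding profile_plan_def using sp AU by (rule emeasure_average)
    also have "(\<Sum>i=1..N. emeasure (?p i) (A \<times> UNIV)) = (\<Sum>i=1..N. emeasure (return borel (x i)) A)"
    proof (rule sum.cong[OF refl])
      fix i assume i: "i \<in> {1..N}"
      interpret B: prob_space "\<nu> i" using \<nu>[OF i] by (simp add: borel_probs_def)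
      have sets: "sets (\<nu> i) = sets borel" using \<nu>[OF i] by (simp add: borel_probs_def)
      have "emeasure (\<nu> i) UNIV = 1"
        using B.emeasure_space_1 sets_eq_imp_space_eq[OF sets] by simp
      then show "emeasure (?p i) (A \<times> UNIV) = emeasure (return borel (x i)) A"
        using A sets by (subst B.emeasure_pair_measure_Times) auto
    qed
    finally show "emeasure (distr (profile_plan N x \<nu>) borel fst) A = emeasure (empirical N x) A"
      unfolding empirical_def using A by (subst emeasure_average) auto
  qed (simp add: empirical_def)
  then show ?thesis
    unfolding plans_def using average_borel_probs[OF N pp] by (simp add: profile_plan_def)
qed

end

theory Submission
  imports Defs
begin

text \<open>
  The finite game is a potential game: the total cost of a pure profile, with the interaction
  summed over ordered pairs of distinct players, changes under a unilateral deviation exactly as the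
  cost of the deviating player does. The potential is coercive and lower semicontinuous, so it has
  pure minimisers, and they are Nash equilibria (\<open>potential_minimiser_nash\<close>). Written in terms of
  the transportation plan it differs from the energy \<open>\<J>\<close> only by the diagonal terms.

  For the first assertion let \<open>\<gamma>\<close> minimise \<open>\<J>\<close> among the plans with first marginal \<open>\<mu>\<close> and couple the
  types with strategies so that the pairs are independent with law \<open>\<gamma>\<close>. The expected potential of
  these strategies is at most \<open>\<J>(\<gamma>)\<close>, since the diagonal is missing. By Fatou's lemma the expected
  lower limit of the potentials is at most \<open>inf \<J>\<close>. On the other hand profiles of bounded potential
  are tight, their plans cluster at plans with first marginal \<open>\<mu>\<close>, and the energy is lower
  semicontinuous (\<open>potential_cluster\<close>); hence the lower limit is almost surely at least \<open>inf \<J>\<close>, and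
  so almost surely equal to it. Only the law of large numbers for bounded functions of the types
  enters, never one for the possibly unbounded interaction. Replacing the coupled strategies by
  minimisers of the potentials gives equilibria which cluster at a minimiser of \<open>\<J>\<close>
  (\<open>AE_equilibria_converge\<close>). The statement about the coupled pairs descends to the types alone
  because a set of full measure contains compact sets of nearly full measure, and these have
  compact projections (\<open>AE_types_from_coupling\<close>).

  A minimiser of \<open>\<J>\<close> is a Cournot--Nash equilibrium by first-order optimality: \<open>\<Phi>\<close> is the derivative of
  the quadratic functional \<open>\<J>\<close>. If \<open>\<Phi>\<close> exceeded its minimum over the strategies on a set of positive
  mass, this mass could be moved to a measurable selection of minimisers, spread out by the kernels
  \<open>\<kappa> n\<close> so that its self-interaction is finite, and a small multiple of this move would lower the
  energy (\<open>minimiser_cournot_nash\<close>).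

  For the second assertion every player of an equilibrium is optimal against the mean field of all
  players up to an error \<open>2 B / N\<close>, where \<open>B\<close> bounds \<open>H\<close>. After truncation of the costs at an
  arbitrary level \<open>T\<close>, the average cost is therefore at most the average optimal cost plus that
  error. On the left the limit is taken by a version of Fatou's lemma for narrowly converging
  measures. On the right the optimal cost of a type is a function that depends on the random
  limit \<open>\<gamma>\<close>; it is approximated from above by members of a countable family of bounded functions,
  to which the law of large numbers applies simultaneously (\<open>simple_cost\<close>). In the limit the cost is
  on average at most the optimal one, so it is optimal \<open>\<gamma>\<close>-almost everywhere
  (\<open>equilibria_limit_cournot_nash\<close>).

  Prokhorov's theorem and the measurable selection both rest on one device: a Borel code of the
  points of a separable metric space by real numbers whose decoding is continuous on the codes of
  compact sets (\<open>real_code_compact_decode\<close>). It reduces the former to Helly's theorem on the line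
  and the latter to taking a smallest code.
\<close>

section \<open>Lower semicontinuous functions and narrow convergence\<close>

lemma borel_probsD:
  assumes "M \<in> borel_probs"
  shows "prob_space M" "sets M = sets borel" "space M = UNIV" "emeasure M UNIV = 1"
    "finite_measure M" "sigma_finite_measure M"
proof -
  show p: "prob_space M" and s: "sets M = sets borel" using assms by (auto simp: borel_probs_def)
  then show sp: "space M = UNIV" using sets_eq_imp_space_eq[OF s] by simp
  show "emeasure M UNIV = 1" using prob_space.emeasure_space_1[OF p] sp by simp
  show "finite_measure M" using p by (simp add: prob_space_def)
  then show "sigma_finite_measure M" by (simp add: finite_measure_def)
qed

lemma borel_probs_measurable:
  assumes "M \<in> borel_probs" "f \<in> measurable borel N"
  shows "f \<in> measurable M N"
  using assms borel_probsD(2)[OF assms(1)] by (simp cong: measurable_cong_sets)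

lemma lsc_openD: "lsc f \<Longrightarrow> open {x. a < f x}"
  by (simp add: lsc_def)

lemma lsc_closed_le: "lsc f \<Longrightarrow> closed {x. f x \<le> a}"
  using lsc_openD[of f a] by (simp add: closed_def Compl_eq not_le)

lemma lsc_localI:
  assumes "\<And>x a. a < f x \<Longrightarrow> \<exists>U. open U \<and> x \<in> U \<and> (\<forall>y\<in>U. a < f y)"
  shows "lsc f"
  unfolding lsc_def
proof
  fix a show "open {x. a < f x}"
    by (subst open_subopen) (use assms in fastforce)
qed

lemma lsc_measurable: "lsc f \<Longrightarrow> f \<in> borel_measurable borel"
  by (rule borel_measurableI_greater) (simp add: lsc_openD borel_open)

lemma lsc_compose: "lsc f \<Longrightarrow> continuous_on UNIV g \<Longrightarrow> lsc (\<lambda>x. f (g x))"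
  using open_vimage[of "{x. a < f x}" g for a] by (auto simp: lsc_def vimage_def)

lemma lsc_continuous: "continuous_on UNIV f \<Longrightarrow> lsc f"
  by (auto simp: lsc_def intro!: open_Collect_less continuous_intros)

lemma lsc_const: "lsc (\<lambda>x. a)"
  by (rule lsc_continuous) (rule continuous_on_const)

lemma lsc_SUP: "(\<And>i. i \<in> I \<Longrightarrow> lsc (f i)) \<Longrightarrow> lsc (\<lambda>x. SUP i\<in>I. f i x)"
  by (auto simp: lsc_def less_SUP_iff Collect_bex_eq intro!: open_UN)

lemma lsc_min: "lsc f \<Longrightarrow> lsc g \<Longrightarrow> lsc (\<lambda>x. min (f x) (g x))"
  by (auto simp: lsc_def Collect_conj_eq intro!: open_Int)

lemma lsc_extend_top:
  assumes "lsc f" "closed C"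
  shows "lsc (\<lambda>x. if x \<in> C then f x else top)"
  unfolding lsc_def
proof
  fix a :: ennreal
  have "{x. a < (if x \<in> C then f x else top)} = {x. a < f x} \<union> (if a < top then - C else {})"
    by (auto simp: less_top[symmetric] top_unique not_less)
  then show "open {x. a < (if x \<in> C then f x else top)}"
    using assms by (auto simp: lsc_openD intro!: open_Un open_Compl)
qed

text \<open>Moreau--Yosida regularisation: the infimal convolution of the truncation
  \<open>min f k\<close> with \<open>k dist\<close> is \<open>k\<close>-Lipschitz and increases to \<open>f\<close> exactly because every
  superlevel set of \<open>f\<close> contains a ball around each of its points.\<close>

lemma lsc_Lipschitz_approx:
  fixes f :: "'a::metric_space \<Rightarrow> ennreal"
  assumes f: "lsc f"
  obtains h :: "nat \<Rightarrow> 'a \<Rightarrow> real" where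
    "\<And>k x. 0 \<le> h k x" "\<And>k x. h k x \<le> real k"
    "\<And>k x y. h k x \<le> h k y + real k * dist x y"
    "\<And>x. incseq (\<lambda>k. h k x)" "\<And>x. (SUP k. ennreal (h k x)) = f x"
    "\<And>k. continuous_on UNIV (h k)"
proof -
  define g where "g k z = enn2real (min (f z) (ennreal (real k)))" for k z
  define h where "h k x = (INF z. g k z + real k * dist x z)" for k x
  have gk: "ennreal (g k z) = min (f z) (ennreal (real k))" for k z
    unfolding g_def by (rule ennreal_enn2real) (simp add: min_less_iff_disj)
  have g0: "0 \<le> g k z" for k z by (simp add: g_def)
  have gle: "g k z \<le> real k" for k z
    using gk[of k z] by (metis ennreal_le_iff min.cobounded2 of_nat_0_le_iff)
  have bdd: "bdd_below (range (\<lambda>z. g k z + real k * dist x z))" for k x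
    by (rule bdd_belowI[of _ 0]) (auto intro!: add_nonneg_nonneg g0)
  have hle: "h k x \<le> g k z + real k * dist x z" for k x z
    unfolding h_def by (rule cINF_lower[OF bdd]) simp
  have hge: "a \<le> h k x" if "\<And>z. a \<le> g k z + real k * dist x z" for a k x
    unfolding h_def by (rule cINF_greatest) (use that in auto)
  have h0: "0 \<le> h k x" for k x by (rule hge) (auto intro!: add_nonneg_nonneg g0)
  have hg: "h k x \<le> g k x" for k x using hle[of k x x] by simp
  have lip: "h k x \<le> h k y + real k * dist x y" for k x y
  proof -
    have "h k x - real k * dist x y \<le> h k y"
    proof (rule hge)
      fix z
      have "real k * dist x z \<le> real k * (dist x y + dist y z)"
        by (intro mult_left_mono dist_triangle) auto
      then show "h k x - real k * dist x y \<le> g k z + real k * dist y z"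
        using hle[of k x z] by (simp add: algebra_simps)
    qed
    then show ?thesis by simp
  qed
  have gmono: "g k z \<le> g l z" if "k \<le> l" for k l z
  proof -
    have "ennreal (g k z) \<le> ennreal (g l z)"
      unfolding gk using that by (intro min.mono) auto
    then show ?thesis using g0 by (simp add: ennreal_le_iff)
  qed
  have inc: "incseq (\<lambda>k. h k x)" for x
  proof (rule incseq_SucI)
    fix k show "h k x \<le> h (Suc k) x"
    proof (rule hge)
      fix z
      have "real k * dist x z \<le> real (Suc k) * dist x z" by (intro mult_right_mono) auto
      then show "h k x \<le> g (Suc k) z + real (Suc k) * dist x z"
        using hle[of k x z] gmono[of k "Suc k" z] by simp
    qed
  qed
  have sup: "(SUP k. ennreal (h k x)) = f x" for x
  proof (rule antisym)
    show "(SUP k. ennreal (h k x)) \<le> f x"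
    proof (rule SUP_least)
      fix k have "ennreal (h k x) \<le> ennreal (g k x)" using hg by (intro ennreal_leI)
      also have "\<dots> \<le> f x" unfolding gk by simp
      finally show "ennreal (h k x) \<le> f x" .
    qed
    show "f x \<le> (SUP k. ennreal (h k x))"
    proof (rule dense_le)
      fix a assume a: "a < f x"
      then obtain r where r: "a = ennreal r" "0 \<le> r" by (cases a) auto
      obtain d where d: "0 < d" "ball x d \<subseteq> {x. a < f x}"
        using lsc_openD[OF f, of a] a by (metis mem_Collect_eq open_contains_ball)
      obtain k where k: "max r (r / d) \<le> real k" using real_arch_simple by blast
      have "r \<le> h k x"
      proof (rule hge)
        fix z
        show "r \<le> g k z + real k * dist x z"
        proof (cases "dist x z < d")
          case True
          then have "a < f z" using d by auto
          then have "ennreal r \<le> ennreal (g k z)" unfolding gk using r k by (auto intro: ennreal_leI)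
          then have "r \<le> g k z" using g0 by (simp add: ennreal_le_iff)
          then show ?thesis by (simp add: add_increasing2)
        next
          case False
          have "r \<le> real k * d" using k d by (simp add: field_simps)
          also have "\<dots> \<le> real k * dist x z" using False by (intro mult_left_mono) auto
          finally show ?thesis using g0[of k z] by simp
        qed
      qed
      then have "a \<le> ennreal (h k x)" using r by (auto intro: ennreal_leI)
      also have "\<dots> \<le> (SUP k. ennreal (h k x))" by (rule SUP_upper) simp
      finally show "a \<le> (SUP k. ennreal (h k x))" .
    qed
  qed
  have cont: "continuous_on UNIV (h k)" for k
  proof (rule continuous_on_iff[THEN iffD2], intro ballI allI impI)
    fix x :: 'a and e :: real assume "0 < e"
    show "\<exists>d>0. \<forall>x'\<in>UNIV. dist x' x < d \<longrightarrow> dist (h k x') (h k x) < e"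
    proof (intro exI[of _ "e / (real k + 1)"] conjI ballI impI)
      show "0 < e / (real k + 1)" using \<open>0 < e\<close> by simp
      fix x' assume "dist x' x < e / (real k + 1)"
      then have *: "(real k + 1) * dist x' x < e" by (simp add: field_simps)
      have "\<bar>h k x' - h k x\<bar> \<le> real k * dist x' x"
        using lip[of k x x'] lip[of k x' x] by (simp add: dist_commute abs_le_iff)
      also have "\<dots> \<le> (real k + 1) * dist x' x" by (intro mult_right_mono) auto
      finally show "dist (h k x') (h k x) < e" using * by (simp add: dist_real_def)
    qed
  qed
  show thesis
  proof (rule that)
    show "h k x \<le> real k" for k x using hg[of k x] gle[of k x] by simp
  qed (use h0 lip inc sup cont in auto)
qed

lemma lsc_add:
  fixes f g :: "'a::metric_space \<Rightarrow> ennreal"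
  assumes "lsc f" "lsc g"
  shows "lsc (\<lambda>x. f x + g x)"
proof -
  obtain h :: "nat \<Rightarrow> 'a \<Rightarrow> real" where h: "\<And>k x. 0 \<le> h k x"
    "\<And>x. incseq (\<lambda>k. h k x)" "\<And>x. (SUP k. ennreal (h k x)) = f x" "\<And>k. continuous_on UNIV (h k)"
    using lsc_Lipschitz_approx[OF assms(1)] by metis
  obtain h' :: "nat \<Rightarrow> 'a \<Rightarrow> real" where h': "\<And>k x. 0 \<le> h' k x"
    "\<And>x. incseq (\<lambda>k. h' k x)" "\<And>x. (SUP k. ennreal (h' k x)) = g x" "\<And>k. continuous_on UNIV (h' k)"
    using lsc_Lipschitz_approx[OF assms(2)] by metis
  have "f x + g x = (SUP k. ennreal (h k x + h' k x))" for x
  proof -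
    have "(SUP k. ennreal (h k x) + ennreal (h' k x)) = f x + g x"
      unfolding h(3)[symmetric] h'(3)[symmetric]
      by (rule ennreal_SUP_add) (use h(2) h'(2) in \<open>auto simp: incseq_def intro!: ennreal_leI\<close>)
    then show ?thesis using h(1) h'(1) by simp
  qed
  then have "(\<lambda>x. f x + g x) = (\<lambda>x. SUP k. ennreal (h k x + h' k x))" by auto
  then show ?thesis
    by (simp only:) (intro lsc_SUP lsc_continuous continuous_on_ennreal continuous_intros h h')
qed

lemma lsc_sum:
  fixes f :: "'i \<Rightarrow> 'a::metric_space \<Rightarrow> ennreal"
  assumes "\<And>i. i \<in> I \<Longrightarrow> lsc (f i)"
  shows "lsc (\<lambda>x. \<Sum>i\<in>I. f i x)"
proof (cases "finite I")
  case True
  then show ?thesis using assms by (induction I) (auto intro!: lsc_const lsc_add)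
qed (simp add: lsc_const)

lemma lsc_cmult:
  fixes f :: "'a::metric_space \<Rightarrow> ennreal"
  assumes "lsc f" "0 \<le> r"
  shows "lsc (\<lambda>x. ennreal r * f x)"
proof -
  obtain h :: "nat \<Rightarrow> 'a \<Rightarrow> real" where h: "\<And>k x. 0 \<le> h k x"
    "\<And>x. (SUP k. ennreal (h k x)) = f x" "\<And>k. continuous_on UNIV (h k)"
    using lsc_Lipschitz_approx[OF assms(1)] by metis
  have "(\<lambda>x. ennreal r * f x) = (\<lambda>x. SUP k. ennreal (r * h k x))"
    using assms(2) h(1) by (simp add: h(2)[symmetric] SUP_mult_left_ennreal ennreal_mult)
  then show ?thesis
    by (simp only:) (intro lsc_SUP lsc_continuous continuous_on_ennreal continuous_intros h)
qed

lemma nn_integral_bounded_continuous: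
  fixes h :: "'a::topological_space \<Rightarrow> real"
  assumes M: "M \<in> borel_probs" and h: "continuous_on UNIV h" "\<And>x. 0 \<le> h x" "\<And>x. h x \<le> B"
  shows "(\<integral>\<^sup>+x. ennreal (h x) \<partial>M) = ennreal (\<integral>x. h x \<partial>M)" "integrable M h"
proof -
  interpret finite_measure M using borel_probsD[OF M] by simp
  have "h \<in> borel_measurable M"
    by (rule borel_probs_measurable[OF M]) (rule borel_measurable_continuous_onI[OF h(1)])
  then show i: "integrable M h" 
    by (intro integrable_const_bound[where B=B]) (use h in auto)
  show "(\<integral>\<^sup>+x. ennreal (h x) \<partial>M) = ennreal (\<integral>x. h x \<partial>M)"
    by (rule nn_integral_eq_integral[OF i]) (use h in auto)
qed

lemma narrow_convD_nn:
  fixes h :: "'a::topological_space \<Rightarrow> real"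
  assumes "narrow_conv M M'" "\<And>n. M n \<in> borel_probs" "M' \<in> borel_probs"
    and h: "continuous_on UNIV h" "\<And>x. 0 \<le> h x" "\<And>x. h x \<le> B"
  shows "(\<lambda>n. \<integral>\<^sup>+x. ennreal (h x) \<partial>M n) \<longlonglongrightarrow> (\<integral>\<^sup>+x. ennreal (h x) \<partial>M')"
proof -
  have "bounded (range h)" by (rule boundedI[of _ B]) (use h in auto)
  then have "(\<lambda>n. \<integral>x. h x \<partial>M n) \<longlonglongrightarrow> (\<integral>x. h x \<partial>M')"
    using assms(1) h(1) by (auto simp: narrow_conv_def)
  then show ?thesis
    by (simp add: nn_integral_bounded_continuous[OF assms(2) h]
        nn_integral_bounded_continuous[OF assms(3) h] tendsto_ennrealI)
qed

text \<open>One half of the portmanteau theorem, for nonnegative integrands.\<close>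

lemma narrow_conv_lsc_liminf:
  fixes f :: "'a::metric_space \<Rightarrow> ennreal"
  assumes conv: "narrow_conv M M'" and M: "\<And>n. M n \<in> borel_probs" "M' \<in> borel_probs" and f: "lsc f"
  shows "(\<integral>\<^sup>+x. f x \<partial>M') \<le> liminf (\<lambda>n. \<integral>\<^sup>+x. f x \<partial>M n)"
proof -
  obtain h :: "nat \<Rightarrow> 'a \<Rightarrow> real" where h: "\<And>k x. 0 \<le> h k x" "\<And>k x. h k x \<le> real k"
    "\<And>x. incseq (\<lambda>k. h k x)" "\<And>x. (SUP k. ennreal (h k x)) = f x" "\<And>k. continuous_on UNIV (h k)"
    using lsc_Lipschitz_approx[OF f] by metis
  have "(\<integral>\<^sup>+x. f x \<partial>M') = (\<integral>\<^sup>+x. (SUP k. ennreal (h k x)) \<partial>M')" by (simp add: h(4))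
  also have "\<dots> = (SUP k. \<integral>\<^sup>+x. ennreal (h k x) \<partial>M')"
  proof (rule nn_integral_monotone_convergence_SUP)
    show "incseq (\<lambda>k x. ennreal (h k x))"
      using h(3) by (auto simp: incseq_def le_fun_def intro!: ennreal_leI)
    show "(\<lambda>x. ennreal (h k x)) \<in> borel_measurable M'" for k
      by (intro borel_probs_measurable[OF M(2)] measurable_compose[OF borel_measurable_continuous_onI[OF h(5)]])
        simp
  qed
  also have "\<dots> \<le> liminf (\<lambda>n. \<integral>\<^sup>+x. f x \<partial>M n)"
  proof (rule SUP_least)
    fix k
    have "(\<lambda>n. \<integral>\<^sup>+x. ennreal (h k x) \<partial>M n) \<longlonglongrightarrow> (\<integral>\<^sup>+x. ennreal (h k x) \<partial>M')"
      by (rule narrow_convD_nn[OF conv M h(5,1,2)])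
    then have "(\<integral>\<^sup>+x. ennreal (h k x) \<partial>M') = liminf (\<lambda>n. \<integral>\<^sup>+x. ennreal (h k x) \<partial>M n)"
      by (simp add: lim_imp_Liminf)
    also have "\<dots> \<le> liminf (\<lambda>n. \<integral>\<^sup>+x. f x \<partial>M n)"
      by (intro Liminf_mono always_eventually allI nn_integral_mono)
        (auto simp: h(4)[symmetric] intro: SUP_upper)
    finally show "(\<integral>\<^sup>+x. ennreal (h k x) \<partial>M') \<le> liminf (\<lambda>n. \<integral>\<^sup>+x. f x \<partial>M n)" .
  qed
  finally show ?thesis .
qed

text \<open>Fatou's lemma with varying measures. The function \<open>z \<mapsto> sup {a. f\<^sub>n \<ge> a near z for all n \<ge> m}\<close>
  is lower semicontinuous and lies below \<open>f\<^sub>n\<close> for \<open>n \<ge> m\<close>, so the portmanteau inequality applies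
  to it; the hypothesis says that these functions increase to something above \<open>f\<close>.\<close>

lemma narrow_conv_Fatou:
  fixes f :: "'a::metric_space \<Rightarrow> ennreal" and g :: "nat \<Rightarrow> 'a \<Rightarrow> ennreal"
  assumes conv: "narrow_conv M M'" and M: "\<And>n. M n \<in> borel_probs" "M' \<in> borel_probs"
    and g: "\<And>z a. a < f z \<Longrightarrow> \<exists>U. open U \<and> z \<in> U \<and> (\<forall>\<^sub>F n in sequentially. \<forall>z'\<in>U. a \<le> g n z')"
  shows "(\<integral>\<^sup>+x. f x \<partial>M') \<le> liminf (\<lambda>n. \<integral>\<^sup>+x. g n x \<partial>M n)"
proof -
  define A where "A m z = {a. \<exists>U. open U \<and> z \<in> U \<and> (\<forall>n\<ge>m. \<forall>z'\<in>U. a \<le> g n z')}" for m z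
  define e where "e m z = Sup (A m z)" for m z
  have lsc: "lsc (e m)" for m
  proof (rule lsc_localI)
    fix x a assume "a < e m x"
    then obtain b U where b: "a < b" "open U" "x \<in> U" "\<forall>n\<ge>m. \<forall>z'\<in>U. b \<le> g n z'"
      unfolding e_def A_def less_Sup_iff by auto
    show "\<exists>U. open U \<and> x \<in> U \<and> (\<forall>y\<in>U. a < e m y)"
    proof (intro exI[of _ U] conjI ballI b)
      fix y assume "y \<in> U"
      then have "b \<in> A m y" unfolding A_def using b by blast
      then show "a < e m y" unfolding e_def using b(1) by (meson less_Sup_iff)
    qed
  qed
  have le: "e m z \<le> g n z" if "m \<le> n" for m n z
    unfolding e_def by (rule Sup_least) (use that in \<open>auto simp: A_def\<close>)
  have inc: "incseq e"
  proof -
    have "A m z \<subseteq> A n z" if "m \<le> n" for m n z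
      unfolding A_def using order_trans[OF that] by blast
    then show ?thesis
      unfolding incseq_def le_fun_def e_def by (auto intro!: Sup_subset_mono)
  qed
  have ge: "f z \<le> (SUP m. e m z)" for z
  proof (rule dense_le)
    fix a assume "a < f z"
    then obtain U m where U: "open U" "z \<in> U" "\<forall>n\<ge>m. \<forall>z'\<in>U. a \<le> g n z'"
      using g[of a z] unfolding eventually_sequentially by blast
    then have "a \<in> A m z" by (auto simp: A_def)
    then have "a \<le> e m z" unfolding e_def by (rule Sup_upper)
    also have "\<dots> \<le> (SUP m. e m z)" by (rule SUP_upper) simp
    finally show "a \<le> (SUP m. e m z)" .
  qed
  have "(\<integral>\<^sup>+x. f x \<partial>M') \<le> (\<integral>\<^sup>+x. (SUP m. e m x) \<partial>M')" by (intro nn_integral_mono ge)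
  also have "\<dots> = (SUP m. \<integral>\<^sup>+x. e m x \<partial>M')"
    by (rule nn_integral_monotone_convergence_SUP[OF inc])
      (intro borel_probs_measurable[OF M(2)] lsc_measurable lsc)
  also have "\<dots> \<le> liminf (\<lambda>n. \<integral>\<^sup>+x. g n x \<partial>M n)"
  proof (rule SUP_least)
    fix m
    have "(\<integral>\<^sup>+x. e m x \<partial>M') \<le> liminf (\<lambda>n. \<integral>\<^sup>+x. e m x \<partial>M n)"
      by (rule narrow_conv_lsc_liminf[OF conv M lsc])
    also have "\<dots> \<le> liminf (\<lambda>n. \<integral>\<^sup>+x. g n x \<partial>M n)"
      by (rule Liminf_mono) (auto simp: eventually_sequentially intro!: exI[of _ m] nn_integral_mono le)
    finally show "(\<integral>\<^sup>+x. e m x \<partial>M') \<le> liminf (\<lambda>n. \<integral>\<^sup>+x. g n x \<partial>M n)" .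
  qed
  finally show ?thesis .
qed

section \<open>Reading compact sets off the real line\<close>

text \<open>A continuous function of period 2 which is 0 on \<open>[0, 1/3]\<close> and 1 on \<open>[2/3, 1]\<close>.\<close>

definition schoenberg_wave :: "real \<Rightarrow> real" where
  "schoenberg_wave t = max 0 (min 1 (1/2 - cos (pi * t)))"

definition ternary_code :: "(nat \<Rightarrow> bool) \<Rightarrow> real" where
  "ternary_code b = (\<Sum>n. 2 * of_bool (b n) / 3 ^ Suc n)"

text \<open>Coordinate \<open>k\<close> of the curve reads its binary digits off the ternary digits with the numbers
  \<open>prod_encode (k, j)\<close>.\<close>

definition schoenberg_curve :: "real \<Rightarrow> nat \<Rightarrow> real" where
  "schoenberg_curve t k = (\<Sum>j. schoenberg_wave (3 ^ prod_encode (k, j) * t) / 2 ^ Suc j)"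

lemma schoenberg_wave_range: "0 \<le> schoenberg_wave t" "schoenberg_wave t \<le> 1"
  by (auto simp: schoenberg_wave_def)

lemma continuous_on_schoenberg_wave [continuous_intros]:
  fixes f :: "real \<Rightarrow> real"
  shows "continuous_on A f \<Longrightarrow> continuous_on A (\<lambda>x. schoenberg_wave (f x))"
  unfolding schoenberg_wave_def by (intro continuous_intros)

lemma ternary_sums: "(\<lambda>n. 2 / 3 ^ Suc n :: real) sums 1"
proof -
  have "(\<lambda>n. (2/3) * (1/3) ^ n :: real) sums ((2/3) * (1 / (1 - 1/3)))"
    by (intro sums_mult geometric_sums) simp
  then show ?thesis by (simp add: power_one_over field_simps)
qed

lemma summable_ternary: "summable (\<lambda>n. 2 * of_bool (b n) / 3 ^ Suc n :: real)"
  by (rule summable_comparison_test[OF _ sums_summable[OF ternary_sums]])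
    (auto intro!: exI[of _ 0])

lemma ternary_code_range: "0 \<le> ternary_code b" "ternary_code b \<le> 1"
proof -
  show "0 \<le> ternary_code b" unfolding ternary_code_def by (intro suminf_nonneg summable_ternary) auto
  have "ternary_code b \<le> (\<Sum>n. 2 / 3 ^ Suc n :: real)" unfolding ternary_code_def
    by (intro suminf_le summable_ternary sums_summable[OF ternary_sums]) auto
  then show "ternary_code b \<le> 1" using sums_unique[OF ternary_sums] by simp
qed

lemma ternary_code_rec: "3 * ternary_code b = 2 * of_bool (b 0) + ternary_code (\<lambda>n. b (Suc n))"
proof -
  have "ternary_code b = (\<Sum>n. 2 * of_bool (b (Suc n)) / 3 ^ Suc (Suc n)) + 2 * of_bool (b 0) / 3"
    unfolding ternary_code_def using suminf_split_head[OF summable_ternary[of b]] by simp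
  also have "(\<Sum>n. 2 * of_bool (b (Suc n)) / 3 ^ Suc (Suc n) :: real)
      = (\<Sum>n. (1/3) * (2 * of_bool (b (Suc n)) / 3 ^ Suc n))"
    by (simp add: field_simps)
  also have "\<dots> = (1/3) * ternary_code (\<lambda>n. b (Suc n))"
    unfolding ternary_code_def by (rule suminf_mult[OF summable_ternary])
  finally show ?thesis by simp
qed

lemma ternary_code_shift: "\<exists>m::nat. 3 ^ n * ternary_code b = 2 * real m + ternary_code (\<lambda>i. b (n + i))"
proof (induction n)
  case 0
  then show ?case by (intro exI[of _ 0]) simp
next
  case (Suc n)
  then obtain m :: nat where m: "3 ^ n * ternary_code b = 2 * real m + ternary_code (\<lambda>i. b (n + i))"
    by blast
  have "3 ^ Suc n * ternary_code b = 2 * real (3 * m) + 3 * ternary_code (\<lambda>i. b (n + i))"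
    using m by simp
  also have "\<dots> = 2 * real (3 * m + of_bool (b n)) + ternary_code (\<lambda>i. b (Suc n + i))"
    by (simp add: ternary_code_rec[of "\<lambda>i. b (n + i)"])
  finally show ?case by blast
qed

text \<open>Schoenberg's observation: up to an even integer, \<open>3 ^ n\<close> times a Cantor number lies in
  the left or the right third of the unit interval according to its \<open>n\<close>-th digit, and the wave is
  2-periodic with value 0, respectively 1, there.\<close>

lemma schoenberg_wave_ternary: "schoenberg_wave (3 ^ n * ternary_code b) = of_bool (b n)"
proof -
  obtain m :: nat where m: "3 ^ n * ternary_code b = 2 * real m + ternary_code (\<lambda>i. b (n + i))"
    using ternary_code_shift by blast
  define u where "u = ternary_code (\<lambda>i. b (n + i))"
  define v where "v = ternary_code (\<lambda>i. b (n + Suc i))"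
  have u: "3 * u = 2 * of_bool (b n) + v"
    unfolding u_def v_def using ternary_code_rec[of "\<lambda>i. b (n + i)"] by simp
  have v: "0 \<le> v" "v \<le> 1" unfolding v_def using ternary_code_range by blast+
  have "cos (pi * (2 * real m + u)) = cos (2 * real m * pi + pi * u)"
    by (simp add: algebra_simps)
  also have "\<dots> = cos (pi * u)" by (simp only: cos_add cos_2npi sin_2npi mult_1 mult_zero_left diff_zero)
  finally have c: "cos (pi * (3 ^ n * ternary_code b)) = cos (pi * u)" using m u_def by simp
  show ?thesis
  proof (cases "b n")
    case True
    then have "2/3 \<le> u" "u \<le> 1" using u v by auto
    then have "cos (pi * u) \<le> cos (pi * (2/3))"
      by (intro cos_monotone_0_pi_le) (auto simp: mult_left_le)
    also have "cos (pi * (2/3)) = cos (pi - pi/3)" by (rule arg_cong[where f=cos]) simp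
    also have "\<dots> = - (1/2)" by (simp only: cos_pi_minus cos_60)
    finally show ?thesis using True by (simp add: schoenberg_wave_def c)
  next
    case False
    then have "0 \<le> u" "u \<le> 1/3" using u v by auto
    then have "cos (pi / 3) \<le> cos (pi * u)"
      by (intro cos_monotone_0_pi_le) (auto simp: field_simps)
    then show ?thesis using False by (simp add: schoenberg_wave_def c cos_60)
  qed
qed

lemma continuous_on_schoenberg_curve: "continuous_on UNIV schoenberg_curve"
proof (rule continuous_on_coordinatewise_then_product)
  fix k
  have "uniform_limit UNIV (\<lambda>n t. \<Sum>j<n. schoenberg_wave (3 ^ prod_encode (k, j) * t) / 2 ^ Suc j)
      (\<lambda>t. \<Sum>j. schoenberg_wave (3 ^ prod_encode (k, j) * t) / 2 ^ Suc j) sequentially"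
  proof (rule Weierstrass_m_test)
    show "norm (schoenberg_wave (3 ^ prod_encode (k, j) * t) / 2 ^ Suc j) \<le> (1/2) ^ Suc j" for j t
      using schoenberg_wave_range[of "3 ^ prod_encode (k, j) * t"]
      by (simp add: power_one_over field_simps)
    show "summable (\<lambda>j. (1/2::real) ^ Suc j)"
      by (subst summable_Suc_iff) (rule summable_geometric, simp)
  qed
  then show "continuous_on UNIV (\<lambda>t. schoenberg_curve t k)"
    unfolding schoenberg_curve_def
    by (rule uniform_limit_theorem[rotated]) (auto intro!: always_eventually continuous_intros)
qed

lemma binary_expansion_sums:
  fixes q :: real
  assumes "0 \<le> q" "q < 1"
  shows "(\<lambda>j. of_bool (odd \<lfloor>2 ^ Suc j * q\<rfloor>) / 2 ^ Suc j :: real) sums q"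
proof -
  define u where "u j = real_of_int \<lfloor>2 ^ j * q\<rfloor> / 2 ^ j" for j
  have step: "of_bool (odd \<lfloor>2 ^ Suc j * q\<rfloor>) / 2 ^ Suc j = u (Suc j) - u j" for j
  proof -
    define z where "z = 2 ^ j * q"
    have "\<lfloor>2 * z\<rfloor> = 2 * \<lfloor>z\<rfloor> \<or> \<lfloor>2 * z\<rfloor> = 2 * \<lfloor>z\<rfloor> + 1" by linarith
    then have "real_of_int \<lfloor>2 * z\<rfloor> = 2 * real_of_int \<lfloor>z\<rfloor> + of_bool (odd \<lfloor>2 * z\<rfloor>)" by auto
    then show ?thesis by (simp add: u_def z_def field_simps)
  qed
  have lim: "u \<longlonglongrightarrow> q"
  proof (rule real_tendsto_sandwich)
    show "\<forall>\<^sub>F j in sequentially. q - (1/2) ^ j \<le> u j"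
    proof (rule always_eventually, rule)
      fix j
      have "2 ^ j * q - 1 \<le> real_of_int \<lfloor>2 ^ j * q\<rfloor>" by linarith
      then have "(2 ^ j * q - 1) / 2 ^ j \<le> u j" unfolding u_def by (rule divide_right_mono) simp
      then show "q - (1/2) ^ j \<le> u j" by (simp add: diff_divide_distrib power_one_over)
    qed
    show "\<forall>\<^sub>F j in sequentially. u j \<le> q"
    proof (rule always_eventually, rule)
      fix j
      have "real_of_int \<lfloor>2 ^ j * q\<rfloor> \<le> 2 ^ j * q" by linarith
      then show "u j \<le> q" by (simp add: u_def field_simps)
    qed
    have "(\<lambda>j. q - (1/2) ^ j) \<longlonglongrightarrow> q - 0" by (intro tendsto_intros LIMSEQ_power_zero) simp
    then show "(\<lambda>j. q - (1/2) ^ j) \<longlonglongrightarrow> q" by simp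
  qed simp
  have "(\<lambda>j. u (Suc j) - u j) sums (q - u 0)" by (rule telescope_sums[OF lim])
  moreover have "u 0 = 0" using assms by (simp add: u_def floor_eq_iff)
  ultimately show ?thesis by (simp only: step diff_zero)
qed

text \<open>A Borel code of the points of a separable metric space by real numbers which can be decoded
  continuously on the codes of any compact set. Distances to a dense sequence embed the space into
  \<open>[0,1) ^ \<nat>\<close>; interleaved binary digits code the image by a Cantor number, and Schoenberg's
  space-filling curve decodes it.\<close>

lemma real_code_compact_decode:
  obtains s :: "'a::{metric_space,second_countable_topology} \<Rightarrow> real" and \<theta> :: "real \<Rightarrow> 'a"
  where "s \<in> borel_measurable borel" "\<And>x. 0 \<le> s x" "\<And>x. s x \<le> 1" "\<And>x. \<theta> (s x) = x"
    "\<And>K. compact K \<Longrightarrow> \<exists>E. closed E \<and> s ` K \<subseteq> E \<and> \<theta> ` E \<subseteq> K \<and> continuous_on E \<theta>"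
proof -
  obtain D :: "'a set" where D: "countable D" "\<And>X. open X \<Longrightarrow> X \<noteq> {} \<Longrightarrow> \<exists>d\<in>D. d \<in> X"
    using countable_dense_setE by blast
  have "D \<noteq> {}" using D(2)[of UNIV] by auto
  then obtain d :: "nat \<Rightarrow> 'a" where d: "D = range d"
    using D(1) by (metis range_from_nat_into)
  define f where "f x k = dist x (d k) / (1 + dist x (d k))" for x :: 'a and k :: nat
  have pos: "1 + dist x (d k) > 0" for x k by (rule add_pos_nonneg) auto
  have f: "0 \<le> f x k" "f x k < 1" for x k using pos[of x k] by (auto simp: f_def)
  have cf: "continuous_on UNIV f"
  proof (rule continuous_on_coordinatewise_then_product)
    fix k show "continuous_on UNIV (\<lambda>x. f x k)"
      unfolding f_def using pos by (intro continuous_intros) (metis less_numeral_extra(3))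
  qed
  have inj: "inj f"
  proof (rule injI, rule ccontr)
    fix x y assume xy: "f x = f y" "x \<noteq> y"
    have "dist x (d k) = dist y (d k)" for k
    proof -
      have "f x k = f y k" using xy by simp
      then show ?thesis unfolding f_def using pos[of x k] pos[of y k] by (simp add: field_simps)
    qed
    moreover obtain k where "d k \<in> ball x (dist x y / 2)"
      using D(2)[of "ball x (dist x y / 2)"] xy d by auto
    ultimately have "dist x (d k) < dist x y / 2" "dist y (d k) < dist x y / 2" by auto
    then show False using dist_triangle2[of x y "d k"] by simp
  qed
  define b where "b x n = odd \<lfloor>2 ^ Suc (snd (prod_decode n)) * f x (fst (prod_decode n))\<rfloor>" for x n
  define s where "s x = ternary_code (b x)" for x
  define \<theta> where "\<theta> t = inv f (schoenberg_curve t)" for t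
  have dec: "schoenberg_curve (s x) = f x" for x
  proof
    fix k
    have "schoenberg_curve (s x) k = (\<Sum>j. of_bool (odd \<lfloor>2 ^ Suc j * f x k\<rfloor>) / 2 ^ Suc j)"
      unfolding schoenberg_curve_def s_def schoenberg_wave_ternary b_def by simp
    also have "\<dots> = f x k" by (rule sums_unique[symmetric]) (rule binary_expansion_sums[OF f])
    finally show "schoenberg_curve (s x) k = f x k" .
  qed
  show thesis
  proof
    have fk[measurable]: "(\<lambda>x. f x k) \<in> borel_measurable borel" for k
      by (rule borel_measurable_continuous_onI) (rule continuous_on_product_then_coordinatewise[OF cf])
    show "s \<in> borel_measurable borel"
      unfolding s_def ternary_code_def b_def by measurable
    show "0 \<le> s x" "s x \<le> 1" for x unfolding s_def by (rule ternary_code_range)+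
    show "\<theta> (s x) = x" for x unfolding \<theta>_def dec by (rule inv_f_f[OF inj])
    fix K :: "'a set" assume K: "compact K"
    define E where "E = schoenberg_curve -` (f ` K)"
    have "compact (f ` K)" by (rule compact_continuous_image[OF continuous_on_subset[OF cf] K]) simp
    then have E: "closed E" unfolding E_def
      by (intro continuous_closed_vimage compact_imp_closed)
        (use continuous_on_schoenberg_curve in \<open>auto simp: continuous_on_eq_continuous_within\<close>)
    have "continuous_on (f ` K) (inv f)"
      by (rule continuous_on_inv[OF continuous_on_subset[OF cf] K]) (auto simp: inv_f_f[OF inj])
    then have "continuous_on E \<theta>" unfolding \<theta>_def
      by (rule continuous_on_compose2) (use continuous_on_subset[OF continuous_on_schoenberg_curve] in \<open>auto simp: E_def\<close>)
    then show "\<exists>E. closed E \<and> s ` K \<subseteq> E \<and> \<theta> ` E \<subseteq> K \<and> continuous_on E \<theta>"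
      using E dec by (intro exI[of _ E]) (auto simp: E_def \<theta>_def inv_f_f[OF inj])
  qed
qed

lemma measurable_piecewise_closed:
  fixes \<theta> :: "'a::topological_space \<Rightarrow> 'b::topological_space"
  assumes "\<And>m::nat. closed (E m)" "\<And>m. continuous_on (E m) \<theta>"
  shows "(\<lambda>t. if t \<in> (\<Union>m. E m) then \<theta> t else y0) \<in> borel_measurable borel"
    (is "?g \<in> _")
proof (rule borel_measurableI)
  fix S :: "'b set" assume "open S"
  have EM: "E m \<in> sets borel" for m by (rule borel_closed[OF assms(1)])
  have "{t \<in> E m. \<theta> t \<in> S} \<in> sets borel" for m
  proof -
    have "\<forall>B. open B \<longrightarrow> (\<exists>A. open A \<and> A \<inter> E m = \<theta> -` B \<inter> E m)"
      using assms(2)[of m] unfolding continuous_on_open_invariant .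
    then obtain T where T: "open T" "T \<inter> E m = \<theta> -` S \<inter> E m"
      using \<open>open S\<close> by metis
    have "{t \<in> E m. \<theta> t \<in> S} = T \<inter> E m" using T(2) by auto
    then show ?thesis using sets.Int[OF borel_open[OF T(1)] EM] by simp
  qed
  then have 1: "(\<Union>m. {t \<in> E m. \<theta> t \<in> S}) \<in> sets borel" by (intro sets.countable_UN) auto
  have 2: "(if y0 \<in> S then - (\<Union>m. E m) else {}) \<in> sets borel"
  proof -
    have "(\<Union>m. E m) \<in> sets borel" using EM by (intro sets.countable_UN) auto
    then show ?thesis using borel_comp[of "\<Union>m. E m"] by (simp del: Compl_UN)
  qed
  have "?g -` S \<inter> space borel = (\<Union>m. {t \<in> E m. \<theta> t \<in> S}) \<union> (if y0 \<in> S then - (\<Union>m. E m) else {})"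
    by (rule set_eqI) (simp split: if_splits, blast)
  then show "?g -` S \<inter> space borel \<in> sets borel" using sets.Un[OF 1 2] by simp
qed

lemma closed_projection_compact:
  fixes C :: "('a::metric_space \<times> 'b::metric_space) set"
  assumes "closed C" "compact K"
  shows "closed {x. \<exists>y\<in>K. (x, y) \<in> C}"
  unfolding closed_sequential_limits
proof (intro allI impI)
  fix x :: "nat \<Rightarrow> 'a" and l assume "(\<forall>n. x n \<in> {x. \<exists>y\<in>K. (x, y) \<in> C}) \<and> x \<longlonglongrightarrow> l"
  then obtain y where y: "\<And>n. y n \<in> K" "\<And>n. (x n, y n) \<in> C" and x: "x \<longlonglongrightarrow> l" by simp metis
  obtain l' r where r: "l' \<in> K" "strict_mono r" "(y \<circ> r) \<longlonglongrightarrow> l'"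
    using assms(2) y(1) unfolding compact_def by metis
  have "(\<lambda>n. ((x \<circ> r) n, (y \<circ> r) n)) \<longlonglongrightarrow> (l, l')"
    by (intro tendsto_Pair r LIMSEQ_subseq_LIMSEQ[OF x r(2)])
  then have "(l, l') \<in> C"
    using closed_sequentially[OF assms(1), of "\<lambda>n. ((x \<circ> r) n, (y \<circ> r) n)"] y by auto
  then show "l \<in> {x. \<exists>y\<in>K. (x, y) \<in> C}" using r by auto
qed

text \<open>Borel uniformisation of a closed set with compact fibres: among the real codes of the points
  of a fibre there is a smallest one, and it depends on the base point in a lower semicontinuous
  way because its sublevel sets are projections along a compact set.\<close>

lemma closed_compact_selection:
  fixes G :: "('a::metric_space \<times> 'b::{metric_space,second_countable_topology}) set"
  assumes G: "closed G" and K: "compact K"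
  obtains T where "T \<in> measurable borel borel" "\<And>x. \<exists>y\<in>K. (x, y) \<in> G \<Longrightarrow> T x \<in> K \<and> (x, T x) \<in> G"
proof -
  obtain s :: "'b \<Rightarrow> real" and \<theta> where s: "\<And>x. 0 \<le> s x" "\<And>x. s x \<le> 1" "\<And>x. \<theta> (s x) = x"
    and dec: "\<And>K. compact K \<Longrightarrow> \<exists>E. closed E \<and> s ` K \<subseteq> E \<and> \<theta> ` E \<subseteq> K \<and> continuous_on E \<theta>"
    using real_code_compact_decode by metis
  obtain E0 where E0: "closed E0" "s ` K \<subseteq> E0" "\<theta> ` E0 \<subseteq> K" "continuous_on E0 \<theta>" using dec[OF K] by blast
  define E where "E = E0 \<inter> {0..1}"
  have E: "compact E" unfolding E_def by (intro closed_Int_compact E0) simp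
  have cE: "continuous_on E \<theta>" by (rule continuous_on_subset[OF E0(4)]) (simp add: E_def)
  define D where "D = {x. \<exists>y\<in>K. (x, y) \<in> G}"
  define C where "C a = {(x, u). u \<in> E \<inter> {..a} \<and> (x, \<theta> u) \<in> G}" for a
  have C: "closed (C a)" for a
  proof -
    have "continuous_on (UNIV \<times> (E \<inter> {..a})) (\<lambda>z::'a \<times> real. (fst z, \<theta> (snd z)))"
      by (intro continuous_intros continuous_on_compose2[OF cE]) auto
    moreover have "closed (UNIV \<times> (E \<inter> {..a}) :: ('a \<times> real) set)"
      by (intro closed_Times closed_Int compact_imp_closed[OF E]) auto
    ultimately have "closed ((\<lambda>z. (fst z, \<theta> (snd z))) -` G \<inter> (UNIV \<times> (E \<inter> {..a})))"
      by (metis G continuous_closed_preimage inf_commute)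
    also have "(\<lambda>z. (fst z, \<theta> (snd z))) -` G \<inter> (UNIV \<times> (E \<inter> {..a})) = C a"
      by (auto simp: C_def)
    finally show ?thesis .
  qed
  define S where "S x = {u \<in> E. (x, \<theta> u) \<in> G}" for x
  have ClS: "compact (S x)" for x
  proof -
    have "S x = E \<inter> (\<lambda>u. (x, u)) -` C 1" by (auto simp: S_def C_def E_def)
    then show ?thesis
      using compact_Int_closed[OF E closed_vimage[OF C[of 1], of "\<lambda>u. (x, u)"]]
      by (simp add: continuous_on_Pair)
  qed
  have Sne: "S x \<noteq> {} \<longleftrightarrow> x \<in> D" for x
  proof
    assume "S x \<noteq> {}"
    then show "x \<in> D" using E0(3) by (auto simp: S_def D_def E_def)
  next
    assume "x \<in> D"
    then obtain y where "y \<in> K" "(x, y) \<in> G" by (auto simp: D_def)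
    then have "s y \<in> S x" using E0(2) s by (auto simp: S_def E_def)
    then show "S x \<noteq> {}" by blast
  qed
  define t where "t x = (if x \<in> D then Inf (S x) else 2)" for x
  have tS: "t x \<in> S x" if "x \<in> D" for x
    unfolding t_def using that Sne ClS
    by (auto intro!: closed_contains_Inf compact_imp_closed bounded_imp_bdd_below compact_imp_bounded)
  have tle: "t x \<le> u" if "u \<in> S x" for x u
  proof -
    have "x \<in> D" using that Sne by blast
    then show ?thesis unfolding t_def using that ClS
      by (auto intro!: cInf_lower bounded_imp_bdd_below compact_imp_bounded)
  qed
  have DB: "D \<in> sets borel"
    unfolding D_def by (rule borel_closed) (rule closed_projection_compact[OF G K])
  have tm: "t \<in> borel_measurable borel"
  proof (rule borel_measurableI_le)
    fix a
    have "{x \<in> space borel. t x \<le> a} = {x. \<exists>u\<in>E. (x, u) \<in> C a} \<union> (if 2 \<le> a then - D else {})"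
    proof -
      have "t x \<le> a \<longleftrightarrow> (\<exists>u\<in>E. (x, u) \<in> C a)" if "x \<in> D" for x
        using tS[OF that] tle[of _ x] by (force simp: C_def S_def)
      moreover have "\<not> (\<exists>u\<in>E. (x, u) \<in> C a)" if "x \<notin> D" for x
        using that Sne[of x] by (auto simp: C_def S_def)
      ultimately show ?thesis by (auto simp: t_def)
    qed
    moreover have "{x. \<exists>u\<in>E. (x, u) \<in> C a} \<in> sets borel"
      by (rule borel_closed) (rule closed_projection_compact[OF C E])
    ultimately show "{x \<in> space borel. t x \<le> a} \<in> sets borel" using DB by auto
  qed
  define T where "T x = (if t x \<in> (\<Union>m::nat. E) then \<theta> (t x) else undefined)" for x
  have "(\<lambda>t. if t \<in> (\<Union>m::nat. E) then \<theta> t else undefined) \<in> borel_measurable borel"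
    by (rule measurable_piecewise_closed) (auto intro: compact_imp_closed E cE)
  then have "T \<in> measurable borel borel"
    unfolding T_def using measurable_compose[OF tm] by simp
  moreover have "T x \<in> K \<and> (x, T x) \<in> G" if "\<exists>y\<in>K. (x, y) \<in> G" for x
  proof -
    have "t x \<in> S x" by (rule tS) (use that in \<open>simp add: D_def\<close>)
    then show ?thesis using E0(3) by (auto simp: T_def S_def E_def)
  qed
  ultimately show thesis by (rule that)
qed

section \<open>Prokhorov's theorem\<close>

lemma integral_diff_le_off_set:
  fixes u v :: "'a \<Rightarrow> real"
  assumes "prob_space M" "u \<in> borel_measurable M" "v \<in> borel_measurable M" "S \<in> sets M"
    and b: "\<And>x. \<bar>u x\<bar> \<le> B" "\<And>x. \<bar>v x\<bar> \<le> B" and eq: "\<And>x. x \<in> S \<Longrightarrow> u x = v x"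
  shows "\<bar>(\<integral>x. u x \<partial>M) - (\<integral>x. v x \<partial>M)\<bar> \<le> 2 * B * measure M (space M - S)"
proof -
  interpret prob_space M by fact
  have [measurable]: "S \<in> sets M" "u \<in> borel_measurable M" "v \<in> borel_measurable M" by fact+
  have i: "integrable M u" "integrable M v"
    by (rule integrable_const_bound[where B=B]; use b in auto)+
  have "\<bar>(\<integral>x. u x \<partial>M) - (\<integral>x. v x \<partial>M)\<bar> = \<bar>\<integral>x. u x - v x \<partial>M\<bar>" using i by simp
  also have "\<dots> \<le> (\<integral>x. \<bar>u x - v x\<bar> \<partial>M)" by (rule integral_abs_bound)
  also have "\<dots> \<le> (\<integral>x. 2 * B * indicator (space M - S) x \<partial>M)"
  proof (rule integral_mono)
    show "integrable M (\<lambda>x. \<bar>u x - v x\<bar>)" using i by auto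
    show "integrable M (\<lambda>x. 2 * B * indicator (space M - S) x :: real)"
      by (intro integrable_mult_right integrable_real_indicator) (auto simp: emeasure_eq_measure)
    fix x assume "x \<in> space M"
    then show "\<bar>u x - v x\<bar> \<le> 2 * B * indicator (space M - S) x"
      using b(1)[of x] b(2)[of x] eq[of x] by (auto simp: indicator_def)
  qed
  also have "\<dots> = 2 * B * measure M (space M - S)" by simp
  finally show ?thesis .
qed

lemma lsc_indicator_open:
  assumes "open U"
  shows "lsc (\<lambda>x. indicator U x :: ennreal)"
proof (rule lsc_localI)
  fix x and a :: ennreal assume a: "a < indicator U x"
  then have "x \<in> U" "a < 1" by (cases "x \<in> U"; simp)+
  then show "\<exists>U'. open U' \<and> x \<in> U' \<and> (\<forall>y\<in>U'. a < indicator U y)"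
    using assms by (intro exI[of _ U]) auto
qed

lemma narrow_conv_open_liminf:
  fixes U :: "'a::metric_space set"
  assumes "narrow_conv M M'" "\<And>n. M n \<in> borel_probs" "M' \<in> borel_probs" "open U"
  shows "emeasure M' U \<le> liminf (\<lambda>n. emeasure (M n) U)"
proof -
  from narrow_conv_lsc_liminf[OF assms(1-3) lsc_indicator_open[OF assms(4)]] show ?thesis
    using assms(4) borel_probsD(2)[OF assms(2)] borel_probsD(2)[OF assms(3)] by simp
qed

text \<open>The codes of the points turn the given measures into measures on the unit interval, where
  Helly's selection theorem applies. Decoding is continuous on the codes of the compact sets that
  carry most of the mass, so by Tietze's theorem every bounded continuous function is, up to a
  small error, a continuous function of the code.\<close>

theorem Prokhorov:
  fixes M :: "nat \<Rightarrow> 'a::{metric_space,second_countable_topology} measure"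
  assumes M: "\<And>n. M n \<in> borel_probs"
    and tight: "\<And>e::real. 0 < e \<Longrightarrow> \<exists>K. compact K \<and> (\<forall>\<^sub>F n in sequentially. measure (M n) (- K) \<le> e)"
  obtains r :: "nat \<Rightarrow> nat" and M' where "strict_mono r" "M' \<in> borel_probs" "narrow_conv (M \<circ> r) M'"
proof -
  obtain s :: "'a \<Rightarrow> real" and \<theta> where sm[measurable]: "s \<in> borel_measurable borel"
    and s: "\<And>x. 0 \<le> s x" "\<And>x. s x \<le> 1" "\<And>x. \<theta> (s x) = x"
    and dec: "\<And>K. compact K \<Longrightarrow> \<exists>E. closed E \<and> s ` K \<subseteq> E \<and> \<theta> ` E \<subseteq> K \<and> continuous_on E \<theta>"
    using real_code_compact_decode by metis
  have "\<exists>K E. compact K \<and> (\<forall>\<^sub>F n in sequentially. measure (M n) (- K) \<le> inverse (real (Suc m))) \<and>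
      closed E \<and> s ` K \<subseteq> E \<and> continuous_on E \<theta>" for m
    using tight[of "inverse (real (Suc m))"] dec by fastforce
  then obtain K E where K: "\<And>m. compact (K m)"
      "\<And>m. \<forall>\<^sub>F n in sequentially. measure (M n) (- K m) \<le> inverse (real (Suc m))"
    and E: "\<And>m. closed (E m)" "\<And>m. s ` K m \<subseteq> E m" "\<And>m. continuous_on (E m) \<theta>"
    by metis
  have [measurable]: "K m \<in> sets borel" "E m \<in> sets borel" for m
    using K(1) E(1) by (auto intro: borel_closed compact_imp_closed)
  note mM = borel_probs_measurable[OF M]
  define N where "N n = distr (M n) borel s" for n
  have Nr: "real_distribution (N n)" for n
    unfolding N_def
    by (intro prob_space.real_distribution_distr borel_probsD(1)[OF M] mM sm)
  have "tight N"
    unfolding tight_def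
  proof (intro conjI allI impI Nr)
    fix \<epsilon> :: real assume "0 < \<epsilon>"
    have "measure (N n) {-1<..1} = 1" for n
    proof -
      have "s -` {-1<..1} \<inter> space (M n) = UNIV"
      proof -
      have "-1 < s x" for x using s(1)[of x] by linarith
      then show ?thesis using s(2) borel_probsD(3)[OF M] by auto
    qed
      then have "measure (N n) {-1<..1} = measure (M n) UNIV"
        unfolding N_def by (subst measure_distr) (auto intro: mM)
      then show ?thesis using borel_probsD(4)[OF M[of n]] by (simp add: measure_def)
    qed
    then show "\<exists>a b. a < b \<and> (\<forall>n. 1 - \<epsilon> < measure (N n) {a<..b})"
      using \<open>0 < \<epsilon>\<close> by (intro exI[of _ "-1"] exI[of _ 1]) auto
  qed
  then obtain r N' where r: "strict_mono (r::nat\<Rightarrow>nat)" and N': "real_distribution N'" "weak_conv_m (N \<circ> id \<circ> r) N'"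
    using tight_imp_convergent_subsubsequence[of N id] by (auto simp: strict_mono_def)
  interpret N': real_distribution N' by fact
  have Nb: "N n \<in> borel_probs" "N' \<in> borel_probs" for n
    using Nr[of n] N'(1) by (auto simp: borel_probs_def real_distribution_def real_distribution_axioms_def)
  have Nint: "(\<lambda>n. \<integral>x. g x \<partial>N (r n)) \<longlonglongrightarrow> (\<integral>x. g x \<partial>N')"
    if "continuous_on UNIV g" "\<And>x. \<bar>g x\<bar> \<le> B" for g :: "real \<Rightarrow> real" and B
    using weak_conv_imp_integral_bdd_continuous_conv[of "N \<circ> id \<circ> r" N' g B] Nr N' that
    by (auto simp: continuous_on_eq_continuous_at)
  have Nconv: "narrow_conv (N \<circ> r) N'"
    unfolding narrow_conv_def
  proof (intro allI impI)
    fix g :: "real \<Rightarrow> real" assume g: "continuous_on UNIV g \<and> bounded (range g)"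
    then obtain B where "\<And>x. \<bar>g x\<bar> \<le> B" unfolding bounded_iff by auto
    then show "(\<lambda>n. \<integral>x. g x \<partial>(N \<circ> r) n) \<longlonglongrightarrow> (\<integral>x. g x \<partial>N')" using Nint g by auto
  qed
  \<comment> \<open>The decoding map is under control only on the codes of the compact sets, which carry the limit.\<close>
  define \<theta>' where "\<theta>' t = (if t \<in> (\<Union>m. E m) then \<theta> t else undefined)" for t
  have \<theta>m[measurable]: "\<theta>' \<in> measurable borel borel"
    unfolding \<theta>'_def by (rule measurable_piecewise_closed[OF E(1,3)])
  define M' where "M' = distr N' borel \<theta>'"
  have M': "M' \<in> borel_probs"
    unfolding M'_def borel_probs_def by (auto intro!: N'.prob_space_distr)
  have off: "measure N' (- E m) \<le> inverse (real (Suc m))" for m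
  proof -
    have "emeasure N' (- E m) \<le> liminf (\<lambda>n. emeasure ((N \<circ> r) n) (- E m))"
      by (rule narrow_conv_open_liminf[OF Nconv]) (use Nb E(1) in auto)
    also have "\<dots> \<le> liminf (\<lambda>n. ennreal (inverse (real (Suc m))))"
    proof (rule Liminf_mono)
      have "\<forall>\<^sub>F n in sequentially. measure (M (r n)) (- K m) \<le> inverse (real (Suc m))"
        by (rule eventually_subseq[OF r K(2)])
      then show "\<forall>\<^sub>F n in sequentially. emeasure ((N \<circ> r) n) (- E m) \<le> ennreal (inverse (real (Suc m)))"
      proof eventually_elim
        case (elim n)
        have "emeasure ((N \<circ> r) n) (- E m) = emeasure (M (r n)) (s -` (- E m) \<inter> space (M (r n)))"
          by (simp add: N_def, subst emeasure_distr) (auto intro: mM)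
        also have "\<dots> \<le> emeasure (M (r n)) (- K m)"
          by (rule emeasure_mono) (use E(2) borel_probsD(2)[OF M] in auto)
        also have "\<dots> = ennreal (measure (M (r n)) (- K m))"
          using borel_probsD(5)[OF M] by (simp add: finite_measure.emeasure_eq_measure)
        finally show ?case using elim by (meson ennreal_leI order_trans)
      qed
    qed
    also have "\<dots> = ennreal (inverse (real (Suc m)))" by (simp add: Liminf_const)
    finally show ?thesis by (simp add: N'.emeasure_eq_measure)
  qed
  have "narrow_conv (M \<circ> r) M'"
    unfolding narrow_conv_def
  proof (intro allI impI)
    fix h :: "'a \<Rightarrow> real" assume h: "continuous_on UNIV h \<and> bounded (range h)"
    then obtain B where B: "\<And>x. \<bar>h x\<bar> \<le> B" unfolding bounded_iff by auto
    have B0: "0 \<le> B" using B[of undefined] by linarith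
    have [measurable]: "h \<in> borel_measurable borel" using h by (auto intro: borel_measurable_continuous_onI)
    show "(\<lambda>n. \<integral>x. h x \<partial>(M \<circ> r) n) \<longlonglongrightarrow> (\<integral>x. h x \<partial>M')"
    proof (rule LIMSEQ_I)
      fix e :: real assume e: "0 < e"
      obtain m where m: "inverse (real (Suc m)) < e / (6 * (B + 1))"
        using reals_Archimedean[of "e / (6 * (B + 1))"] e B0 by auto
      have small: "2 * B * x < e / 3" if "x \<le> inverse (real (Suc m))" for x
      proof -
        have "2 * B * x \<le> 2 * B * inverse (real (Suc m))" using that B0 by (intro mult_left_mono) auto
        also have "\<dots> \<le> (2 * (B + 1)) * inverse (real (Suc m))" using B0 by (intro mult_right_mono) auto
        also have "\<dots> < (2 * (B + 1)) * (e / (6 * (B + 1)))" using m B0 by (intro mult_strict_left_mono) auto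
        also have "\<dots> = e / 3" using B0 by (simp add: field_simps)
        finally show ?thesis .
      qed
      have "continuous_on (E m) (\<lambda>t. h (\<theta> t))"
        by (rule continuous_on_compose2[OF _ E(3)]) (use h in auto)
      then obtain g where g: "continuous_on UNIV g" "\<And>t. t \<in> E m \<Longrightarrow> g t = h (\<theta> t)" "\<And>t. \<bar>g t\<bar> \<le> B"
        using Tietze[of "E m" "\<lambda>t. h (\<theta> t)" UNIV B] E(1) B0 B by auto
      have [measurable]: "g \<in> borel_measurable borel" using g by (auto intro: borel_measurable_continuous_onI)
      have "(\<lambda>n. \<integral>x. g x \<partial>N (r n)) \<longlonglongrightarrow> (\<integral>x. g x \<partial>N')" by (rule Nint[OF g(1,3)])
      then have "\<forall>\<^sub>F n in sequentially. \<bar>(\<integral>x. g x \<partial>N (r n)) - (\<integral>x. g x \<partial>N')\<bar> < e / 3"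
        using tendstoD[of _ _ _ "e/3"] e by (fastforce simp: dist_real_def)
      moreover have "\<forall>\<^sub>F n in sequentially. measure (M (r n)) (- K m) \<le> inverse (real (Suc m))"
        by (rule eventually_subseq[OF r K(2)])
      ultimately have "\<forall>\<^sub>F n in sequentially. norm ((\<integral>x. h x \<partial>(M \<circ> r) n) - (\<integral>x. h x \<partial>M')) < e"
      proof eventually_elim
        case (elim n)
        have sp: "space (M (r n)) = UNIV" by (rule borel_probsD(3)[OF M])
        have 1: "\<bar>(\<integral>x. h x \<partial>M (r n)) - (\<integral>x. g (s x) \<partial>M (r n))\<bar> \<le> 2 * B * measure (M (r n)) (space (M (r n)) - K m)"
          by (rule integral_diff_le_off_set)
            (use B g E(2)[of m] s(3) borel_probsD(1)[OF M] borel_probsD(2)[OF M] in \<open>auto intro!: mM simp: image_subset_iff\<close>)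
        have 2: "\<bar>(\<integral>x. h (\<theta>' x) \<partial>N') - (\<integral>x. g x \<partial>N')\<bar> \<le> 2 * B * measure N' (space N' - E m)"
          by (rule integral_diff_le_off_set) (use B g in \<open>auto simp: \<theta>'_def[symmetric] N'.prob_space_axioms, auto simp: \<theta>'_def\<close>)
        have eq1: "(\<integral>x. g x \<partial>N (r n)) = (\<integral>x. g (s x) \<partial>M (r n))"
          unfolding N_def by (rule integral_distr) (auto intro: mM)
        have eq2: "(\<integral>x. h x \<partial>M') = (\<integral>x. h (\<theta>' x) \<partial>N')"
          unfolding M'_def by (rule integral_distr) auto
        have eq3: "space N' - E m = - E m" "space (M (r n)) - K m = - K m"
          using sp by (auto simp: Compl_eq_Diff_UNIV)
        show ?case
          using 1[unfolded eq3] 2[unfolded eq3] eq1 eq2 elim(1) small[OF elim(2)] small[OF off[of m]]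
          unfolding real_norm_def comp_def by linarith
      qed
      then show "\<exists>no. \<forall>n\<ge>no. norm ((\<integral>x. h x \<partial>(M \<circ> r) n) - (\<integral>x. h x \<partial>M')) < e"
        by (simp add: eventually_sequentially)
    qed
  qed
  with r M' show thesis by (rule that)
qed

section \<open>Minimisation of coercive lower semicontinuous functions\<close>

lemma lsc_attains_min:
  fixes f :: "'a::topological_space \<Rightarrow> ennreal"
  assumes f: "lsc f" and coercive: "\<And>a. a < top \<Longrightarrow> \<exists>K. compact K \<and> {x. f x \<le> a} \<subseteq> K"
  shows "\<exists>x. \<forall>z. f x \<le> f z"
proof (cases "\<exists>x0. f x0 < top")
  case False
  then show ?thesis by (auto simp: not_less top_unique)
next
  case True
  then obtain x0 where x0: "f x0 < top" by blast
  then obtain K where K: "compact K" "{x. f x \<le> f x0} \<subseteq> K" using coercive by blast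
  define F where "F = (\<lambda>z. {x. f x \<le> f z}) ` {z. f z \<le> f x0}"
  have "K \<inter> \<Inter>F \<noteq> {}"
  proof (rule compact_imp_fip[OF K(1)])
    show "closed T" if "T \<in> F" for T using that lsc_closed_le[OF f] by (auto simp: F_def)
    fix F' assume "finite F'" "F' \<subseteq> F"
    then obtain Z where Z: "finite Z" "Z \<subseteq> {z. f z \<le> f x0}" "F' = (\<lambda>z. {x. f x \<le> f z}) ` Z"
      unfolding F_def by (meson finite_subset_image)
    show "K \<inter> \<Inter>F' \<noteq> {}"
    proof (cases "Z = {}")
      case True
      then show ?thesis using Z K by auto
    next
      case False
      then have "Min (f ` Z) \<in> f ` Z" using Z(1) by (intro Min_in) auto
      then obtain z where z: "z \<in> Z" "f z = Min (f ` Z)" by auto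
      then have "\<forall>w\<in>Z. f z \<le> f w" using Z(1) by simp
      then have "z \<in> K \<inter> \<Inter>F'" using Z z K by auto
      then show ?thesis by blast
    qed
  qed
  then obtain x where x: "\<And>z. f z \<le> f x0 \<Longrightarrow> f x \<le> f z" by (auto simp: F_def)
  have "f x \<le> f z" for z
    using x[of z] x[of x0] by (cases "f z \<le> f x0") auto
  then show ?thesis by blast
qed

text \<open>The superlevel sets of a partial infimum are open because its sublevel sets are projections
  along compact sets.\<close>

lemma lsc_partial_INF:
  fixes G :: "'a::metric_space \<times> 'b::metric_space \<Rightarrow> ennreal"
  assumes G: "lsc G"
    and coercive: "\<And>a. a < top \<Longrightarrow> \<exists>K. compact K \<and> (\<forall>x y. G (x, y) \<le> a \<longrightarrow> y \<in> K)"
  shows "lsc (\<lambda>x. INF y. G (x, y))" "\<exists>y. G (x, y) = (INF y. G (x, y))"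
proof -
  have att: "\<exists>y. G (x, y) = (INF y. G (x, y))" for x
  proof -
    have "\<exists>y. \<forall>z. G (x, y) \<le> G (x, z)"
    proof (rule lsc_attains_min)
      show "lsc (\<lambda>y. G (x, y))" by (rule lsc_compose[OF G]) (intro continuous_intros)
      show "\<exists>K. compact K \<and> {y. G (x, y) \<le> a} \<subseteq> K" if "a < top" for a
        using coercive[OF that] by blast
    qed
    then obtain y where "\<And>z. G (x, y) \<le> G (x, z)" by blast
    then show ?thesis by (metis INF_greatest INF_lower UNIV_I antisym)
  qed
  then show "\<exists>y. G (x, y) = (INF y. G (x, y))" .
  show "lsc (\<lambda>x. INF y. G (x, y))"
    unfolding lsc_def
  proof
    fix a show "open {x. a < (INF y. G (x, y))}"
    proof (cases "a < top")
      case False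
      then have "{x. a < (INF y. G (x, y))} = {}" by (auto simp: not_less top_unique)
      then show ?thesis by (simp only: open_empty)
    next
      case True
      then obtain K where K: "compact K" "\<And>x y. G (x, y) \<le> a \<Longrightarrow> y \<in> K" using coercive by blast
      have "(INF y. G (x, y)) \<le> a \<longleftrightarrow> (\<exists>y\<in>K. (x, y) \<in> {z. G z \<le> a})" for x
      proof
        assume "(INF y. G (x, y)) \<le> a"
        moreover obtain y where "G (x, y) = (INF y. G (x, y))" using att by blast
        ultimately have "G (x, y) \<le> a" by simp
        then show "\<exists>y\<in>K. (x, y) \<in> {z. G z \<le> a}" using K(2) by auto
      next
        assume "\<exists>y\<in>K. (x, y) \<in> {z. G z \<le> a}"
        then show "(INF y. G (x, y)) \<le> a" by (auto intro: INF_lower2)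
      qed
      then have "{x. a < (INF y. G (x, y))} = - {x. \<exists>y\<in>K. (x, y) \<in> {z. G z \<le> a}}"
        by (auto simp: not_le[symmetric])
      then show ?thesis
        using closed_projection_compact[OF lsc_closed_le[OF G] K(1)] by (simp only: open_Compl)
    qed
  qed
qed

lemma Hcal_iterated:
  fixes H :: "'b::second_countable_topology \<times> 'b \<Rightarrow> ennreal"
  assumes "H \<in> borel_measurable borel" "\<nu> \<in> borel_probs" "\<nu>' \<in> borel_probs"
  shows "Hcal H \<nu> \<nu>' = (\<integral>\<^sup>+y. \<integral>\<^sup>+y'. H (y, y') \<partial>\<nu>' \<partial>\<nu>)"
proof -
  interpret sigma_finite_measure \<nu>' using borel_probsD[OF assms(3)] by simp
  have s: "sets (\<nu> \<Otimes>\<^sub>M \<nu>') = sets (borel \<Otimes>\<^sub>M borel)"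
    using borel_probsD(2)[OF assms(2)] borel_probsD(2)[OF assms(3)] by (rule sets_pair_measure_cong)
  have "H \<in> borel_measurable (\<nu> \<Otimes>\<^sub>M \<nu>')"
    unfolding measurable_cong_sets[OF s refl] borel_prod by (rule assms(1))
  then show ?thesis unfolding Hcal_def by (simp add: nn_integral_fst)
qed

lemma borel_measurable_section_integral:
  fixes H :: "'a::second_countable_topology \<times> 'b::second_countable_topology \<Rightarrow> ennreal"
  assumes "H \<in> borel_measurable borel" "\<nu> \<in> borel_probs"
  shows "(\<lambda>y. \<integral>\<^sup>+y'. H (y, y') \<partial>\<nu>) \<in> borel_measurable borel"
proof -
  interpret sigma_finite_measure \<nu> using borel_probsD[OF assms(2)] by simp
  have s: "sets (borel \<Otimes>\<^sub>M \<nu>) = sets (borel \<Otimes>\<^sub>M borel)"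
    using borel_probsD(2)[OF assms(2)] by (intro sets_pair_measure_cong) auto
  have "H \<in> borel_measurable (borel \<Otimes>\<^sub>M \<nu>)"
    unfolding measurable_cong_sets[OF s refl] borel_prod by (rule assms(1))
  then show ?thesis by (rule borel_measurable_nn_integral_fst)
qed

lemma section_measurable:
  fixes f :: "'a::second_countable_topology \<times> 'b::second_countable_topology \<Rightarrow> ennreal"
  assumes "f \<in> borel_measurable borel"
  shows "(\<lambda>y. f (x, y)) \<in> borel_measurable borel"
proof -
  have "f \<in> borel_measurable (borel \<Otimes>\<^sub>M borel)" using assms by (simp add: borel_prod)
  then show ?thesis by measurable
qed

lemma return_borel_probs: "return borel y \<in> borel_probs"
  by (auto simp: borel_probs_def intro!: prob_space_return)

lemma ennreal_2_over_nat: "1 \<le> N \<Longrightarrow> 2 / of_nat N = ennreal (2 / real N)"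
  using divide_ennreal[of 2 "real N"] by (simp add: ennreal_of_nat_eq_real_of_nat)

section \<open>Equilibria of the finite game\<close>

locale game_costs =
  fixes c :: "'a::polish_space \<times> 'b::polish_space \<Rightarrow> ennreal"
    and L :: "'b \<Rightarrow> ennreal"
    and H :: "'b \<times> 'b \<Rightarrow> ennreal"
  assumes lsc_c: "lsc c" and lsc_L: "lsc L" and lsc_H: "lsc H"
    and sym_H: "H (y, y') = H (y', y)"
    and compact_L: "0 < (a::real) \<Longrightarrow> compact {y. L y \<le> ennreal a}"
begin

lemma measurable_costs [measurable]:
  "c \<in> borel_measurable borel" "L \<in> borel_measurable borel" "H \<in> borel_measurable borel"
  using lsc_c lsc_L lsc_H by (auto intro: lsc_measurable)

lemma compact_sublevel_L:
  assumes "a < top"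
  shows "\<exists>K. compact K \<and> (\<forall>y. L y \<le> a \<longrightarrow> y \<in> K)"
proof -
  obtain r where r: "0 \<le> r" "a = ennreal r" using assms by (cases a) auto
  have "compact {y. L y \<le> ennreal (r + 1)}" using r by (intro compact_L) simp
  moreover have "L y \<le> ennreal (r + 1)" if "L y \<le> a" for y
    using that unfolding r(2) by (rule order_trans) (simp add: r(1) ennreal_leI)
  ultimately show ?thesis by blast
qed

text \<open>The marginal cost of a pure strategy of player \<open>i\<close>; the cost of a mixed strategy is its
  integral.\<close>

definition player_field :: "(nat \<Rightarrow> 'a) \<Rightarrow> nat \<Rightarrow> nat \<Rightarrow> (nat \<Rightarrow> 'b measure) \<Rightarrow> 'b \<Rightarrow> ennreal" where
  "player_field x N i \<nu> z =
    c (x i, z) + L z + (2 / of_nat N) * (\<Sum>j\<in>{1..N} - {i}. \<integral>\<^sup>+y'. H (z, y') \<partial>\<nu> j)"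

lemma player_cost_eq_integral:
  assumes i: "i \<in> {1..N}" and \<nu>: "\<And>j. j \<in> {1..N} \<Longrightarrow> \<nu> j \<in> borel_probs"
  shows "player_cost c L H x N i \<nu> = (\<integral>\<^sup>+z. player_field x N i \<nu> z \<partial>\<nu> i)"
proof -
  note m = borel_probs_measurable[OF \<nu>[OF i]]
  have 1: "(\<lambda>y. c (x i, y)) \<in> borel_measurable (\<nu> i)" "L \<in> borel_measurable (\<nu> i)"
    by (intro m section_measurable measurable_costs)+
  have 2: "(\<lambda>z. \<integral>\<^sup>+y'. H (z, y') \<partial>\<nu> j) \<in> borel_measurable (\<nu> i)" if "j \<in> {1..N}" for j
    by (intro m borel_measurable_section_integral measurable_costs \<nu> that)
  have 3: "(\<lambda>z. \<Sum>j\<in>{1..N} - {i}. \<integral>\<^sup>+y'. H (z, y') \<partial>\<nu> j) \<in> borel_measurable (\<nu> i)"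
    by (intro borel_measurable_sum 2) auto
  have "(\<integral>\<^sup>+z. player_field x N i \<nu> z \<partial>\<nu> i) =
      (\<integral>\<^sup>+z. c (x i, z) \<partial>\<nu> i) + (\<integral>\<^sup>+z. L z \<partial>\<nu> i)
      + (2 / of_nat N) * (\<integral>\<^sup>+z. (\<Sum>j\<in>{1..N} - {i}. \<integral>\<^sup>+y'. H (z, y') \<partial>\<nu> j) \<partial>\<nu> i)"
    unfolding player_field_def using 1 3 by (simp add: nn_integral_add nn_integral_cmult)
  also have "(\<integral>\<^sup>+z. (\<Sum>j\<in>{1..N} - {i}. \<integral>\<^sup>+y'. H (z, y') \<partial>\<nu> j) \<partial>\<nu> i)
      = (\<Sum>j\<in>{1..N} - {i}. \<integral>\<^sup>+z. \<integral>\<^sup>+y'. H (z, y') \<partial>\<nu> j \<partial>\<nu> i)"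
    by (rule nn_integral_sum) (use 2 in auto)
  also have "\<dots> = (\<Sum>j\<in>{1..N} - {i}. Hcal H (\<nu> i) (\<nu> j))"
    by (rule sum.cong[OF refl]) (use \<nu> i in \<open>auto intro!: Hcal_iterated[symmetric]\<close>)
  finally show ?thesis by (simp add: player_cost_def Lcal_def)
qed

lemma player_field_cong:
  "(\<And>j. j \<in> {1..N} - {i} \<Longrightarrow> \<nu> j = \<nu>' j) \<Longrightarrow> player_field x N i \<nu> = player_field x N i \<nu>'"
  by (auto simp: player_field_def fun_eq_iff intro!: arg_cong2[where f="(+)"] arg_cong2[where f="(*)"] sum.cong)

text \<open>A mixed deviation costs the average of the costs of pure ones, so only pure deviations have to be
  compared.\<close>

lemma nash_iff_field:
  assumes "\<And>j. j \<in> {1..N} \<Longrightarrow> \<nu> j \<in> borel_probs"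
  shows "nash_equilibrium c L H x N \<nu> \<longleftrightarrow>
    (\<forall>i\<in>{1..N}. \<forall>z. (\<integral>\<^sup>+z. player_field x N i \<nu> z \<partial>\<nu> i) \<le> player_field x N i \<nu> z)"
proof -
  have dev: "player_cost c L H x N i (\<nu>(i := \<nu>')) = (\<integral>\<^sup>+z. player_field x N i \<nu> z \<partial>\<nu>')"
    if "i \<in> {1..N}" "\<nu>' \<in> borel_probs" for i \<nu>'
    using that assms player_field_cong[of N i "\<nu>(i := \<nu>')" \<nu> x]
    by (subst player_cost_eq_integral) auto
  have meas: "player_field x N i \<nu> \<in> borel_measurable borel" if "i \<in> {1..N}" for i
    unfolding player_field_def
    by (intro borel_measurable_add borel_measurable_times_ennreal borel_measurable_const borel_measurable_sum
        section_measurable measurable_costs borel_measurable_section_integral assms) auto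
  show ?thesis
  proof
    assume n: "nash_equilibrium c L H x N \<nu>"
    show "\<forall>i\<in>{1..N}. \<forall>z. (\<integral>\<^sup>+z. player_field x N i \<nu> z \<partial>\<nu> i) \<le> player_field x N i \<nu> z"
    proof (intro ballI allI)
      fix i z assume i: "i \<in> {1..N}"
      have "player_cost c L H x N i \<nu> \<le> player_cost c L H x N i (\<nu>(i := return borel z))"
        using n i return_borel_probs unfolding nash_equilibrium_def by blast
      then show "(\<integral>\<^sup>+z. player_field x N i \<nu> z \<partial>\<nu> i) \<le> player_field x N i \<nu> z"
        using dev[OF i return_borel_probs] player_cost_eq_integral[where \<nu>=\<nu>, OF i assms] meas[OF i]
        by (simp add: nn_integral_return)
    qed
  next
    assume f: "\<forall>i\<in>{1..N}. \<forall>z. (\<integral>\<^sup>+z. player_field x N i \<nu> z \<partial>\<nu> i) \<le> player_field x N i \<nu> z"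
    show "nash_equilibrium c L H x N \<nu>"
      unfolding nash_equilibrium_def
    proof (intro conjI ballI assms)
      fix i and \<nu>' :: "'b measure" assume i: "i \<in> {1..N}" "\<nu>' \<in> borel_probs"
      let ?I = "\<integral>\<^sup>+z. player_field x N i \<nu> z \<partial>\<nu> i"
      have "?I = (\<integral>\<^sup>+z. ?I \<partial>\<nu>')" using borel_probsD[OF i(2)] by simp
      also have "\<dots> \<le> (\<integral>\<^sup>+z. player_field x N i \<nu> z \<partial>\<nu>')"
        by (rule nn_integral_mono) (use f i in auto)
      finally show "player_cost c L H x N i \<nu> \<le> player_cost c L H x N i (\<nu>(i := \<nu>'))"
        using dev[OF i] player_cost_eq_integral[where \<nu>=\<nu>, OF i(1) assms] by simp
    qed
  qed
qed

text \<open>The finite game is a potential game: the interaction of two players enters the cost of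
  each of them with the weight \<open>2 / N\<close>, hence the potential with the weight \<open>1 / N\<close> per ordered
  pair. The further factor \<open>1 / N\<close> turns the potential into the cost per player.\<close>

definition potential :: "nat \<Rightarrow> (nat \<Rightarrow> 'a) \<Rightarrow> (nat \<Rightarrow> 'b) \<Rightarrow> ennreal" where
  "potential N x y = ennreal (1 / real N) * (\<Sum>i\<in>{1..N}. c (x i, y i) + L (y i))
    + ennreal (1 / (real N)\<^sup>2) * (\<Sum>i\<in>{1..N}. \<Sum>j\<in>{1..N} - {i}. H (y i, y j))"

lemma potential_split:
  assumes i: "i \<in> {1..N}"
  shows "\<exists>R. \<forall>z. potential N x (y(i := z)) =
    ennreal (1 / real N) * (player_field x N i (\<lambda>j. return borel (y j)) z + R)"
proof -
  let ?I = "{1..N} - {i}"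
  have N: "1 \<le> N" using i by auto
  define R1 where "R1 = (\<Sum>k\<in>?I. c (x k, y k) + L (y k))"
  define R2 where "R2 = (\<Sum>k\<in>?I. \<Sum>j\<in>?I - {k}. H (y k, y j))"
  have "potential N x (y(i := z)) =
      ennreal (1 / real N) * (player_field x N i (\<lambda>j. return borel (y j)) z + (R1 + ennreal (1 / real N) * R2))" for z
  proof -
    let ?y = "y(i := z)"
    have s1: "(\<Sum>k\<in>{1..N}. c (x k, ?y k) + L (?y k)) = (c (x i, z) + L z) + R1"
      unfolding R1_def using i by (subst sum.remove[of _ i]) (auto intro!: sum.cong)
    have "(\<Sum>k\<in>{1..N}. \<Sum>j\<in>{1..N} - {k}. H (?y k, ?y j)) =
        (\<Sum>j\<in>?I. H (z, y j)) + (\<Sum>k\<in>?I. \<Sum>j\<in>{1..N} - {k}. H (?y k, ?y j))"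
      using i by (subst sum.remove[of _ i]) (auto intro!: sum.cong)
    also have "(\<Sum>k\<in>?I. \<Sum>j\<in>{1..N} - {k}. H (?y k, ?y j)) = (\<Sum>k\<in>?I. H (z, y k) + (\<Sum>j\<in>?I - {k}. H (y k, y j)))"
    proof (rule sum.cong[OF refl])
      fix k assume k: "k \<in> ?I"
      then have "(\<Sum>j\<in>{1..N} - {k}. H (?y k, ?y j)) = H (?y k, ?y i) + (\<Sum>j\<in>{1..N} - {k} - {i}. H (?y k, ?y j))"
        using i by (intro sum.remove) auto
      also have "{1..N} - {k} - {i} = ?I - {k}" by auto
      also have "(\<Sum>j\<in>?I - {k}. H (?y k, ?y j)) = (\<Sum>j\<in>?I - {k}. H (y k, y j))"
        using k by (intro sum.cong) auto
      finally show "(\<Sum>j\<in>{1..N} - {k}. H (?y k, ?y j)) = H (z, y k) + (\<Sum>j\<in>?I - {k}. H (y k, y j))"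
        using k sym_H[of "y k" z] by simp
    qed
    also have "\<dots> = (\<Sum>j\<in>?I. H (z, y j)) + R2" unfolding R2_def by (rule sum.distrib)
    finally have s2: "(\<Sum>k\<in>{1..N}. \<Sum>j\<in>{1..N} - {k}. H (?y k, ?y j)) = 2 * (\<Sum>j\<in>?I. H (z, y j)) + R2"
      by (simp add: mult_2 add.assoc)
    have f: "player_field x N i (\<lambda>j. return borel (y j)) z = c (x i, z) + L z + ennreal (2 / real N) * (\<Sum>j\<in>?I. H (z, y j))"
      unfolding player_field_def ennreal_2_over_nat[OF N]
      using section_measurable[OF measurable_costs(3)] by (simp add: nn_integral_return)
    have a: "ennreal (1 / (real N)\<^sup>2) = ennreal (1 / real N) * ennreal (1 / real N)"
      by (simp add: ennreal_mult[symmetric] power2_eq_square)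
    have b: "ennreal (2 / real N) = 2 * ennreal (1 / real N)"
      using ennreal_mult[of 2 "1 / real N"] by simp
    show ?thesis unfolding potential_def s1 s2 f a b
      by (simp add: distrib_left mult.assoc add.assoc mult.left_commute add.left_commute)
  qed
  then show ?thesis by blast
qed

lemma potential_minimiser_nash:
  assumes fin: "potential N x y < top" and min: "\<And>z. potential N x y \<le> potential N x z"
  shows "nash_equilibrium c L H x N (\<lambda>i. return borel (y i))"
proof -
  let ?\<nu> = "\<lambda>i. return borel (y i)"
  have "(\<integral>\<^sup>+z. player_field x N i ?\<nu> z \<partial>?\<nu> i) \<le> player_field x N i ?\<nu> z" if i: "i \<in> {1..N}" for i z
  proof -
    obtain R where R: "\<And>z. potential N x (y(i := z)) = ennreal (1 / real N) * (player_field x N i ?\<nu> z + R)"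
      using potential_split[OF i] by blast
    have N: "0 < ennreal (1 / real N)" "ennreal (1 / real N) < top" using i by auto
    have y: "potential N x y = ennreal (1 / real N) * (player_field x N i ?\<nu> (y i) + R)"
      using R[of "y i"] by simp
    have "player_field x N i ?\<nu> (y i) + R < top"
      using fin N unfolding y by (auto simp: ennreal_mult_less_top)
    moreover have "player_field x N i ?\<nu> (y i) + R \<le> player_field x N i ?\<nu> z + R"
      using min[of "y(i := z)"] N unfolding y R by (simp add: ennreal_mult_le_mult_iff)
    ultimately have le: "player_field x N i ?\<nu> (y i) \<le> player_field x N i ?\<nu> z"
      by (auto simp: add.commute[of _ R] ennreal_add_left_cancel_le)
    have "player_field x N i ?\<nu> \<in> borel_measurable borel"
      unfolding player_field_def
      by (intro borel_measurable_add borel_measurable_times_ennreal borel_measurable_const borel_measurable_sum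
          section_measurable measurable_costs borel_measurable_section_integral return_borel_probs)
    then show ?thesis using le by (simp add: nn_integral_return)
  qed
  then show ?thesis by (subst nash_iff_field) (auto intro: return_borel_probs)
qed

lemma lsc_potential: "lsc (\<lambda>y. potential N x y)"
  unfolding potential_def
  by (intro lsc_add lsc_cmult lsc_sum lsc_compose[OF lsc_c] lsc_compose[OF lsc_L] lsc_compose[OF lsc_H]
      continuous_intros continuous_on_product_coordinates) auto

lemma potential_cong: "(\<And>i. i \<in> {1..N} \<Longrightarrow> y i = y' i) \<Longrightarrow> potential N x y = potential N x y'"
  unfolding potential_def by (auto intro!: arg_cong2[where f="(+)"] arg_cong2[where f="(*)"] sum.cong)

lemma cost_le_potential: "ennreal (1 / real N) * (\<Sum>i\<in>{1..N}. c (x i, y i) + L (y i)) \<le> potential N x y"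
  by (simp add: potential_def)

lemma potential_minimiser_exists:
  assumes N: "1 \<le> N"
  obtains y where "\<And>z. potential N x y \<le> potential N x z"
proof -
  define C where "C = {y::nat \<Rightarrow> 'b. \<forall>i. i \<notin> {1..N} \<longrightarrow> y i = undefined}"
  have "C = (\<Inter>i\<in>- {1..N}. {y. y i = undefined})" by (auto simp: C_def)
  then have C: "closed C"
    by (simp only:) (intro closed_INT ballI closed_Collect_eq continuous_on_product_coordinates continuous_intros)
  \<comment> \<open>The strategies of the players beyond \<open>N\<close> do not matter, and freezing them gives compactness.\<close>
  let ?f = "\<lambda>y. if y \<in> C then potential N x y else top"
  have "\<exists>y. \<forall>z. ?f y \<le> ?f z"
  proof (rule lsc_attains_min)
    show "lsc ?f" by (rule lsc_extend_top[OF lsc_potential C])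
    fix a :: ennreal assume a: "a < top"
    then have "of_nat N * a < top" by (simp add: ennreal_mult_less_top of_nat_less_top)
    then obtain K where K: "compact K" "\<And>y. L y \<le> of_nat N * a \<Longrightarrow> y \<in> K"
      using compact_sublevel_L by blast
    define Q where "Q i = (if i \<in> {1..N} then K else {undefined})" for i
    have "compactin (product_topology (\<lambda>i. euclidean) UNIV) (PiE UNIV Q)"
      unfolding compactin_PiE using K(1) by (auto simp: Q_def)
    then have "compact (PiE UNIV Q)"
      by (simp add: euclidean_product_topology)
    moreover have "{y. ?f y \<le> a} \<subseteq> PiE UNIV Q"
    proof
      fix y assume "y \<in> {y. ?f y \<le> a}"
      then have y: "y \<in> C" "potential N x y \<le> a" using a by (auto split: if_splits simp: top_unique)
      have "L (y i) \<le> of_nat N * a" if i: "i \<in> {1..N}" for i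
      proof -
        have "L (y i) \<le> (\<Sum>i\<in>{1..N}. c (x i, y i) + L (y i))"
          using i by (intro order_trans[OF _ member_le_sum[of i]]) auto
        also have "\<dots> = of_nat N * (ennreal (1 / real N) * (\<Sum>i\<in>{1..N}. c (x i, y i) + L (y i)))"
          using N by (simp add: mult.assoc[symmetric] ennreal_of_nat_eq_real_of_nat ennreal_mult[symmetric])
        also have "\<dots> \<le> of_nat N * a"
          by (intro mult_left_mono order_trans[OF cost_le_potential y(2)]) auto
        finally show ?thesis .
      qed
      then show "y \<in> PiE UNIV Q" using y(1) K(2) by (auto simp: Q_def C_def)
    qed
    ultimately show "\<exists>K. compact K \<and> {y. ?f y \<le> a} \<subseteq> K" by blast
  qed
  then obtain y where y: "\<And>z. ?f y \<le> ?f z" by blast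
  have "potential N x y \<le> potential N x z" for z
  proof -
    let ?z = "\<lambda>i. if i \<in> {1..N} then z i else undefined"
    have "potential N x y \<le> ?f y" by simp
    also have "\<dots> \<le> ?f ?z" by (rule y)
    also have "\<dots> = potential N x ?z" by (auto simp: C_def)
    also have "\<dots> = potential N x z" by (rule potential_cong) auto
    finally show ?thesis .
  qed
  then show thesis by (rule that)
qed

end

section \<open>Empirical measures\<close>

text \<open>For bounded functions Hoeffding's inequality makes the deviation probabilities summable.\<close>

lemma bounded_SLLN:
  fixes X :: "nat \<Rightarrow> 'w \<Rightarrow> 'a::topological_space" and g :: "'a \<Rightarrow> real"
  assumes P: "prob_space P" and ind: "prob_space.indep_vars P (\<lambda>_. borel) X {1..}"
    and law: "\<And>i. 1 \<le> i \<Longrightarrow> distr P borel (X i) = \<mu>"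
    and g[measurable]: "g \<in> borel_measurable borel" and gb: "\<And>x. 0 \<le> g x" "\<And>x. g x \<le> B"
  shows "AE \<omega> in P. (\<lambda>N. (\<Sum>i=1..N. g (X i \<omega>)) / real N) \<longlonglongrightarrow> (\<integral>x. g x \<partial>\<mu>)"
proof -
  interpret prob_space P by fact
  have B0: "0 \<le> B" using gb[of undefined] by linarith
  have Xm[measurable]: "X i \<in> measurable P borel" if "1 \<le> i" for i
    using ind that by (auto simp: indep_vars_def)
  define m where "m = (\<integral>x. g x \<partial>\<mu>)"
  have m: "m = expectation (\<lambda>\<omega>. g (X 1 \<omega>))"
    unfolding m_def law[of 1, OF order_refl, symmetric] by (rule integral_distr) auto
  define A where "A e N = {\<omega>\<in>space P. \<bar>(\<Sum>i\<in>{1..Suc N}. g (X i \<omega>)) / real (Suc N) - m\<bar> \<ge> e}" for e N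
  have Am: "A e N \<in> events" for e N unfolding A_def by measurable
  have bound: "prob (A e N) \<le> 2 * exp (- 2 * e\<^sup>2 / (B + 1)\<^sup>2) ^ Suc N" if "0 < e" for e N
  proof -
    interpret Hoeffding_ineq_iid P "{1..Suc N}" "\<lambda>i \<omega>. g (X i \<omega>)" "\<lambda>\<omega>. g (X 1 \<omega>)" 0 "B + 1" m
    proof unfold_locales
      show "indep_vars (\<lambda>_. borel) (\<lambda>i \<omega>. g (X i \<omega>)) {1..Suc N}"
        by (rule indep_vars_subset[OF indep_vars_compose2[OF ind, where Y="\<lambda>_. g"]]) auto
      show "distr P borel (\<lambda>\<omega>. g (X i \<omega>)) = distr P borel (\<lambda>\<omega>. g (X 1 \<omega>))" if "i \<in> {1..Suc N}" for i
      proof -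
        have "distr P borel (\<lambda>\<omega>. g (X j \<omega>)) = distr \<mu> borel g" if "1 \<le> j" for j
          unfolding law[OF that, symmetric] using that by (subst distr_distr) (auto simp: comp_def)
        then show ?thesis using that by simp
      qed
      have "g y \<le> B + 1" for y using gb(2)[of y] by linarith
      then show "AE \<omega> in P. g (X 1 \<omega>) \<in> {0..B + 1}" using gb(1) by simp
    qed (simp_all add: m)
    have "prob (A e N) \<le> 2 * exp (- 2 * real (card {1..Suc N}) * e\<^sup>2 / (B + 1 - 0)\<^sup>2)"
      unfolding A_def using Hoeffding_ineq_abs_ge'[of e] that B0 by simp
    also have "exp (- 2 * real (card {1..Suc N}) * e\<^sup>2 / (B + 1 - 0)\<^sup>2) = exp (real (Suc N) * (- 2 * e\<^sup>2 / (B + 1)\<^sup>2))"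
      by (rule arg_cong[where f=exp]) (simp del: of_nat_Suc)
    also have "\<dots> = exp (- 2 * e\<^sup>2 / (B + 1)\<^sup>2) ^ Suc N" by (rule exp_of_nat_mult)
    finally show ?thesis .
  qed
  have "AE \<omega> in P. \<forall>k. \<forall>\<^sub>F N in sequentially. \<omega> \<in> space P - A (inverse (real (Suc k))) N"
    unfolding AE_all_countable
  proof
    fix k
    let ?e = "inverse (real (Suc k))"
    have "exp (- 2 * ?e\<^sup>2 / (B + 1)\<^sup>2) < 1" using B0 by (simp add: divide_neg_pos)
    then have "summable (\<lambda>N. 2 * exp (- 2 * ?e\<^sup>2 / (B + 1)\<^sup>2) ^ Suc N)"
      by (subst summable_Suc_iff) (intro summable_mult summable_geometric, simp)
    then have "summable (\<lambda>N. prob (A ?e N))"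
      by (rule summable_comparison_test[rotated]) (use bound[of ?e] in auto)
    then show "AE \<omega> in P. \<forall>\<^sub>F N in sequentially. \<omega> \<in> space P - A ?e N"
      by (intro borel_cantelli_AE1 Am) (auto simp: emeasure_eq_measure)
  qed
  then show ?thesis
  proof eventually_elim
    case (elim \<omega>)
    have "(\<lambda>N. (\<Sum>i=1..Suc N. g (X i \<omega>)) / real (Suc N)) \<longlonglongrightarrow> m"
    proof (rule tendstoI)
      fix e :: real assume "0 < e"
      then obtain k where k: "inverse (real (Suc k)) < e" using reals_Archimedean by blast
      from elim[rule_format, of k] show "\<forall>\<^sub>F N in sequentially. dist ((\<Sum>i=1..Suc N. g (X i \<omega>)) / real (Suc N)) m < e"
      proof eventually_elim
        case (elim N)
        then have "\<not> inverse (real (Suc k)) \<le> \<bar>(\<Sum>i=1..Suc N. g (X i \<omega>)) / real (Suc N) - m\<bar>"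
          unfolding A_def by blast
        then show ?case using k unfolding dist_real_def by linarith
      qed
    qed
    then show ?case unfolding m_def by (rule LIMSEQ_imp_Suc)
  qed
qed

text \<open>The indicators of the finite intersections of basic open sets determine a measure, and each
  of them is a supremum of a sequence of continuous functions.\<close>

lemma countable_determining_functions:
  obtains g :: "nat \<Rightarrow> 'a::{metric_space,second_countable_topology} \<Rightarrow> real"
  where "\<And>k. continuous_on UNIV (g k)" "\<And>k x. 0 \<le> g k x" "\<And>k x. g k x \<le> 1"
    "\<And>M M'. M \<in> borel_probs \<Longrightarrow> M' \<in> borel_probs \<Longrightarrow> (\<And>k. (\<integral>x. g k x \<partial>M) = (\<integral>x. g k x \<partial>M')) \<Longrightarrow> M = M'"
proof -
  obtain B :: "'a set set" where B: "countable B" "topological_basis B" using ex_countable_basis by blast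
  define \<U> where "\<U> = Inter ` {F. finite F \<and> F \<subseteq> B}"
  have cU: "countable \<U>" unfolding \<U>_def using countable_Collect_finite_subset[OF B(1)] by simp
  have oU: "open U" if "U \<in> \<U>" for U
    using that topological_basis_open[OF B(2)] by (auto simp: \<U>_def intro!: open_Inter)
  have UU: "UNIV \<in> \<U>" unfolding \<U>_def by (auto intro!: image_eqI[of _ _ "{}"])
  have "\<forall>U\<in>\<U>. \<exists>h::nat \<Rightarrow> 'a \<Rightarrow> real. (\<forall>k. continuous_on UNIV (h k)) \<and> (\<forall>k x. 0 \<le> h k x) \<and>
      (\<forall>x. incseq (\<lambda>k. h k x)) \<and> (\<forall>x. (SUP k. ennreal (h k x)) = indicator U x)"
    using lsc_Lipschitz_approx[OF lsc_indicator_open[OF oU]] by metis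
  then obtain h :: "'a set \<Rightarrow> nat \<Rightarrow> 'a \<Rightarrow> real" where h: "\<And>U k. U \<in> \<U> \<Longrightarrow> continuous_on UNIV (h U k)"
    "\<And>U k x. U \<in> \<U> \<Longrightarrow> 0 \<le> h U k x" "\<And>U x. U \<in> \<U> \<Longrightarrow> incseq (\<lambda>k. h U k x)"
    "\<And>U x. U \<in> \<U> \<Longrightarrow> (SUP k. ennreal (h U k x)) = indicator U x" by metis
  have h1: "h U k x \<le> 1" if "U \<in> \<U>" for U k x
  proof -
    have "ennreal (h U k x) \<le> (SUP k. ennreal (h U k x))" by (rule SUP_upper) simp
    also have "\<dots> \<le> ennreal 1" unfolding h(4)[OF that] by (simp add: indicator_def)
    finally show ?thesis by simp
  qed
  define g where "g n = h (from_nat_into \<U> (fst (prod_decode n))) (snd (prod_decode n))" for n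
  have U: "from_nat_into \<U> i \<in> \<U>" for i using UU by (intro from_nat_into) auto
  show thesis
  proof
    show "continuous_on UNIV (g k)" "0 \<le> g k x" "g k x \<le> 1" for k x
      unfolding g_def using h(1,2) h1 U by auto
    fix M M' :: "'a measure"
    assume M: "M \<in> borel_probs" "M' \<in> borel_probs" and eq: "\<And>k. (\<integral>x. g k x \<partial>M) = (\<integral>x. g k x \<partial>M')"
    have eqh: "(\<integral>x. h U k x \<partial>M) = (\<integral>x. h U k x \<partial>M')" if V: "U \<in> \<U>" for U k
    proof -
      obtain i where "from_nat_into \<U> i = U" using from_nat_into_surj[OF cU V] by blast
      then have "g (prod_encode (i, k)) = h U k" by (simp add: g_def)
      then show ?thesis using eq[of "prod_encode (i, k)"] by simp
    qed
    have SUP: "emeasure M1 U = (SUP k. ennreal (\<integral>x. h U k x \<partial>M1))" if V: "U \<in> \<U>" and M1: "M1 \<in> borel_probs" for U M1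
    proof -
      have "emeasure M1 U = (\<integral>\<^sup>+x. indicator U x \<partial>M1)"
        using oU[OF V] borel_probsD(2)[OF M1] by simp
      also have "\<dots> = (\<integral>\<^sup>+x. (SUP k. ennreal (h U k x)) \<partial>M1)" by (simp add: h(4)[OF V])
      also have "\<dots> = (SUP k. \<integral>\<^sup>+x. ennreal (h U k x) \<partial>M1)"
        by (rule nn_integral_monotone_convergence_SUP)
          (auto simp: incseq_def le_fun_def intro!: ennreal_leI incseqD[OF h(3)[OF V]] borel_probs_measurable[OF M1]
            measurable_compose[OF borel_measurable_continuous_onI[OF h(1)[OF V]] measurable_ennreal])
      also have "\<dots> = (SUP k. ennreal (\<integral>x. h U k x \<partial>M1))"
        by (simp add: nn_integral_bounded_continuous(1)[OF M1 h(1)[OF V] h(2)[OF V] h1[OF V]])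
      finally show ?thesis .
    qed
    show "M = M'"
    proof (rule measure_eqI_generator_eq[where E="\<U>" and \<Omega>=UNIV and A="\<lambda>_. UNIV"])
      show "Int_stable \<U>"
      proof (rule Int_stableI)
        fix a b assume "a \<in> \<U>" "b \<in> \<U>"
        then obtain F G where "finite F" "F \<subseteq> B" "a = \<Inter>F" "finite G" "G \<subseteq> B" "b = \<Inter>G" by (auto simp: \<U>_def)
        then show "a \<inter> b \<in> \<U>" unfolding \<U>_def by (intro image_eqI[of _ _ "F \<union> G"]) auto
      qed
      have sb: "sets borel = sigma_sets UNIV \<U>"
      proof
        have "sets borel = sigma_sets UNIV B"
          by (subst borel_eq_countable_basis[OF B]) (rule sets_measure_of, simp)
        also have "\<dots> \<subseteq> sigma_sets UNIV \<U>"
        proof (rule sigma_sets_mono)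
          show "B \<subseteq> sigma_sets UNIV \<U>"
            unfolding \<U>_def by (auto intro!: sigma_sets.Basic image_eqI[of _ _ "{_}"])
        qed
        finally show "sets borel \<subseteq> sigma_sets UNIV \<U>" .
        show "sigma_sets UNIV \<U> \<subseteq> sets borel"
          using oU sets.sigma_sets_subset[of \<U> borel] borel_open by auto
      qed
      show "sets M = sigma_sets UNIV \<U>" "sets M' = sigma_sets UNIV \<U>"
        using borel_probsD(2)[OF M(1)] borel_probsD(2)[OF M(2)] sb by auto
      show "emeasure M V = emeasure M' V" if "V \<in> \<U>" for V
        unfolding SUP[OF that M(1)] SUP[OF that M(2)] eqh[OF that] ..
    qed (use UU borel_probsD[OF M(1)] in auto)
  qed
qed

lemma nn_integral_average:
  assumes N: "1 \<le> N" and m: "\<And>i. i \<in> {1..N} \<Longrightarrow> m i \<in> borel_probs" and f: "f \<in> borel_measurable borel"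
  shows "(\<integral>\<^sup>+x. f x \<partial>average N m) = (\<Sum>i=1..N. \<integral>\<^sup>+x. f x \<partial>m i) / of_nat N"
proof -
  define m' where "m' i = (if i \<in> {1..N} then m i else m 1)" for i
  have m': "m' i \<in> borel_probs" for i using m[of i] m[of 1] N by (auto simp: m'_def)
  let ?p = "measure_pmf (pmf_of_set {1..N})"
  have K: "m' \<in> measurable ?p (subprob_algebra borel)"
    using borel_probsD[OF m'] by (auto simp: space_subprob_algebra prob_space_imp_subprob_space)
  have ne: "{1..N} \<noteq> {}" using N by auto
  have eq: "average N m = ?p \<bind> m'"
  proof (rule measure_eqI)
    show "sets (average N m) = sets (?p \<bind> m')"
      using K by (subst sets_bind[where N=borel]) (use borel_probsD(2)[OF m'] in auto)
    fix A assume "A \<in> sets (average N m)"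
    then have A: "A \<in> sets borel" by simp
    have "emeasure (?p \<bind> m') A = (\<integral>\<^sup>+i. emeasure (m' i) A \<partial>?p)"
      by (rule emeasure_bind[OF _ K A]) simp
    also have "\<dots> = (\<Sum>i=1..N. emeasure (m' i) A) / of_nat N"
      by (subst nn_integral_pmf_of_set) (use ne in \<open>auto simp: ennreal_of_nat_eq_real_of_nat\<close>)
    also have "(\<Sum>i=1..N. emeasure (m' i) A) = (\<Sum>i=1..N. emeasure (m i) A)"
      by (auto simp: m'_def)
    also have "\<dots> / of_nat N = emeasure (average N m) A"
      by (rule emeasure_average[symmetric, OF borel_probsD(2)[OF m] A])
    finally show "emeasure (average N m) A = emeasure (?p \<bind> m') A" ..
  qed
  have "(\<integral>\<^sup>+x. f x \<partial>average N m) = (\<integral>\<^sup>+i. \<integral>\<^sup>+x. f x \<partial>m' i \<partial>?p)"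
    unfolding eq by (rule nn_integral_bind[OF f K])
  also have "\<dots> = (\<Sum>i=1..N. \<integral>\<^sup>+x. f x \<partial>m' i) / of_nat N"
    by (subst nn_integral_pmf_of_set) (use ne in \<open>auto simp: ennreal_of_nat_eq_real_of_nat\<close>)
  also have "(\<Sum>i=1..N. \<integral>\<^sup>+x. f x \<partial>m' i) = (\<Sum>i=1..N. \<integral>\<^sup>+x. f x \<partial>m i)"
    by (auto simp: m'_def)
  finally show ?thesis .
qed

lemma empirical_borel_probs: "1 \<le> N \<Longrightarrow> empirical N x \<in> borel_probs"
  unfolding empirical_def by (intro average_borel_probs return_borel_probs)

lemma integral_empirical:
  assumes N: "1 \<le> N" and g: "g \<in> borel_measurable borel" "\<And>x. 0 \<le> g x"
  shows "(\<integral>z. g z \<partial>empirical N x) = (\<Sum>i=1..N. g (x i)) / real N"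
proof -
  have "(\<integral>\<^sup>+z. ennreal (g z) \<partial>empirical N x) = (\<Sum>i=1..N. ennreal (g (x i))) / of_nat N"
    unfolding empirical_def using g by (subst nn_integral_average[OF N return_borel_probs]) (auto simp: nn_integral_return)
  also have "(\<Sum>i=1..N. ennreal (g (x i))) = ennreal (\<Sum>i=1..N. g (x i))"
    using g by (simp add: sum_ennreal)
  also have "\<dots> / of_nat N = ennreal ((\<Sum>i=1..N. g (x i)) / real N)"
    using N g by (simp add: divide_ennreal sum_nonneg ennreal_of_nat_eq_real_of_nat)
  finally have "(\<integral>\<^sup>+z. ennreal (g z) \<partial>empirical N x) = ennreal ((\<Sum>i=1..N. g (x i)) / real N)" .
  moreover have "(\<integral>z. g z \<partial>empirical N x) = enn2real (\<integral>\<^sup>+z. ennreal (g z) \<partial>empirical N x)"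
    by (rule integral_eq_nn_integral) (use g borel_probs_measurable[OF empirical_borel_probs[OF N]] in auto)
  ultimately show ?thesis using g by (simp add: sum_nonneg)
qed

lemma tight_measure:
  fixes M :: "'a::{second_countable_topology,complete_space} measure"
  assumes M: "M \<in> borel_probs" and "0 < (e::real)"
  shows "\<exists>K. compact K \<and> measure M (- K) < e"
proof -
  interpret prob_space M using borel_probsD[OF M] by simp
  have "(SUP K \<in> {K. K \<subseteq> UNIV \<and> compact K}. emeasure M K) = 1"
    using inner_regular[of M UNIV] borel_probsD[OF M] by simp
  moreover have "ennreal (1 - e) < 1" using assms(2) by (simp add: ennreal_less_one_iff)
  ultimately obtain K where K: "compact K" "ennreal (1 - e) < emeasure M K"
    by (metis (mono_tags, lifting) less_SUP_iff mem_Collect_eq)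
  then have "1 - e < measure M K" by (simp add: emeasure_eq_measure ennreal_less_iff) (metis ennreal_less_iff linorder_not_le ennreal_leI measure_nonneg)
  moreover have "measure M (- K) = 1 - measure M K"
    using prob_compl[of K] K(1) borel_probsD[OF M] by (simp add: Compl_eq_Diff_UNIV compact_imp_closed)
  ultimately show ?thesis using K(1) by auto
qed

text \<open>What is needed of the convergence of the empirical measures of a sequence of types to \<open>\<mu>\<close>:
  they are asymptotically tight and \<open>\<mu>\<close> is their only cluster point.\<close>

definition typical_sequence :: "'a::topological_space measure \<Rightarrow> (nat \<Rightarrow> 'a) \<Rightarrow> bool" where
  "typical_sequence \<mu> x \<longleftrightarrow>
    (\<forall>e::real>0. \<exists>K. compact K \<and> (\<forall>\<^sub>F N in sequentially. measure (empirical N x) (- K) \<le> e)) \<and>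
    (\<forall>r \<mu>'. strict_mono r \<and> \<mu>' \<in> borel_probs \<and> narrow_conv (\<lambda>n. empirical (r n) x) \<mu>' \<longrightarrow> \<mu>' = \<mu>)"

text \<open>The law of large numbers for countably many bounded functions suffices: the determining functions
  identify the cluster points, and the indicators of the complements of compact sets carrying most of
  \<open>\<mu>\<close> give tightness.\<close>

lemma AE_typical_sequence:
  fixes X :: "nat \<Rightarrow> 'w \<Rightarrow> 'a::{second_countable_topology,complete_space}"
  assumes P: "prob_space P" and ind: "prob_space.indep_vars P (\<lambda>_. borel) X {1..}"
    and law: "\<And>i. 1 \<le> i \<Longrightarrow> distr P borel (X i) = \<mu>" and \<mu>: "\<mu> \<in> borel_probs"
  shows "AE \<omega> in P. typical_sequence \<mu> (\<lambda>i. X i \<omega>)"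
proof -
  obtain g :: "nat \<Rightarrow> 'a \<Rightarrow> real" where g: "\<And>k. continuous_on UNIV (g k)" "\<And>k x. 0 \<le> g k x" "\<And>k x. g k x \<le> 1"
    and det: "\<And>M M'. M \<in> borel_probs \<Longrightarrow> M' \<in> borel_probs \<Longrightarrow> (\<And>k. (\<integral>x. g k x \<partial>M) = (\<integral>x. g k x \<partial>M')) \<Longrightarrow> M = M'"
    using countable_determining_functions by metis
  have gm: "g k \<in> borel_measurable borel" for k by (rule borel_measurable_continuous_onI[OF g(1)])
  have "\<forall>m. \<exists>K. compact K \<and> measure \<mu> (- K) < inverse (real (Suc m))"
    using tight_measure[OF \<mu>] by simp
  then obtain K where K: "\<And>m. compact (K m)" "\<And>m. measure \<mu> (- K m) < inverse (real (Suc m))" by metis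
  have Km: "- K m \<in> sets borel" for m
    by (rule borel_comp[OF borel_closed[OF compact_imp_closed[OF K(1)]]])
  note S = bounded_SLLN[OF P ind law]
  have 1: "AE \<omega> in P. \<forall>k. (\<lambda>N. (\<Sum>i=1..N. g k (X i \<omega>)) / real N) \<longlonglongrightarrow> (\<integral>x. g k x \<partial>\<mu>)"
    unfolding AE_all_countable by (intro allI S[where B=1] gm g)
  have 2: "AE \<omega> in P. \<forall>m. (\<lambda>N. (\<Sum>i=1..N. indicator (- K m) (X i \<omega>)) / real N) \<longlonglongrightarrow> (\<integral>x. indicator (- K m) x \<partial>\<mu>)"
    unfolding AE_all_countable by (intro allI S[where B=1] borel_measurable_indicator Km) (auto simp: indicator_def)
  show ?thesis using 1 2
  proof eventually_elim
    case (elim \<omega>)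
    let ?x = "\<lambda>i. X i \<omega>"
    show ?case unfolding typical_sequence_def
    proof (intro conjI allI impI)
      fix e :: real assume "0 < e"
      then obtain m where m: "inverse (real (Suc m)) < e" using reals_Archimedean by blast
      have "(\<integral>x. indicator (- K m) x \<partial>\<mu>) < e"
        using K(2)[of m] m Km borel_probsD[OF \<mu>] by simp
      then have "\<forall>\<^sub>F N in sequentially. (\<Sum>i=1..N. indicator (- K m) (?x i)) / real N < e"
        using elim(2) order_tendstoD(2) by blast
      then have "\<forall>\<^sub>F N in sequentially. measure (empirical N ?x) (- K m) \<le> e"
        using eventually_ge_at_top[of 1]
      proof eventually_elim
        case (elim N)
        have "measure (empirical N ?x) (- K m) = (\<integral>z. indicator (- K m) z \<partial>empirical N ?x)"
          using Km[of m] borel_probsD[OF empirical_borel_probs[OF elim(2), of ?x]] by simp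
        also have "\<dots> = (\<Sum>i=1..N. indicator (- K m) (?x i)) / real N"
          by (rule integral_empirical[OF elim(2)]) (use Km in auto)
        finally show ?case using elim(1) by simp
      qed
      then show "\<exists>K. compact K \<and> (\<forall>\<^sub>F N in sequentially. measure (empirical N ?x) (- K) \<le> e)"
        using K(1) by blast
    next
      fix r :: "nat \<Rightarrow> nat" and \<mu>' assume h: "strict_mono r \<and> \<mu>' \<in> borel_probs \<and> narrow_conv (\<lambda>n. empirical (r n) ?x) \<mu>'"
      show "\<mu>' = \<mu>"
      proof (rule det)
        fix k
        have "bounded (range (g k))" by (rule boundedI[of _ 1]) (use g in auto)
        then have "(\<lambda>n. \<integral>z. g k z \<partial>empirical (r n) ?x) \<longlonglongrightarrow> (\<integral>z. g k z \<partial>\<mu>')"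
          using h g(1) unfolding narrow_conv_def by blast
        moreover have "(\<lambda>n. \<integral>z. g k z \<partial>empirical (r n) ?x) \<longlonglongrightarrow> (\<integral>z. g k z \<partial>\<mu>)"
        proof (rule Lim_transform_eventually)
          show "(\<lambda>n. (\<Sum>i=1..r n. g k (?x i)) / real (r n)) \<longlonglongrightarrow> (\<integral>z. g k z \<partial>\<mu>)"
            using LIMSEQ_subseq_LIMSEQ[OF elim(1)[rule_format, of k], of r] h by (simp add: comp_def)
          show "\<forall>\<^sub>F n in sequentially. (\<Sum>i=1..r n. g k (?x i)) / real (r n) = (\<integral>z. g k z \<partial>empirical (r n) ?x)"
            using eventually_subseq[OF conjunct1[OF h] eventually_ge_at_top[of 1]]
            by eventually_elim (rule integral_empirical[symmetric]; use gm g in auto)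
        qed
        ultimately show "(\<integral>z. g k z \<partial>\<mu>') = (\<integral>z. g k z \<partial>\<mu>)" by (rule LIMSEQ_unique)
      qed (use h \<mu> in auto)
    qed
  qed
qed

lemma narrow_conv_distr:
  fixes f :: "'a::topological_space \<Rightarrow> 'b::topological_space"
  assumes conv: "narrow_conv M M'" and M: "\<And>n. M n \<in> borel_probs" "M' \<in> borel_probs" and f: "continuous_on UNIV f"
  shows "narrow_conv (\<lambda>n. distr (M n) borel f) (distr M' borel f)"
  unfolding narrow_conv_def
proof (intro allI impI)
  fix g :: "'b \<Rightarrow> real" assume g: "continuous_on UNIV g \<and> bounded (range g)"
  have fm: "f \<in> measurable borel borel" by (rule borel_measurable_continuous_onI[OF f])
  have gm: "g \<in> borel_measurable borel" by (rule borel_measurable_continuous_onI) (use g in auto)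
  have "continuous_on UNIV (\<lambda>x. g (f x))" by (rule continuous_on_compose2[of UNIV g]) (use f g in auto)
  moreover have "bounded (range (\<lambda>x. g (f x)))" using g by (auto simp: bounded_iff)
  ultimately have "(\<lambda>n. \<integral>x. g (f x) \<partial>M n) \<longlonglongrightarrow> (\<integral>x. g (f x) \<partial>M')"
    using conv unfolding narrow_conv_def by blast
  then show "(\<lambda>n. \<integral>x. g x \<partial>distr (M n) borel f) \<longlonglongrightarrow> (\<integral>x. g x \<partial>distr M' borel f)"
    by (simp add: integral_distr[OF borel_probs_measurable[OF M(1) fm] gm] integral_distr[OF borel_probs_measurable[OF M(2) fm] gm])
qed

lemma distr_borel_probs: "M \<in> borel_probs \<Longrightarrow> f \<in> measurable borel borel \<Longrightarrow> distr M borel f \<in> borel_probs"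
  by (simp add: borel_probs_def prob_space.prob_space_distr borel_probs_measurable)

section \<open>Coupling the types with independent strategies\<close>

lemma PiM_iid_coordinates:
  fixes M :: "'a measure"
  assumes M: "prob_space M"
  defines "W \<equiv> PiM (UNIV::nat set) (\<lambda>_. M)"
  shows "prob_space W" "prob_space.indep_vars W (\<lambda>_. M) (\<lambda>i w. w i) UNIV"
    "\<And>i. distr W M (\<lambda>w. w i) = M"
proof -
  interpret product_prob_space "\<lambda>_. M" "UNIV::nat set"
    using M by (simp add: product_prob_space_def product_prob_space_axioms_def product_sigma_finite_def
        prob_space_imp_sigma_finite)
  show p: "prob_space W" unfolding W_def by (rule prob_space_PiM) (rule M)
  interpret W: prob_space W by (rule p)
  show d: "distr W M (\<lambda>w. w i) = M" for i
    unfolding W_def by (rule distr_PiM_component) (use M in auto)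
  have "distr W (\<Pi>\<^sub>M i\<in>UNIV. M) (\<lambda>w. \<lambda>i\<in>UNIV. w i) = distr W W (\<lambda>w. w)"
    unfolding W_def by (rule distr_cong) (auto simp: restrict_UNIV)
  also have "\<dots> = W" by (rule distr_id2) simp
  finally show "W.indep_vars (\<lambda>_. M) (\<lambda>i w. w i) UNIV"
    by (subst W.indep_vars_iff_distr_eq_PiM) (auto simp: d, auto simp: W_def)
qed

lemma iid_distr_PiM:
  fixes X :: "nat \<Rightarrow> 'w \<Rightarrow> 'a::topological_space"
  assumes P: "prob_space P" and ind: "prob_space.indep_vars P (\<lambda>_. borel) X {1..}"
    and law: "\<And>i. 1 \<le> i \<Longrightarrow> distr P borel (X i) = \<mu>"
  shows "distr P (PiM UNIV (\<lambda>_. borel)) (\<lambda>\<omega> i. X (Suc i) \<omega>) = PiM UNIV (\<lambda>_. \<mu>)"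
proof -
  interpret prob_space P by fact
  have Xm: "X i \<in> measurable P borel" if "1 \<le> i" for i
    using ind that by (auto simp: indep_vars_def)
  have \<mu>: "prob_space \<mu>" "sets \<mu> = sets borel"
    unfolding law[OF order_refl, symmetric] by (auto intro!: prob_space_distr Xm)
  have "distr P (\<Pi>\<^sub>M i\<in>{1..}. borel) (\<lambda>x. \<lambda>i\<in>{1..}. X i x) = (\<Pi>\<^sub>M i\<in>{1..}. distr P borel (X i))"
    using ind Xm by (subst (asm) indep_vars_iff_distr_eq_PiM') auto
  also have "\<dots> = (\<Pi>\<^sub>M i\<in>{1..}. \<mu>)" by (rule PiM_cong) (auto simp: law)
  finally have J: "distr P (\<Pi>\<^sub>M i\<in>{1..}. borel) (\<lambda>x. \<lambda>i\<in>{1..}. X i x) = (\<Pi>\<^sub>M i\<in>{1..}. \<mu>)" .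
  have s: "sets (PiM I (\<lambda>_. \<mu>)) = sets (PiM I (\<lambda>_. borel))" for I :: "nat set"
    by (rule sets_PiM_cong) (auto simp: \<mu>)
  let ?s = "\<lambda>\<omega>. \<lambda>n\<in>UNIV. \<omega> (Suc n)"
  have sm: "?s \<in> measurable (\<Pi>\<^sub>M i\<in>{1..}. borel) (\<Pi>\<^sub>M i\<in>(UNIV::nat set). (borel :: 'a measure))"
    by (intro measurable_restrict measurable_component_singleton) auto
  have "PiM UNIV (\<lambda>_. \<mu>) = distr (\<Pi>\<^sub>M i\<in>{1..}. \<mu>) (\<Pi>\<^sub>M i\<in>UNIV. \<mu>) ?s"
    by (rule distr_PiM_reindex[symmetric]) (auto simp: \<mu>)
  also have "\<dots> = distr (\<Pi>\<^sub>M i\<in>{1..}. \<mu>) (\<Pi>\<^sub>M i\<in>UNIV. borel) ?s"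
    by (rule distr_cong) (auto simp: s)
  also have "\<dots> = distr P (\<Pi>\<^sub>M i\<in>UNIV. borel) (?s \<circ> (\<lambda>x. \<lambda>i\<in>{1..}. X i x))"
    unfolding J[symmetric] by (rule distr_distr[OF sm]) (intro measurable_restrict Xm, simp)
  also have "?s \<circ> (\<lambda>x. \<lambda>i\<in>{1..}. X i x) = (\<lambda>\<omega> i. X (Suc i) \<omega>)" by (auto simp: fun_eq_iff)
  finally show ?thesis ..
qed

text \<open>An almost sure property of the types may be proved after coupling them with strategies: if
  it holds almost surely for the first coordinates of an i.i.d. sequence with law \<open>\<gamma>\<close>, it holds
  almost surely for every i.i.d. sequence whose law is the first marginal of \<open>\<gamma>\<close>. This replaces a
  disintegration of \<open>\<gamma>\<close>; the projection of the exceptional set is controlled by exhausting its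
  complement by compact sets, whose projections are compact.\<close>

lemma AE_types_from_coupling:
  fixes \<gamma> :: "('a::{second_countable_topology,complete_space} \<times> 'b::{second_countable_topology,complete_space}) measure"
    and X :: "nat \<Rightarrow> 'w \<Rightarrow> 'a"
  assumes P: "prob_space P" and ind: "prob_space.indep_vars P (\<lambda>_. borel) X {1..}"
    and law: "\<And>i. 1 \<le> i \<Longrightarrow> distr P borel (X i) = \<mu>"
    and \<gamma>: "\<gamma> \<in> plans \<mu>"
    and Q: "AE w in PiM UNIV (\<lambda>_. \<gamma>). Q (\<lambda>i::nat. fst (w i))"
  shows "AE \<omega> in P. Q (\<lambda>i. X (Suc i) \<omega>)"
proof -
  interpret P: prob_space P by fact
  have \<gamma>b: "\<gamma> \<in> borel_probs" and \<gamma>\<mu>: "distr \<gamma> borel fst = \<mu>" using \<gamma> by (auto simp: plans_def)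
  define W where "W = PiM (UNIV::nat set) (\<lambda>_. \<gamma>)"
  note iid = PiM_iid_coordinates[OF borel_probsD(1)[OF \<gamma>b], folded W_def]
  interpret W: prob_space W by (rule iid(1))
  have sW: "sets W = sets borel"
  proof -
    have "sets W = sets (PiM UNIV (\<lambda>_. borel))"
      unfolding W_def by (rule sets_PiM_cong) (auto simp: borel_probsD[OF \<gamma>b])
    then show ?thesis by (simp only: sets_PiM_equal_borel)
  qed
  have spW: "space W = UNIV" using sets_eq_imp_space_eq[OF sW] by simp
  have fstm: "fst \<in> measurable \<gamma> borel"
    by (rule borel_probs_measurable[OF \<gamma>b]) (intro borel_measurable_continuous_onI continuous_intros)
  let ?p = "\<lambda>w i. fst (w i) :: 'a"
  have pm: "?p \<in> measurable W (PiM UNIV (\<lambda>_. borel))"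
  proof (rule measurable_PiM_single')
    show "(\<lambda>w. fst (w i)) \<in> measurable W borel" for i
      unfolding W_def by (rule measurable_compose[OF _ fstm]) (rule measurable_component_singleton, simp)
  qed auto
  have indW: "W.indep_vars (\<lambda>_. borel) (\<lambda>i w. fst (w i)) UNIV"
    by (rule W.indep_vars_compose2[OF iid(2) fstm])
  have lawW: "distr W borel (\<lambda>w. fst (w i)) = \<mu>" for i
  proof -
    have "distr W borel (\<lambda>w. fst (w i)) = distr (distr W \<gamma> (\<lambda>w. w i)) borel fst"
      by (subst distr_distr[OF fstm]) (auto simp: W_def comp_def)
    then show ?thesis by (simp add: iid(3) \<gamma>\<mu>)
  qed
  have dW: "distr W (PiM UNIV (\<lambda>_. borel)) ?p = PiM UNIV (\<lambda>_. \<mu>)"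
    using W.indep_vars_iff_distr_eq_PiM[where I="UNIV::nat set" and M'="\<lambda>_. borel" and X="\<lambda>i w. fst (w i)"] indW lawW
    by (auto simp: W.indep_vars_def restrict_UNIV)
  let ?\<xi> = "\<lambda>\<omega> i. X (Suc i) \<omega>"
  have Xm: "X i \<in> measurable P borel" if "1 \<le> i" for i
    using ind that by (auto simp: P.indep_vars_def)
  have \<xi>m: "?\<xi> \<in> measurable P (PiM UNIV (\<lambda>_. borel))"
    by (intro measurable_PiM_single' Xm) auto
  have dP: "distr P (PiM UNIV (\<lambda>_. borel)) ?\<xi> = PiM UNIV (\<lambda>_. \<mu>)"
    by (rule iid_distr_PiM[OF P ind law])
  obtain N where N: "{w \<in> space W. \<not> Q (?p w)} \<subseteq> N" "emeasure W N = 0" "N \<in> sets W"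
    using AE_E[OF Q[folded W_def]] by blast
  have "W.prob (space W - N) = 1" using N by (subst W.prob_compl) (auto simp: measure_def)
  then have E1: "emeasure W (- N) = 1" by (simp add: W.emeasure_eq_measure spW Compl_eq_Diff_UNIV)
  have E: "- N \<in> sets borel" using N(3) sW by auto
  have "\<exists>K. K \<subseteq> - N \<and> compact K \<and> 1 - inverse (real (Suc m)) < W.prob K" for m
  proof -
    have "(SUP K \<in> {K. K \<subseteq> - N \<and> compact K}. emeasure W K) = 1"
      using inner_regular[OF sW _ E] E1 W.emeasure_space_1 by simp
    moreover have "ennreal (1 - inverse (real (Suc m))) < 1"
      by (subst ennreal_less_one_iff) simp
    ultimately obtain K where K: "K \<subseteq> - N" "compact K" "ennreal (1 - inverse (real (Suc m))) < emeasure W K"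
      by (metis (mono_tags, lifting) less_SUP_iff mem_Collect_eq)
    have "0 \<le> 1 - inverse (real (Suc m))" by (simp add: inverse_le_1_iff)
    then have "1 - inverse (real (Suc m)) < W.prob K"
      using K(3) by (simp add: W.emeasure_eq_measure ennreal_less_iff)
    with K show ?thesis by blast
  qed
  then obtain K where K: "\<And>m. K m \<subseteq> - N" "\<And>m. compact (K m)" "\<And>m. 1 - inverse (real (Suc m)) < W.prob (K m)"
    by metis
  have cp: "continuous_on UNIV (?p :: (nat \<Rightarrow> 'a \<times> 'b) \<Rightarrow> nat \<Rightarrow> 'a)"
    by (intro continuous_on_coordinatewise_then_product continuous_intros continuous_on_product_coordinates)
  have KB: "?p ` K m \<in> sets (PiM UNIV (\<lambda>_. borel))" for m
    unfolding sets_PiM_equal_borel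
    by (intro borel_closed compact_imp_closed compact_continuous_image[OF continuous_on_subset[OF cp] K(2)]) auto
  have ge: "1 - inverse (real (Suc m)) < P.prob (?\<xi> -` (?p ` K m) \<inter> space P)" for m
  proof -
    have "P.prob (?\<xi> -` (?p ` K m) \<inter> space P) = measure (PiM UNIV (\<lambda>_. \<mu>)) (?p ` K m)"
      unfolding dP[symmetric] by (rule measure_distr[symmetric, OF \<xi>m KB])
    also have "\<dots> = W.prob (?p -` (?p ` K m) \<inter> space W)"
      unfolding dW[symmetric] by (rule measure_distr[OF pm KB])
    also have "\<dots> \<ge> W.prob (K m)"
      by (rule W.finite_measure_mono) (use spW measurable_sets[OF pm KB] in auto)
    finally show ?thesis using K(3)[of m] by linarith
  qed
  define G where "G = (\<Union>m. ?\<xi> -` (?p ` K m) \<inter> space P)"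
  have Gm: "G \<in> P.events" unfolding G_def by (intro sets.countable_UN) (use measurable_sets[OF \<xi>m KB] in auto)
  have "1 \<le> P.prob G"
  proof (rule field_le_epsilon)
    fix e :: real assume "0 < e"
    then obtain m where "inverse (real (Suc m)) < e" using reals_Archimedean by blast
    moreover have "P.prob (?\<xi> -` (?p ` K m) \<inter> space P) \<le> P.prob G"
      by (rule P.finite_measure_mono[OF _ Gm]) (auto simp: G_def)
    ultimately show "1 \<le> P.prob G + e" using ge[of m] by linarith
  qed
  then have "P.prob G = 1" using P.prob_le_1[of G] by linarith
  then have "AE \<omega> in P. \<omega> \<in> G" by (rule P.AE_prob_1)
  then show ?thesis
  proof eventually_elim
    case (elim \<omega>)
    then obtain m w where w: "w \<in> K m" "?\<xi> \<omega> = ?p w" by (auto simp: G_def)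
    then have "Q (?p w)" using N(1) K(1) spW by blast
    then show ?case using w(2) by simp
  qed
qed

section \<open>Lower semicontinuity and compactness for the total cost\<close>

text \<open>Integrating a lower semicontinuous kernel against narrowly converging measures is jointly
  lower semicontinuous in the parameter and the measure: the Lipschitz approximations are
  equicontinuous in the parameter.\<close>

lemma narrow_conv_section_liminf:
  fixes K :: "'p::metric_space \<times> 'q::metric_space \<Rightarrow> ennreal"
  assumes K: "lsc K" and conv: "narrow_conv \<nu> \<nu>'" and \<nu>: "\<And>n. \<nu> n \<in> borel_probs" "\<nu>' \<in> borel_probs"
    and a: "a < (\<integral>\<^sup>+q. K (p, q) \<partial>\<nu>')"
  shows "\<exists>U. open U \<and> p \<in> U \<and> (\<forall>\<^sub>F n in sequentially. \<forall>p'\<in>U. a \<le> (\<integral>\<^sup>+q. K (p', q) \<partial>\<nu> n))"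
proof -
  obtain h :: "nat \<Rightarrow> 'p \<times> 'q \<Rightarrow> real" where h: "\<And>k x. 0 \<le> h k x" "\<And>k x. h k x \<le> real k"
    "\<And>k x y. h k x \<le> h k y + real k * dist x y"
    "\<And>x. incseq (\<lambda>k. h k x)" "\<And>x. (SUP k. ennreal (h k x)) = K x" "\<And>k. continuous_on UNIV (h k)"
    using lsc_Lipschitz_approx[OF K] by metis
  have hc: "continuous_on UNIV (\<lambda>q. h k (p', q))" for k p'
    by (rule continuous_on_compose2[OF h(6)]) (auto intro!: continuous_intros)
  have hm: "(\<lambda>q. ennreal (h k (p', q))) \<in> borel_measurable borel" for k p'
    by (rule measurable_compose[OF borel_measurable_continuous_onI[OF hc] measurable_ennreal])
  have "(\<integral>\<^sup>+q. K (p, q) \<partial>\<nu>') = (\<integral>\<^sup>+q. (SUP k. ennreal (h k (p, q))) \<partial>\<nu>')" by (simp add: h(5))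
  also have "\<dots> = (SUP k. \<integral>\<^sup>+q. ennreal (h k (p, q)) \<partial>\<nu>')"
    by (rule nn_integral_monotone_convergence_SUP)
      (auto simp: incseq_def le_fun_def intro!: ennreal_leI incseqD[OF h(4)] borel_probs_measurable[OF \<nu>(2) hm])
  finally obtain k where k: "a < (\<integral>\<^sup>+q. ennreal (h k (p, q)) \<partial>\<nu>')"
    using a by (auto simp: less_SUP_iff)
  obtain b where b: "a < b" "b < (\<integral>\<^sup>+q. ennreal (h k (p, q)) \<partial>\<nu>')" using dense[OF k] by blast
  obtain r s where rs: "a = ennreal r" "b = ennreal s" "0 \<le> r" "0 \<le> s"
    using b by (cases a; cases b) auto
  then have "r < s" using b(1) by (simp add: ennreal_less_iff)
  define d where "d = (s - r) / (real k + 1)"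
  have d: "0 < d" using \<open>r < s\<close> by (simp add: d_def)
  have kd: "real k * d \<le> s - r"
  proof -
    have "real k * d \<le> (real k + 1) * d" using d by (intro mult_right_mono) auto
    then show ?thesis by (simp add: d_def)
  qed
  have "(\<lambda>n. \<integral>\<^sup>+q. ennreal (h k (p, q)) \<partial>\<nu> n) \<longlonglongrightarrow> (\<integral>\<^sup>+q. ennreal (h k (p, q)) \<partial>\<nu>')"
    by (rule narrow_convD_nn[OF conv \<nu> hc]) (use h in auto)
  then have ev: "\<forall>\<^sub>F n in sequentially. b < (\<integral>\<^sup>+q. ennreal (h k (p, q)) \<partial>\<nu> n)"
    using b(2) by (rule order_tendstoD)
  show ?thesis
  proof (intro exI[of _ "ball p d"] conjI)
    show "\<forall>\<^sub>F n in sequentially. \<forall>p'\<in>ball p d. a \<le> (\<integral>\<^sup>+q. K (p', q) \<partial>\<nu> n)"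
      using ev
    proof (eventually_elim, intro ballI)
      fix n p' assume n: "b < (\<integral>\<^sup>+q. ennreal (h k (p, q)) \<partial>\<nu> n)" and p': "p' \<in> ball p d"
      have "(\<integral>\<^sup>+q. ennreal (h k (p, q)) \<partial>\<nu> n) \<le> (\<integral>\<^sup>+q. ennreal (h k (p', q)) + ennreal (s - r) \<partial>\<nu> n)"
      proof (rule nn_integral_mono)
        fix q
        have "h k (p, q) \<le> h k (p', q) + real k * dist p p'" using h(3)[of k "(p, q)" "(p', q)"] by (simp add: dist_Pair_Pair)
        also have "real k * dist p p' \<le> real k * d" using p' by (intro mult_left_mono) auto
        also note kd
        finally show "ennreal (h k (p, q)) \<le> ennreal (h k (p', q)) + ennreal (s - r)"
          using h(1) \<open>r < s\<close> by (simp add: ennreal_plus[symmetric] ennreal_leI del: ennreal_plus)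
      qed
      also have "\<dots> = (\<integral>\<^sup>+q. ennreal (h k (p', q)) \<partial>\<nu> n) + ennreal (s - r)"
        using borel_probsD[OF \<nu>(1)] by (subst nn_integral_add) (auto intro: borel_probs_measurable[OF \<nu>(1) hm])
      also have "\<dots> \<le> (\<integral>\<^sup>+q. K (p', q) \<partial>\<nu> n) + ennreal (s - r)"
        by (intro add_right_mono nn_integral_mono) (auto simp: h(5)[symmetric] intro: SUP_upper)
      finally have "ennreal s < (\<integral>\<^sup>+q. K (p', q) \<partial>\<nu> n) + ennreal (s - r)" using n rs by auto
      then show "a \<le> (\<integral>\<^sup>+q. K (p', q) \<partial>\<nu> n)"
        using rs \<open>r < s\<close> by (cases "\<integral>\<^sup>+q. K (p', q) \<partial>\<nu> n") (auto simp: ennreal_plus[symmetric] ennreal_less_iff simp del: ennreal_plus)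
    qed
  qed (use d in auto)
qed

lemma narrow_conv_interaction_liminf:
  fixes K :: "'p::metric_space \<times> 'q::metric_space \<Rightarrow> ennreal"
  assumes "lsc K" "narrow_conv \<nu> \<nu>'" "\<And>n. \<nu> n \<in> borel_probs" "\<nu>' \<in> borel_probs"
    and "narrow_conv M M'" "\<And>n. M n \<in> borel_probs" "M' \<in> borel_probs"
  shows "(\<integral>\<^sup>+p. min T (\<integral>\<^sup>+q. K (p, q) \<partial>\<nu>') \<partial>M') \<le> liminf (\<lambda>n. \<integral>\<^sup>+p. min T (\<integral>\<^sup>+q. K (p, q) \<partial>\<nu> n) \<partial>M n)"
proof (rule narrow_conv_Fatou[OF assms(5-7)])
  fix z a assume "a < min T (\<integral>\<^sup>+q. K (z, q) \<partial>\<nu>')"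
  then have a: "a \<le> T" "a < (\<integral>\<^sup>+q. K (z, q) \<partial>\<nu>')" by auto
  obtain U where U: "open U" "z \<in> U" "\<forall>\<^sub>F n in sequentially. \<forall>p'\<in>U. a \<le> (\<integral>\<^sup>+q. K (p', q) \<partial>\<nu> n)"
    using narrow_conv_section_liminf[OF assms(1-4) a(2)] by blast
  have "\<forall>\<^sub>F n in sequentially. \<forall>z'\<in>U. a \<le> min T (\<integral>\<^sup>+q. K (z', q) \<partial>\<nu> n)"
    using U(3) by eventually_elim (use a in auto)
  then show "\<exists>U. open U \<and> z \<in> U \<and> (\<forall>\<^sub>F n in sequentially. \<forall>z'\<in>U. a \<le> min T (\<integral>\<^sup>+q. K (z', q) \<partial>\<nu> n))"
    using U by blast
qed

lemma measurable_fst_snd_borel: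
  "fst \<in> measurable borel borel" "snd \<in> measurable borel borel"
  by (intro borel_measurable_continuous_onI continuous_intros)+

lemma snd_marginal_borel_probs: "\<gamma> \<in> borel_probs \<Longrightarrow> snd_marginal \<gamma> \<in> borel_probs"
  unfolding snd_marginal_def by (rule distr_borel_probs[OF _ measurable_fst_snd_borel(2)])

lemma nn_integral_snd_marginal:
  assumes "\<gamma> \<in> borel_probs" "f \<in> borel_measurable borel"
  shows "(\<integral>\<^sup>+y. f y \<partial>snd_marginal \<gamma>) = (\<integral>\<^sup>+z. f (snd z) \<partial>\<gamma>)"
  unfolding snd_marginal_def
  by (rule nn_integral_distr) (auto intro: borel_probs_measurable[OF assms(1)] measurable_fst_snd_borel assms(2))

lemma narrow_conv_snd_marginal:
  fixes M :: "nat \<Rightarrow> ('a::topological_space \<times> 'b::topological_space) measure"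
  assumes "narrow_conv M M'" "\<And>n. M n \<in> borel_probs" "M' \<in> borel_probs"
  shows "narrow_conv (\<lambda>n. snd_marginal (M n)) (snd_marginal M')"
  unfolding snd_marginal_def by (rule narrow_conv_distr[OF assms]) (intro continuous_intros)

lemma narrow_conv_const_unique:
  fixes M :: "'a::{metric_space,second_countable_topology} measure"
  assumes "narrow_conv (\<lambda>n. M) M'" "M \<in> borel_probs" "M' \<in> borel_probs"
  shows "M' = M"
proof -
  obtain g :: "nat \<Rightarrow> 'a \<Rightarrow> real" where g: "\<And>k. continuous_on UNIV (g k)" "\<And>k x. 0 \<le> g k x" "\<And>k x. g k x \<le> 1"
    and det: "\<And>M M'. M \<in> borel_probs \<Longrightarrow> M' \<in> borel_probs \<Longrightarrow> (\<And>k. (\<integral>x. g k x \<partial>M) = (\<integral>x. g k x \<partial>M')) \<Longrightarrow> M = M'"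
    using countable_determining_functions by metis
  show ?thesis
  proof (rule det[OF assms(3,2)])
    fix k
    have "bounded (range (g k))" by (rule boundedI[of _ 1]) (use g in auto)
    then have "(\<lambda>n. \<integral>x. g k x \<partial>M) \<longlonglongrightarrow> (\<integral>x. g k x \<partial>M')"
      using assms(1) g(1) unfolding narrow_conv_def by blast
    then show "(\<integral>x. g k x \<partial>M') = (\<integral>x. g k x \<partial>M)" by (simp add: LIMSEQ_const_iff)
  qed
qed

lemma nn_integral_profile_plan:
  fixes x :: "nat \<Rightarrow> 'a::second_countable_topology" and f :: "'a \<times> 'b::second_countable_topology \<Rightarrow> ennreal"
  assumes N: "1 \<le> N" and \<nu>: "\<And>i. i \<in> {1..N} \<Longrightarrow> \<nu> i \<in> borel_probs" and f: "f \<in> borel_measurable borel"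
  shows "(\<integral>\<^sup>+z. f z \<partial>profile_plan N x \<nu>) = ennreal (1 / real N) * (\<Sum>i=1..N. \<integral>\<^sup>+y. f (x i, y) \<partial>\<nu> i)"
proof -
  have p: "return borel (x i) \<Otimes>\<^sub>M \<nu> i \<in> borel_probs"
    and I: "(\<integral>\<^sup>+z. f z \<partial>(return borel (x i) \<Otimes>\<^sub>M \<nu> i)) = (\<integral>\<^sup>+y. f (x i, y) \<partial>\<nu> i)" if i: "i \<in> {1..N}" for i
  proof -
    note b = borel_probsD[OF \<nu>[OF i]]
    interpret A: prob_space "return borel (x i)" by (rule prob_space_return) simp
    interpret B: prob_space "\<nu> i" by (rule b)
    interpret pair_prob_space "return borel (x i)" "\<nu> i" ..
    have s: "sets (return borel (x i) \<Otimes>\<^sub>M \<nu> i) = sets (borel \<Otimes>\<^sub>M borel)"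
      using b by (intro sets_pair_measure_cong) auto
    then show "return borel (x i) \<Otimes>\<^sub>M \<nu> i \<in> borel_probs"
      unfolding borel_prod using prob_space_axioms by (simp add: borel_probs_def)
    have "f \<in> borel_measurable (return borel (x i) \<Otimes>\<^sub>M \<nu> i)"
      unfolding measurable_cong_sets[OF s refl] borel_prod by (rule f)
    then have "(\<integral>\<^sup>+z. f z \<partial>(return borel (x i) \<Otimes>\<^sub>M \<nu> i)) = (\<integral>\<^sup>+x'. \<integral>\<^sup>+y. f (x', y) \<partial>\<nu> i \<partial>return borel (x i))"
      by (simp add: B.nn_integral_fst)
    also have "\<dots> = (\<integral>\<^sup>+y. f (x i, y) \<partial>\<nu> i)"
      using borel_measurable_section_integral[OF f \<nu>[OF i]] by (simp add: nn_integral_return)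
    finally show "(\<integral>\<^sup>+z. f z \<partial>(return borel (x i) \<Otimes>\<^sub>M \<nu> i)) = (\<integral>\<^sup>+y. f (x i, y) \<partial>\<nu> i)" .
  qed
  have "1 / of_nat N = ennreal (1 / real N)"
    using N divide_ennreal[of 1 "real N"] by (simp add: ennreal_of_nat_eq_real_of_nat)
  then have d: "s / of_nat N = ennreal (1 / real N) * s" for s :: ennreal
    by (metis ennreal_times_divide mult.commute mult.right_neutral)
  have "(\<integral>\<^sup>+z. f z \<partial>profile_plan N x \<nu>) = (\<Sum>i=1..N. \<integral>\<^sup>+z. f z \<partial>(return borel (x i) \<Otimes>\<^sub>M \<nu> i)) / of_nat N"
    unfolding profile_plan_def by (rule nn_integral_average[OF N p f])
  also have "(\<Sum>i=1..N. \<integral>\<^sup>+z. f z \<partial>(return borel (x i) \<Otimes>\<^sub>M \<nu> i)) = (\<Sum>i=1..N. \<integral>\<^sup>+y. f (x i, y) \<partial>\<nu> i)"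
    by (rule sum.cong[OF refl I])
  finally show ?thesis unfolding d .
qed

lemma profile_plan_borel_probs:
  fixes x :: "nat \<Rightarrow> 'a::second_countable_topology" and \<nu> :: "nat \<Rightarrow> 'b::second_countable_topology measure"
  assumes "1 \<le> N" "\<And>i. i \<in> {1..N} \<Longrightarrow> \<nu> i \<in> borel_probs"
  shows "profile_plan N x \<nu> \<in> borel_probs"
  using profile_plan_in_plans[of N \<nu> x, OF assms] by (simp add: plans_def)

abbreviation pure_plan :: "nat \<Rightarrow> (nat \<Rightarrow> 'a::topological_space) \<Rightarrow> (nat \<Rightarrow> 'b::topological_space) \<Rightarrow> ('a \<times> 'b) measure" where
  "pure_plan N x y \<equiv> profile_plan N x (\<lambda>i. return borel (y i))"

lemma nn_integral_pure_plan:
  fixes x :: "nat \<Rightarrow> 'a::second_countable_topology" and f :: "'a \<times> 'b::second_countable_topology \<Rightarrow> ennreal"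
  assumes "1 \<le> N" "f \<in> borel_measurable borel"
  shows "(\<integral>\<^sup>+z. f z \<partial>pure_plan N x y) = ennreal (1 / real N) * (\<Sum>i=1..N. f (x i, y i))"
  using section_measurable[OF assms(2)]
  by (subst nn_integral_profile_plan) (use assms in \<open>auto simp: return_borel_probs nn_integral_return\<close>)

context game_costs
begin

definition pair_cost :: "('a \<times> 'b) \<times> 'b \<Rightarrow> ennreal" where
  "pair_cost p = c (fst p) + L (snd (fst p)) + H (snd (fst p), snd p)"

lemma lsc_type_cost: "lsc (\<lambda>z. c z + L (snd z))"
  by (intro lsc_add lsc_c lsc_compose[OF lsc_L] continuous_intros)

lemma lsc_pair_cost: "lsc pair_cost"
  unfolding pair_cost_def[abs_def]
  by (intro lsc_add lsc_compose[OF lsc_c] lsc_compose[OF lsc_L] lsc_compose[OF lsc_H] continuous_intros)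

lemma Jcal_eq_pair_cost:
  assumes \<gamma>: "\<gamma> \<in> borel_probs"
  shows "Jcal c L H \<gamma> = (\<integral>\<^sup>+z. \<integral>\<^sup>+y. pair_cost (z, y) \<partial>snd_marginal \<gamma> \<partial>\<gamma>)"
proof -
  note \<nu> = snd_marginal_borel_probs[OF \<gamma>]
  note m = borel_probs_measurable[OF \<gamma>]
  let ?h = "\<lambda>y. \<integral>\<^sup>+y'. H (y, y') \<partial>snd_marginal \<gamma>"
  have h: "?h \<in> borel_measurable borel"
    by (rule borel_measurable_section_integral[OF measurable_costs(3) \<nu>])
  have in': "(\<integral>\<^sup>+y. pair_cost (z, y) \<partial>snd_marginal \<gamma>) = c z + L (snd z) + ?h (snd z)" for z
    unfolding pair_cost_def using borel_probsD[OF \<nu>]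
    by (simp, subst nn_integral_add)
      (auto intro!: borel_probs_measurable[OF \<nu>] section_measurable[OF measurable_costs(3)])
  have "(\<integral>\<^sup>+z. \<integral>\<^sup>+y. pair_cost (z, y) \<partial>snd_marginal \<gamma> \<partial>\<gamma>)
      = (\<integral>\<^sup>+z. c z \<partial>\<gamma>) + (\<integral>\<^sup>+z. L (snd z) \<partial>\<gamma>) + (\<integral>\<^sup>+z. ?h (snd z) \<partial>\<gamma>)"
    unfolding in' using m[OF measurable_costs(1)]
      m[OF measurable_compose[OF measurable_fst_snd_borel(2) measurable_costs(2)]]
      m[OF measurable_compose[OF measurable_fst_snd_borel(2) h]]
    by (simp add: nn_integral_add)
  also have "\<dots> = Jcal c L H \<gamma>"
    unfolding Jcal_def Lcal_def Hcal_iterated[OF measurable_costs(3) \<nu> \<nu>]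
    by (simp only: nn_integral_snd_marginal[OF \<gamma> measurable_costs(2)] nn_integral_snd_marginal[OF \<gamma> h])
  finally show ?thesis ..
qed

lemma Jcal_liminf:
  assumes "narrow_conv M M'" "\<And>n. M n \<in> borel_probs" "M' \<in> borel_probs"
  shows "Jcal c L H M' \<le> liminf (\<lambda>n. Jcal c L H (M n))"
  using narrow_conv_interaction_liminf[OF lsc_pair_cost narrow_conv_snd_marginal[OF assms]
    snd_marginal_borel_probs[OF assms(2)] snd_marginal_borel_probs[OF assms(3)] assms, of top]
  by (simp add: Jcal_eq_pair_cost assms)

text \<open>The first marginals are tight by hypothesis, the second ones by Markov's inequality, since \<open>L\<close> has
  compact sublevel sets.\<close>

lemma coercive_compactness:
  fixes M :: "nat \<Rightarrow> ('a \<times> 'b) measure" and R :: real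
  assumes M: "\<And>n. M n \<in> borel_probs"
    and tight: "\<And>e::real. 0 < e \<Longrightarrow> \<exists>K. compact K \<and> (\<forall>\<^sub>F n in sequentially. measure (distr (M n) borel fst) (- K) \<le> e)"
    and bound: "\<forall>\<^sub>F n in sequentially. (\<integral>\<^sup>+z. L (snd z) \<partial>M n) \<le> ennreal R"
  obtains r M' where "strict_mono r" "M' \<in> borel_probs" "narrow_conv (M \<circ> r) M'"
proof (rule Prokhorov[OF M])
  fix e :: real assume e: "0 < e"
  obtain K where K: "compact K" "\<forall>\<^sub>F n in sequentially. measure (distr (M n) borel fst) (- K) \<le> e / 2"
    using tight[of "e / 2"] e by auto
  define a where "a = 2 * (\<bar>R\<bar> + 1) / e"
  have a: "0 < a" using e by (simp add: a_def)
  define K' where "K' = {y. L y \<le> ennreal a}"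
  have cK: "compact (K \<times> K')" unfolding K'_def by (intro compact_Times K compact_L a)
  have "\<forall>\<^sub>F n in sequentially. measure (M n) (- (K \<times> K')) \<le> e"
    using K(2) bound
  proof eventually_elim
    case (elim n)
    interpret prob_space "M n" by (rule borel_probsD[OF M])
    note s = borel_probsD(2,3)[OF M[of n]]
    have Ls: "(\<lambda>z. L (snd z)) \<in> borel_measurable (M n)"
      by (intro borel_probs_measurable[OF M] measurable_compose[OF measurable_fst_snd_borel(2) measurable_costs(2)])
    have fm: "fst \<in> measurable (M n) borel" by (rule borel_probs_measurable[OF M measurable_fst_snd_borel(1)])
    have Kb: "- K \<in> sets borel" by (rule borel_comp[OF borel_closed[OF compact_imp_closed[OF K(1)]]])
    have A: "fst -` (- K) \<inter> space (M n) \<in> sets (M n)" by (rule measurable_sets[OF fm Kb])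
    have B: "{z \<in> space (M n). 1 \<le> ennreal (1 / a) * L (snd z)} \<in> sets (M n)"
      using Ls by measurable
    have pA: "prob (fst -` (- K) \<inter> space (M n)) \<le> e / 2"
      using elim(1) by (simp add: measure_distr[OF fm Kb])
    have "emeasure (M n) {z \<in> space (M n). 1 \<le> ennreal (1 / a) * L (snd z)} \<le> ennreal (1 / a) * (\<integral>\<^sup>+z. L (snd z) \<partial>M n)"
    proof -
      have "emeasure (M n) ({z \<in> space (M n). 1 \<le> ennreal (1 / a) * L (snd z)}) \<le> ennreal (1 / a) * (\<integral>\<^sup>+z. L (snd z) * indicator (space (M n)) z \<partial>M n)"
        using nn_integral_Markov_inequality[of "\<lambda>z. L (snd z)" "space (M n)" "M n" "ennreal (1/a)"] Ls by simp
      then show ?thesis by (simp cong: nn_integral_cong)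
    qed
    also have "\<dots> \<le> ennreal (1 / a) * ennreal R" by (intro mult_left_mono elim(2)) simp
    also have "\<dots> \<le> ennreal (1 / a * \<bar>R\<bar>)" by (subst ennreal_mult) (use a in \<open>auto intro!: mult_left_mono ennreal_leI\<close>)
    also have "\<dots> \<le> ennreal (e / 2)"
      using e by (intro ennreal_leI) (simp add: a_def field_simps)
    finally have pB: "prob {z \<in> space (M n). 1 \<le> ennreal (1 / a) * L (snd z)} \<le> e / 2"
      using e by (simp add: emeasure_eq_measure)
    have "- (K \<times> K') \<subseteq> (fst -` (- K) \<inter> space (M n)) \<union> {z \<in> space (M n). 1 \<le> ennreal (1 / a) * L (snd z)}"
    proof
      fix z :: "'a \<times> 'b" assume z: "z \<in> - (K \<times> K')"
      have "1 \<le> ennreal (1 / a) * L (snd z)" if "snd z \<notin> K'"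
      proof -
        have "ennreal (1 / a) * ennreal a \<le> ennreal (1 / a) * L (snd z)"
          using that by (intro mult_left_mono) (auto simp: K'_def)
        then show ?thesis using a by (simp add: ennreal_mult[symmetric])
      qed
      then show "z \<in> (fst -` (- K) \<inter> space (M n)) \<union> {z \<in> space (M n). 1 \<le> ennreal (1 / a) * L (snd z)}"
        using z s by (cases z) auto
    qed
    then have "prob (- (K \<times> K')) \<le> prob ((fst -` (- K) \<inter> space (M n)) \<union> {z \<in> space (M n). 1 \<le> ennreal (1 / a) * L (snd z)})"
      by (rule finite_measure_mono) (use A B in auto)
    also have "\<dots> \<le> prob (fst -` (- K) \<inter> space (M n)) + prob {z \<in> space (M n). 1 \<le> ennreal (1 / a) * L (snd z)}"
      by (rule measure_Un_le[OF A B])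
    finally show ?case using pA pB by linarith
  qed
  then show "\<exists>K. compact K \<and> (\<forall>\<^sub>F n in sequentially. measure (M n) (- K) \<le> e)" using cK by blast
qed (rule that)

lemma L_le_Jcal: "\<gamma> \<in> borel_probs \<Longrightarrow> (\<integral>\<^sup>+z. L (snd z) \<partial>\<gamma>) \<le> Jcal c L H \<gamma>"
  by (simp add: Jcal_def Lcal_def nn_integral_snd_marginal add_increasing2 add_increasing)

lemma Jcal_minimiser_exists:
  assumes \<mu>: "\<mu> \<in> borel_probs" and fin: "(INF \<gamma>\<in>plans \<mu>. Jcal c L H \<gamma>) < \<infinity>"
  obtains \<gamma> where "\<gamma> \<in> plans \<mu>" "Jcal c L H \<gamma> = (INF \<gamma>\<in>plans \<mu>. Jcal c L H \<gamma>)"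
proof -
  let ?I = "INF \<gamma>\<in>plans \<mu>. Jcal c L H \<gamma>"
  obtain i where i: "?I = ennreal i" "0 \<le> i" using fin by (cases ?I) auto
  have "\<exists>\<gamma>\<in>plans \<mu>. Jcal c L H \<gamma> < ennreal (i + inverse (real (Suc n)))" for n
  proof -
    have "?I < ennreal (i + inverse (real (Suc n)))" using i by (simp add: ennreal_less_iff del: ennreal_plus)
    then show ?thesis by (simp only: INF_less_iff)
  qed
  then obtain M where M: "\<And>n. M n \<in> plans \<mu>" "\<And>n. Jcal c L H (M n) < ennreal (i + inverse (real (Suc n)))" by metis
  have Mb: "M n \<in> borel_probs" and M\<mu>: "distr (M n) borel fst = \<mu>" for n using M(1)[of n] by (auto simp: plans_def)
  obtain r M' where r: "strict_mono r" "M' \<in> borel_probs" "narrow_conv (M \<circ> r) M'"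
  proof (rule coercive_compactness[where R="i + 1", OF Mb])
    show "\<exists>K. compact K \<and> (\<forall>\<^sub>F n in sequentially. measure (distr (M n) borel fst) (- K) \<le> e)" if "0 < e" for e :: real
      using tight_measure[OF \<mu> that] unfolding M\<mu> by (auto intro: less_imp_le)
    show "\<forall>\<^sub>F n in sequentially. (\<integral>\<^sup>+z. L (snd z) \<partial>M n) \<le> ennreal (i + 1)"
    proof (rule always_eventually, rule)
      fix n
      have "(\<integral>\<^sup>+z. L (snd z) \<partial>M n) \<le> Jcal c L H (M n)" by (rule L_le_Jcal[OF Mb])
      also have "\<dots> \<le> ennreal (i + inverse (real (Suc n)))" using M(2)[of n] by simp
      also have "\<dots> \<le> ennreal (i + 1)" by (intro ennreal_leI) (simp add: inverse_le_1_iff)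
      finally show "(\<integral>\<^sup>+z. L (snd z) \<partial>M n) \<le> ennreal (i + 1)" .
    qed
  qed
  have Mr: "(M \<circ> r) n \<in> borel_probs" for n using Mb by simp
  have "narrow_conv (\<lambda>n. distr ((M \<circ> r) n) borel fst) (distr M' borel fst)"
    by (rule narrow_conv_distr[OF r(3) Mr r(2)]) (intro continuous_intros)
  then have "narrow_conv (\<lambda>n. \<mu>) (distr M' borel fst)" by (simp add: M\<mu>)
  then have "distr M' borel fst = \<mu>"
    by (rule narrow_conv_const_unique[OF _ \<mu> distr_borel_probs[OF r(2) measurable_fst_snd_borel(1)]])
  then have M': "M' \<in> plans \<mu>" using r(2) by (simp add: plans_def)
  have "Jcal c L H M' \<le> liminf (\<lambda>n. Jcal c L H ((M \<circ> r) n))" by (rule Jcal_liminf[OF r(3) Mr r(2)])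
  also have "\<dots> \<le> liminf (\<lambda>n. ennreal (i + inverse (real (Suc n))))"
  proof (intro Liminf_mono always_eventually allI)
    fix n
    have "Jcal c L H ((M \<circ> r) n) \<le> ennreal (i + inverse (real (Suc (r n))))" using M(2)[of "r n"] by simp
    also have "\<dots> \<le> ennreal (i + inverse (real (Suc n)))"
      using seq_suble[OF r(1), of n] by (intro ennreal_leI) simp
    finally show "Jcal c L H ((M \<circ> r) n) \<le> ennreal (i + inverse (real (Suc n)))" .
  qed
  also have "\<dots> = ?I"
  proof -
    have "(\<lambda>n. i + inverse (real (Suc n))) \<longlonglongrightarrow> i + 0" by (intro tendsto_intros LIMSEQ_inverse_real_of_nat)
    then have "(\<lambda>n. ennreal (i + inverse (real (Suc n)))) \<longlonglongrightarrow> ennreal i" by (intro tendsto_ennrealI) simp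
    then show ?thesis using i by (simp add: lim_imp_Liminf)
  qed
  finally have "Jcal c L H M' \<le> ?I" .
  then have "Jcal c L H M' = ?I" using M' by (intro antisym) (auto intro: INF_lower)
  with M' show thesis by (rule that)
qed

text \<open>The interaction of the empirical measure with itself exceeds that in the potential by the
  diagonal terms, which are negligible once the interaction has been truncated.\<close>

lemma truncated_cost_le_potential:
  fixes x :: "nat \<Rightarrow> 'a" and y :: "nat \<Rightarrow> 'b"
  assumes N: "1 \<le> N"
  defines "\<gamma> \<equiv> pure_plan N x y"
  shows "(\<integral>\<^sup>+z. \<integral>\<^sup>+y'. c z + L (snd z) + min (H (snd z, y')) (of_nat k) \<partial>snd_marginal \<gamma> \<partial>\<gamma>)
    \<le> potential N x y + ennreal (real k / real N)"
proof -
  let ?e = "ennreal (1 / real N)"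
  have \<gamma>: "\<gamma> \<in> borel_probs" unfolding \<gamma>_def by (intro profile_plan_borel_probs N return_borel_probs)
  note \<nu> = snd_marginal_borel_probs[OF \<gamma>]
  let ?m = "\<lambda>z. min (H z) (of_nat k)"
  have mm: "?m \<in> borel_measurable borel" by measurable
  have in': "(\<integral>\<^sup>+y'. c z + L (snd z) + ?m (snd z, y') \<partial>snd_marginal \<gamma>)
      = c z + L (snd z) + ?e * (\<Sum>j=1..N. ?m (snd z, y j))" for z
  proof -
    have "(\<integral>\<^sup>+y'. c z + L (snd z) + ?m (snd z, y') \<partial>snd_marginal \<gamma>)
        = c z + L (snd z) + (\<integral>\<^sup>+y'. ?m (snd z, y') \<partial>snd_marginal \<gamma>)"
      using borel_probsD[OF \<nu>] section_measurable[OF mm]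
      by (subst nn_integral_add) (auto intro!: borel_probs_measurable[OF \<nu>])
    also have "(\<integral>\<^sup>+y'. ?m (snd z, y') \<partial>snd_marginal \<gamma>) = (\<integral>\<^sup>+w. ?m (snd z, snd w) \<partial>\<gamma>)"
      by (rule nn_integral_snd_marginal[OF \<gamma> section_measurable[OF mm]])
    also have "\<dots> = ?e * (\<Sum>j=1..N. ?m (snd z, y j))"
      unfolding \<gamma>_def
      by (subst nn_integral_pure_plan[OF N])
        (auto intro: measurable_compose[OF measurable_fst_snd_borel(2) section_measurable[OF mm]])
    finally show ?thesis .
  qed
  have om: "(\<lambda>z. c z + L (snd z) + ?e * (\<Sum>j=1..N. ?m (snd z, y j))) \<in> borel_measurable borel"
  proof -
    have "(\<lambda>z. ?m (snd z, y j)) \<in> borel_measurable borel" for j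
      by (rule measurable_compose[OF measurable_fst_snd_borel(2)])
        (rule measurable_compose[OF _ mm], intro borel_measurable_continuous_onI continuous_intros)
    then show ?thesis
      by (intro borel_measurable_add borel_measurable_times_ennreal borel_measurable_const borel_measurable_sum
          measurable_costs measurable_compose[OF measurable_fst_snd_borel(2) measurable_costs(2)])
  qed
  have "(\<integral>\<^sup>+z. \<integral>\<^sup>+y'. c z + L (snd z) + ?m (snd z, y') \<partial>snd_marginal \<gamma> \<partial>\<gamma>)
      = ?e * (\<Sum>i=1..N. c (x i, y i) + L (y i) + ?e * (\<Sum>j=1..N. ?m (y i, y j)))"
    unfolding in' unfolding \<gamma>_def by (subst nn_integral_pure_plan[OF N om]) simp
  also have "\<dots> \<le> ?e * (\<Sum>i=1..N. c (x i, y i) + L (y i) + ?e * (of_nat k + (\<Sum>j\<in>{1..N} - {i}. H (y i, y j))))"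
  proof (intro mult_left_mono sum_mono add_left_mono)
    fix i assume i: "i \<in> {1..N}"
    have "(\<Sum>j=1..N. ?m (y i, y j)) = ?m (y i, y i) + (\<Sum>j\<in>{1..N} - {i}. ?m (y i, y j))"
      using i by (intro sum.remove) auto
    also have "\<dots> \<le> of_nat k + (\<Sum>j\<in>{1..N} - {i}. H (y i, y j))" by (intro add_mono sum_mono) auto
    finally show "(\<Sum>j=1..N. ?m (y i, y j)) \<le> of_nat k + (\<Sum>j\<in>{1..N} - {i}. H (y i, y j))" .
  qed auto
  also have "\<dots> = ?e * (\<Sum>i=1..N. c (x i, y i) + L (y i)) + ?e * ?e * (\<Sum>i=1..N. \<Sum>j\<in>{1..N} - {i}. H (y i, y j))
      + ?e * ?e * (of_nat N * of_nat k)"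
    by (simp add: sum.distrib distrib_left sum_distrib_left[symmetric] mult_ac add_ac)
  also have "?e * ?e = ennreal (1 / (real N)\<^sup>2)"
    by (simp add: ennreal_mult[symmetric] power2_eq_square)
  also have "ennreal (1 / (real N)\<^sup>2) * (of_nat N * of_nat k) = ennreal (real k / real N)"
    using N by (simp add: ennreal_of_nat_eq_real_of_nat ennreal_mult[symmetric] power2_eq_square)
  finally show ?thesis by (simp add: potential_def)
qed

lemma SUP_truncated_cost:
  assumes \<gamma>: "\<gamma> \<in> borel_probs"
  shows "(SUP k. \<integral>\<^sup>+z. \<integral>\<^sup>+y'. c z + L (snd z) + min (H (snd z, y')) (of_nat k) \<partial>snd_marginal \<gamma> \<partial>\<gamma>) = Jcal c L H \<gamma>"
proof -
  note \<nu> = snd_marginal_borel_probs[OF \<gamma>]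
  define f where "f k p = c (fst p) + L (snd (fst p)) + min (H (snd (fst p), snd p)) (of_nat k)" for k :: nat and p :: "('a \<times> 'b) \<times> 'b"
  have "lsc (f k)" for k unfolding f_def
    by (intro lsc_add lsc_min lsc_const lsc_compose[OF lsc_c] lsc_compose[OF lsc_L] lsc_compose[OF lsc_H] continuous_intros)
  then have fm: "f k \<in> borel_measurable borel" for k by (rule lsc_measurable)
  have inc: "incseq f"
    by (auto simp: incseq_def le_fun_def f_def min_le_iff_disj intro!: add_left_mono)
  have sup: "(SUP k. f k p) = pair_cost p" for p
  proof -
    have "(SUP k. min h (of_nat k)) = h" for h :: ennreal
      using inf_SUP[of h "\<lambda>k. of_nat k" UNIV] by (simp add: inf_min ennreal_SUP_of_nat_eq_top)
    then show ?thesis unfolding f_def pair_cost_def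
      by (subst ennreal_SUP_add_right[symmetric]) auto
  qed
  have "Jcal c L H \<gamma> = (\<integral>\<^sup>+z. \<integral>\<^sup>+y. (SUP k. f k (z, y)) \<partial>snd_marginal \<gamma> \<partial>\<gamma>)"
    by (simp add: Jcal_eq_pair_cost[OF \<gamma>] sup)
  also have "\<dots> = (\<integral>\<^sup>+z. (SUP k. \<integral>\<^sup>+y. f k (z, y) \<partial>snd_marginal \<gamma>) \<partial>\<gamma>)"
    using inc by (intro nn_integral_cong nn_integral_monotone_convergence_SUP)
      (auto simp: incseq_def le_fun_def intro!: borel_probs_measurable[OF \<nu>] section_measurable[OF fm])
  also have "\<dots> = (SUP k. \<integral>\<^sup>+z. \<integral>\<^sup>+y. f k (z, y) \<partial>snd_marginal \<gamma> \<partial>\<gamma>)"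
    using inc by (intro nn_integral_monotone_convergence_SUP)
      (auto simp: incseq_def le_fun_def intro!: nn_integral_mono borel_probs_measurable[OF \<gamma>] borel_measurable_section_integral[OF fm \<nu>])
  finally show ?thesis by (simp add: f_def)
qed

text \<open>The \<open>\<Gamma>\<close>-liminf inequality, together with the compactness that goes with it.\<close>

lemma potential_cluster:
  assumes typical: "typical_sequence \<mu> x" and r: "strict_mono r" "\<And>n. 1 \<le> r n"
    and lim: "(\<lambda>n. potential (r n) x (y n)) \<longlonglongrightarrow> \<beta>" and fin: "\<beta> < top"
  obtains q \<gamma> where "strict_mono q" "\<gamma> \<in> plans \<mu>" "narrow_conv (\<lambda>n. pure_plan (r (q n)) x (y (q n))) \<gamma>" "Jcal c L H \<gamma> \<le> \<beta>"
proof -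
  define M where "M n = pure_plan (r n) x (y n)" for n
  have Mp: "M n \<in> plans (empirical (r n) x)" for n
    unfolding M_def by (rule profile_plan_in_plans[OF r(2) return_borel_probs])
  then have Mb: "M n \<in> borel_probs" and Me: "distr (M n) borel fst = empirical (r n) x" for n
    by (auto simp: plans_def)
  obtain l where l: "\<beta> = ennreal l" "0 \<le> l" using fin by (cases \<beta>) auto
  obtain q \<gamma> where q: "strict_mono q" "\<gamma> \<in> borel_probs" "narrow_conv (M \<circ> q) \<gamma>"
  proof (rule coercive_compactness[where R="l + 1", OF Mb])
    fix e :: real assume "0 < e"
    then obtain K where K: "compact K" "\<forall>\<^sub>F N in sequentially. measure (empirical N x) (- K) \<le> e"
      using typical unfolding typical_sequence_def by blast
    then show "\<exists>K. compact K \<and> (\<forall>\<^sub>F n in sequentially. measure (distr (M n) borel fst) (- K) \<le> e)"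
      unfolding Me using eventually_subseq[OF r(1) K(2)] by blast
  next
    have "\<beta> < ennreal (l + 1)" using l by (simp add: ennreal_less_iff del: ennreal_plus)
    with lim have "\<forall>\<^sub>F n in sequentially. potential (r n) x (y n) < ennreal (l + 1)" by (rule order_tendstoD)
    then show "\<forall>\<^sub>F n in sequentially. (\<integral>\<^sup>+z. L (snd z) \<partial>M n) \<le> ennreal (l + 1)"
    proof eventually_elim
      case (elim n)
      have "(\<integral>\<^sup>+z. L (snd z) \<partial>M n) = ennreal (1 / real (r n)) * (\<Sum>i=1..r n. L (y n i))"
        unfolding M_def
        by (subst nn_integral_pure_plan[OF r(2)])
          (auto intro: measurable_compose[OF measurable_fst_snd_borel(2) measurable_costs(2)])
      also have "\<dots> \<le> ennreal (1 / real (r n)) * (\<Sum>i=1..r n. c (x i, y n i) + L (y n i))"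
        by (intro mult_left_mono sum_mono) auto
      also have "\<dots> \<le> potential (r n) x (y n)" by (rule cost_le_potential)
      finally show ?case using elim by simp
    qed
  qed
  have Mq: "(M \<circ> q) n \<in> borel_probs" for n using Mb by simp
  have rq: "strict_mono (r \<circ> q)" using r(1) q(1) by (rule strict_mono_o)
  have "narrow_conv (\<lambda>n. distr ((M \<circ> q) n) borel fst) (distr \<gamma> borel fst)"
    by (rule narrow_conv_distr[OF q(3) Mq q(2)]) (intro continuous_intros)
  then have "narrow_conv (\<lambda>n. empirical ((r \<circ> q) n) x) (distr \<gamma> borel fst)" by (simp add: Me)
  then have "distr \<gamma> borel fst = \<mu>"
    using typical rq distr_borel_probs[OF q(2) measurable_fst_snd_borel(1)] unfolding typical_sequence_def by blast
  then have \<gamma>: "\<gamma> \<in> plans \<mu>" using q(2) by (simp add: plans_def)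
  have limq: "(\<lambda>n. potential (r (q n)) x (y (q n))) \<longlonglongrightarrow> \<beta>"
    using LIMSEQ_subseq_LIMSEQ[OF lim q(1)] by (simp add: comp_def)
  have "Jcal c L H \<gamma> \<le> \<beta>"
    unfolding SUP_truncated_cost[OF q(2), symmetric]
  proof (rule SUP_least)
    fix k :: nat
    let ?K = "\<lambda>p. c (fst p) + L (snd (fst p)) + min (H (snd (fst p), snd p)) (of_nat k)"
    have K: "lsc ?K"
      by (intro lsc_add lsc_min lsc_const lsc_compose[OF lsc_c] lsc_compose[OF lsc_L] lsc_compose[OF lsc_H] continuous_intros)
    have "(\<integral>\<^sup>+z. \<integral>\<^sup>+y'. ?K (z, y') \<partial>snd_marginal \<gamma> \<partial>\<gamma>)
        \<le> liminf (\<lambda>n. \<integral>\<^sup>+z. \<integral>\<^sup>+y'. ?K (z, y') \<partial>snd_marginal ((M \<circ> q) n) \<partial>(M \<circ> q) n)"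
      using narrow_conv_interaction_liminf[OF K narrow_conv_snd_marginal[OF q(3) Mq q(2)]
          snd_marginal_borel_probs[OF Mq] snd_marginal_borel_probs[OF q(2)] q(3) Mq q(2), of top]
      by simp
    also have "\<dots> \<le> liminf (\<lambda>n. potential (r (q n)) x (y (q n)) + ennreal (real k / real (r (q n))))"
      by (intro Liminf_mono always_eventually allI)
        (use truncated_cost_le_potential[OF r(2)] in \<open>simp add: M_def\<close>)
    also have "\<dots> = \<beta>"
    proof (rule lim_imp_Liminf)
      have "filterlim (\<lambda>n. real (r (q n))) at_top sequentially"
        using filterlim_compose[OF filterlim_real_sequentially filterlim_subseq[OF rq]] by (simp add: comp_def)
      then have "(\<lambda>n. real k / real (r (q n))) \<longlonglongrightarrow> 0" by (rule tendsto_divide_0[OF tendsto_const filterlim_at_top_imp_at_infinity])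
      then have "(\<lambda>n. ennreal (real k / real (r (q n)))) \<longlonglongrightarrow> ennreal 0" by (rule tendsto_ennrealI)
      from tendsto_add[OF limq this]
      show "(\<lambda>n. potential (r (q n)) x (y (q n)) + ennreal (real k / real (r (q n)))) \<longlonglongrightarrow> \<beta>" by simp
    qed simp
    finally show "(\<integral>\<^sup>+z. \<integral>\<^sup>+y'. c z + L (snd z) + min (H (snd z, y')) (of_nat k) \<partial>snd_marginal \<gamma> \<partial>\<gamma>) \<le> \<beta>" by simp
  qed
  with q(1) \<gamma> show thesis using q(3) by (intro that) (auto simp: M_def comp_def)
qed

end

section \<open>Minimisers are Cournot--Nash equilibria\<close>

lemma lsc_section_integral:
  fixes K :: "'p::metric_space \<times> 'q::metric_space \<Rightarrow> ennreal"
  assumes K: "lsc K" and \<nu>: "\<nu> \<in> borel_probs"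
  shows "lsc (\<lambda>p. \<integral>\<^sup>+q. K (p, q) \<partial>\<nu>)"
proof (rule lsc_localI)
  fix p a assume "a < (\<integral>\<^sup>+q. K (p, q) \<partial>\<nu>)"
  then obtain b where b: "a < b" "b < (\<integral>\<^sup>+q. K (p, q) \<partial>\<nu>)" using dense by blast
  have "narrow_conv (\<lambda>n. \<nu>) \<nu>" by (simp add: narrow_conv_def)
  from narrow_conv_section_liminf[OF K this \<nu> \<nu> b(2)]
  obtain U where U: "open U" "p \<in> U" "\<forall>p'\<in>U. b \<le> (\<integral>\<^sup>+q. K (p', q) \<partial>\<nu>)"
    by (auto simp: eventually_sequentially)
  then show "\<exists>U. open U \<and> p \<in> U \<and> (\<forall>p'\<in>U. a < (\<integral>\<^sup>+q. K (p', q) \<partial>\<nu>))"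
    using b(1) by (meson less_le_trans)
qed

lemma nn_integral_swap_borel:
  fixes f :: "'p::second_countable_topology \<times> 'q::second_countable_topology \<Rightarrow> ennreal"
  assumes f: "f \<in> borel_measurable borel" and M: "M \<in> borel_probs" "M' \<in> borel_probs"
  shows "(\<integral>\<^sup>+x. \<integral>\<^sup>+y. f (x, y) \<partial>M' \<partial>M) = (\<integral>\<^sup>+y. \<integral>\<^sup>+x. f (x, y) \<partial>M \<partial>M')"
proof -
  interpret A: sigma_finite_measure M by (rule borel_probsD[OF M(1)])
  interpret B: sigma_finite_measure M' by (rule borel_probsD[OF M(2)])
  interpret pair_sigma_finite M M' ..
  have s: "sets (M \<Otimes>\<^sub>M M') = sets (borel \<Otimes>\<^sub>M borel)"
    using borel_probsD(2)[OF M(1)] borel_probsD(2)[OF M(2)] by (rule sets_pair_measure_cong)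
  have "case_prod (\<lambda>x y. f (x, y)) \<in> borel_measurable (M \<Otimes>\<^sub>M M')"
    unfolding measurable_cong_sets[OF s refl] borel_prod using f by simp
  then show ?thesis by (rule Fubini'[symmetric])
qed

lemma Hcal_commute:
  fixes H :: "'b::second_countable_topology \<times> 'b \<Rightarrow> ennreal"
  assumes H: "H \<in> borel_measurable borel" and sym: "\<And>y y'. H (y, y') = H (y', y)"
    and \<nu>: "\<nu> \<in> borel_probs" "\<nu>' \<in> borel_probs"
  shows "Hcal H \<nu> \<nu>' = Hcal H \<nu>' \<nu>"
  using nn_integral_swap_borel[OF H \<nu>] sym by (simp add: Hcal_iterated[OF H] \<nu>)

context game_costs
begin

abbreviation type_cost :: "('a \<times> 'b) measure \<Rightarrow> ennreal" where
  "type_cost \<gamma> \<equiv> \<integral>\<^sup>+z. c z + L (snd z) \<partial>\<gamma>"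

lemma type_cost_measurable: "(\<lambda>z. c z + L (snd z)) \<in> borel_measurable borel"
  by (rule lsc_measurable[OF lsc_type_cost])

lemma section_H_measurable:
  assumes "\<nu> \<in> borel_probs"
  shows "(\<lambda>y. \<integral>\<^sup>+y'. H (y, y') \<partial>\<nu>) \<in> borel_measurable borel"
    "(\<lambda>z. \<integral>\<^sup>+y'. H (snd z, y') \<partial>\<nu>) \<in> borel_measurable borel"
  using borel_measurable_section_integral[OF measurable_costs(3) assms]
    measurable_compose[OF measurable_fst_snd_borel(2)] by auto

lemma Jcal_eq_type_cost:
  assumes \<gamma>: "\<gamma> \<in> borel_probs"
  shows "Jcal c L H \<gamma> = type_cost \<gamma> + Hcal H (snd_marginal \<gamma>) (snd_marginal \<gamma>)"
proof -
  have "type_cost \<gamma> = (\<integral>\<^sup>+z. c z \<partial>\<gamma>) + (\<integral>\<^sup>+z. L (snd z) \<partial>\<gamma>)"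
    by (rule nn_integral_add)
      (intro borel_probs_measurable[OF \<gamma>] measurable_costs measurable_compose[OF measurable_fst_snd_borel(2)])+
  then show ?thesis
    by (simp only: Jcal_def Lcal_def nn_integral_snd_marginal[OF \<gamma> measurable_costs(2)])
qed

lemma lsc_Phi:
  assumes "\<nu> \<in> borel_probs"
  shows "lsc (\<lambda>z. Phi c L H (fst z) (snd z) \<nu>)"
proof -
  have "lsc (\<lambda>z. c (fst z, snd z) + L (snd z) + ennreal 2 * (\<integral>\<^sup>+y'. H (snd z, y') \<partial>\<nu>))"
    by (intro lsc_add lsc_cmult lsc_compose[OF lsc_c] lsc_compose[OF lsc_L]
        lsc_compose[OF lsc_section_integral[OF lsc_H assms]] continuous_intros) simp
  then show ?thesis by (simp add: Phi_def)
qed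

lemma nn_integral_Phi:
  assumes \<gamma>: "\<gamma> \<in> borel_probs" and \<nu>: "\<nu> \<in> borel_probs"
  shows "(\<integral>\<^sup>+z. Phi c L H (fst z) (snd z) \<nu> \<partial>\<gamma>) = type_cost \<gamma> + 2 * Hcal H (snd_marginal \<gamma>) \<nu>"
proof -
  note m = borel_probs_measurable[OF \<gamma>]
  have "(\<integral>\<^sup>+z. Phi c L H (fst z) (snd z) \<nu> \<partial>\<gamma>) = type_cost \<gamma> + 2 * (\<integral>\<^sup>+z. \<integral>\<^sup>+y'. H (snd z, y') \<partial>\<nu> \<partial>\<gamma>)"
    unfolding Phi_def prod.collapse
    using m[OF type_cost_measurable] m[OF section_H_measurable(2)[OF \<nu>]]
    by (simp add: nn_integral_add nn_integral_cmult)
  then show ?thesis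
    by (simp only: Hcal_iterated[OF measurable_costs(3) snd_marginal_borel_probs[OF \<gamma>] \<nu>]
        nn_integral_snd_marginal[OF \<gamma> section_H_measurable(1)[OF \<nu>]])
qed

lemma Phi_coercive:
  assumes "a < top"
  shows "\<exists>K. compact K \<and> (\<forall>x y. Phi c L H (fst (x, y)) (snd (x, y)) \<nu> \<le> a \<longrightarrow> y \<in> K)"
proof -
  obtain K where K: "compact K" "\<And>y. L y \<le> a \<Longrightarrow> y \<in> K" using compact_sublevel_L[OF assms] by blast
  have "L y \<le> Phi c L H x y \<nu>" for x y unfolding Phi_def by (simp add: add_increasing2 add_increasing)
  then have "y \<in> K" if "Phi c L H x y \<nu> \<le> a" for x y using that K(2) order_trans by blast
  then show ?thesis using K(1) by (intro exI[of _ K]) simp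
qed

lemma lsc_inf_Phi:
  assumes "\<nu> \<in> borel_probs"
  shows "lsc (\<lambda>x. INF y. Phi c L H x y \<nu>)" "\<exists>y. Phi c L H x y \<nu> = (INF y. Phi c L H x y \<nu>)"
  using lsc_partial_INF[OF lsc_Phi[OF assms] Phi_coercive] by simp_all

text \<open>The set of pairs of a type and an optimal strategy is Borel because the optimal cost is lower
  semicontinuous in the type.\<close>

lemma cournot_nash_iff_AE:
  assumes \<gamma>: "\<gamma> \<in> plans \<mu>"
  shows "cournot_nash c L H \<mu> \<gamma> \<longleftrightarrow>
    (AE z in \<gamma>. Phi c L H (fst z) (snd z) (snd_marginal \<gamma>) \<le> (INF y. Phi c L H (fst z) y (snd_marginal \<gamma>)))"
proof -
  have \<gamma>b: "\<gamma> \<in> borel_probs" using \<gamma> by (simp add: plans_def)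
  note \<nu> = snd_marginal_borel_probs[OF \<gamma>b]
  interpret prob_space \<gamma> by (rule borel_probsD[OF \<gamma>b])
  let ?\<Phi> = "\<lambda>z. Phi c L H (fst z) (snd z) (snd_marginal \<gamma>)"
  let ?m = "\<lambda>z. INF y. Phi c L H (fst z) y (snd_marginal \<gamma>)"
  have meas: "?\<Phi> \<in> borel_measurable \<gamma>" "?m \<in> borel_measurable \<gamma>"
    by (intro borel_probs_measurable[OF \<gamma>b] lsc_measurable[OF lsc_Phi[OF \<nu>]])
      (intro borel_probs_measurable[OF \<gamma>b] measurable_compose[OF measurable_fst_snd_borel(1) lsc_measurable[OF lsc_inf_Phi(1)[OF \<nu>]]])
  have eq: "{(x, y). y \<in> argmin (\<lambda>y'. Phi c L H x y' (snd_marginal \<gamma>))} = {z \<in> space \<gamma>. ?\<Phi> z \<le> ?m z}"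
    using borel_probsD(3)[OF \<gamma>b] by (auto simp: argmin_def le_INF_iff)
  have "{z \<in> space \<gamma>. ?\<Phi> z \<le> ?m z} \<in> events" using meas by measurable
  then have "emeasure \<gamma> {z \<in> space \<gamma>. ?\<Phi> z \<le> ?m z} = 1 \<longleftrightarrow> (AE z in \<gamma>. ?\<Phi> z \<le> ?m z)"
    by (simp add: emeasure_eq_measure prob_Collect_eq_1)
  then show ?thesis using \<gamma> unfolding cournot_nash_def eq by simp
qed

text \<open>First-order optimality along the segment from \<open>\<gamma>\<close> to \<open>\<gamma>\<^sub>1\<close>. The point of the segment with
  weight \<open>1 / N\<close> at \<open>\<gamma>\<^sub>1\<close> is an average of \<open>N\<close> plans; the energy is quadratic along the segment,
  and \<open>\<Phi>\<close> is its derivative.\<close>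

lemma minimiser_first_order:
  assumes \<gamma>: "\<gamma> \<in> plans \<mu>" and fin: "Jcal c L H \<gamma> < top"
    and min: "\<And>\<gamma>'. \<gamma>' \<in> plans \<mu> \<Longrightarrow> Jcal c L H \<gamma> \<le> Jcal c L H \<gamma>'"
    and \<gamma>1: "\<gamma>1 \<in> plans \<mu>" and fin1: "Hcal H (snd_marginal \<gamma>1) (snd_marginal \<gamma>1) < top"
  shows "(\<integral>\<^sup>+z. Phi c L H (fst z) (snd z) (snd_marginal \<gamma>) \<partial>\<gamma>) \<le> (\<integral>\<^sup>+z. Phi c L H (fst z) (snd z) (snd_marginal \<gamma>) \<partial>\<gamma>1)"
proof (rule ccontr)
  assume neg: "\<not> ?thesis"
  have b: "\<gamma> \<in> borel_probs" "\<gamma>1 \<in> borel_probs" using \<gamma> \<gamma>1 by (auto simp: plans_def)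
  define \<nu> where "\<nu> = snd_marginal \<gamma>"
  define \<nu>1 where "\<nu>1 = snd_marginal \<gamma>1"
  have \<nu>: "\<nu> \<in> borel_probs" "\<nu>1 \<in> borel_probs" unfolding \<nu>_def \<nu>1_def by (intro snd_marginal_borel_probs b)+
  have lt: "type_cost \<gamma>1 + 2 * Hcal H \<nu>1 \<nu> < type_cost \<gamma> + 2 * Hcal H \<nu> \<nu>"
    using neg unfolding nn_integral_Phi[OF b(1) \<nu>(1), unfolded \<nu>_def] nn_integral_Phi[OF b(2) \<nu>(1), unfolded \<nu>_def]
    by (simp add: \<nu>_def \<nu>1_def not_le)
  have J: "Jcal c L H \<gamma> = type_cost \<gamma> + Hcal H \<nu> \<nu>" unfolding \<nu>_def by (rule Jcal_eq_type_cost[OF b(1)])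
  have fin': "type_cost \<gamma> < top" "Hcal H \<nu> \<nu> < top" "type_cost \<gamma>1 < top" "Hcal H \<nu>1 \<nu> < top" "Hcal H \<nu>1 \<nu>1 < top"
  proof -
    show 1: "type_cost \<gamma> < top" "Hcal H \<nu> \<nu> < top" using fin unfolding J by auto
    have "type_cost \<gamma>1 + 2 * Hcal H \<nu>1 \<nu> < top" using lt by (rule less_le_trans) simp
    then show "type_cost \<gamma>1 < top" "Hcal H \<nu>1 \<nu> < top" by (auto simp: ennreal_mult_less_top)
    show "Hcal H \<nu>1 \<nu>1 < top" using fin1 by (simp add: \<nu>1_def)
  qed
  obtain C0 C1 h00 h10 h11 where r: "type_cost \<gamma> = ennreal C0" "type_cost \<gamma>1 = ennreal C1" "Hcal H \<nu> \<nu> = ennreal h00"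
      "Hcal H \<nu>1 \<nu> = ennreal h10" "Hcal H \<nu>1 \<nu>1 = ennreal h11" "0 \<le> C0" "0 \<le> C1" "0 \<le> h00" "0 \<le> h10" "0 \<le> h11"
  proof -
    have "\<exists>r. t = ennreal r \<and> 0 \<le> r" if "t < top" for t :: ennreal using that by (cases t) auto
    then show thesis using fin' that by meson
  qed
  have comm: "Hcal H \<nu> \<nu>1 = ennreal h10"
    using Hcal_commute[OF measurable_costs(3) sym_H \<nu>] r(4) by simp
  have bound: "real N * (C0 + 2 * h00 - C1 - 2 * h10) \<le> h00 + h11 - 2 * h10" if N: "1 \<le> N" for N
  proof -
    let ?e = "ennreal (1 / real N)"
    define m where "m i = (if i = 1 then \<gamma>1 else \<gamma>)" for i :: nat
    define \<gamma>N where "\<gamma>N = average N m"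
    have mb: "m i \<in> borel_probs" for i by (simp add: m_def b)
    have \<gamma>Nb: "\<gamma>N \<in> borel_probs" unfolding \<gamma>N_def by (rule average_borel_probs[OF N mb])
    have "1 / of_nat N = ?e"
      using N divide_ennreal[of 1 "real N"] by (simp add: ennreal_of_nat_eq_real_of_nat)
    then have d: "s / of_nat N = ?e * s" for s :: ennreal
      by (metis ennreal_times_divide mult.commute mult.right_neutral)
    have E: "(\<integral>\<^sup>+z. f z \<partial>\<gamma>N) = ?e * ((\<integral>\<^sup>+z. f z \<partial>\<gamma>1) + ennreal (real N - 1) * (\<integral>\<^sup>+z. f z \<partial>\<gamma>))"
      if "f \<in> borel_measurable borel" for f
    proof -
      have "(\<Sum>i=1..N. \<integral>\<^sup>+z. f z \<partial>m i) = (\<integral>\<^sup>+z. f z \<partial>\<gamma>1) + (\<Sum>i\<in>{1..N} - {1}. \<integral>\<^sup>+z. f z \<partial>\<gamma>)"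
        using N by (subst sum.remove[of _ 1]) (auto simp: m_def)
      also have "(\<Sum>i\<in>{1..N} - {1}. \<integral>\<^sup>+z. f z \<partial>\<gamma>) = of_nat (N - 1) * (\<integral>\<^sup>+z. f z \<partial>\<gamma>)"
        using N by (simp add: card_Diff_singleton)
      also have "of_nat (N - 1) = ennreal (real N - 1)" using N by (simp add: ennreal_of_nat_eq_real_of_nat of_nat_diff)
      finally show ?thesis unfolding \<gamma>N_def nn_integral_average[OF N mb that] d by simp
    qed
    have "\<gamma>N \<in> plans \<mu>"
    proof -
      have "distr \<gamma>N borel fst = \<mu>"
      proof (rule measure_eqI)
        have s\<mu>: "sets \<mu> = sets borel" using \<gamma> by (auto simp: plans_def)
        then show "sets (distr \<gamma>N borel fst) = sets \<mu>" by simp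
        fix A assume "A \<in> sets (distr \<gamma>N borel (fst :: 'a \<times> 'b \<Rightarrow> 'a))"
        then have A: "A \<in> sets borel" by simp
        have fA: "fst -` A \<in> sets (borel :: ('a \<times> 'b) measure)"
          using measurable_sets[OF measurable_fst_snd_borel(1) A] by simp
        have em: "emeasure \<mu> A = emeasure \<gamma>' (fst -` A)" if "\<gamma>' \<in> plans \<mu>" for \<gamma>' :: "('a \<times> 'b) measure"
        proof -
          have b': "\<gamma>' \<in> borel_probs" and d': "distr \<gamma>' borel fst = \<mu>" using that by (auto simp: plans_def)
          show ?thesis unfolding d'[symmetric] using borel_probsD(3)[OF b']
            by (simp add: emeasure_distr[OF borel_probs_measurable[OF b' measurable_fst_snd_borel(1)] A])
        qed
        have "emeasure (distr \<gamma>N borel fst) A = (\<integral>\<^sup>+z. indicator (fst -` A) z \<partial>\<gamma>N)"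
          using borel_probsD(2,3)[OF \<gamma>Nb] fA
          by (simp add: emeasure_distr[OF borel_probs_measurable[OF \<gamma>Nb measurable_fst_snd_borel(1)] A])
        also have "\<dots> = ?e * (emeasure \<gamma>1 (fst -` A) + ennreal (real N - 1) * emeasure \<gamma> (fst -` A))"
          using borel_probsD(2)[OF b(1)] borel_probsD(2)[OF b(2)] fA by (subst E) auto
        also have "\<dots> = ?e * ((1 + ennreal (real N - 1)) * emeasure \<mu> A)"
          by (simp add: em[OF \<gamma>, symmetric] em[OF \<gamma>1, symmetric] distrib_right)
        also have "1 + ennreal (real N - 1) = ennreal (real N)"
          using N by (simp add: ennreal_plus[symmetric] ennreal_1[symmetric] del: ennreal_plus ennreal_1)
        also have "?e * (ennreal (real N) * emeasure \<mu> A) = emeasure \<mu> A"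
          using N by (simp add: mult.assoc[symmetric] ennreal_mult[symmetric])
        finally show "emeasure (distr \<gamma>N borel fst) A = emeasure \<mu> A" .
      qed
      then show ?thesis using \<gamma>Nb by (simp add: plans_def)
    qed
    then have le: "Jcal c L H \<gamma> \<le> Jcal c L H \<gamma>N" by (rule min)
    define \<nu>N where "\<nu>N = snd_marginal \<gamma>N"
    have \<nu>N: "\<nu>N \<in> borel_probs" unfolding \<nu>N_def by (rule snd_marginal_borel_probs[OF \<gamma>Nb])
    have E2: "(\<integral>\<^sup>+y. f y \<partial>\<nu>N) = ?e * ((\<integral>\<^sup>+y. f y \<partial>\<nu>1) + ennreal (real N - 1) * (\<integral>\<^sup>+y. f y \<partial>\<nu>))"
      if f: "f \<in> borel_measurable borel" for f
      unfolding \<nu>N_def \<nu>1_def \<nu>_def nn_integral_snd_marginal[OF \<gamma>Nb f] nn_integral_snd_marginal[OF b(1) f] nn_integral_snd_marginal[OF b(2) f]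
      by (rule E) (rule measurable_compose[OF measurable_fst_snd_borel(2) f])
    have lin: "Hcal H \<nu>N \<nu>' = ?e * (Hcal H \<nu>1 \<nu>' + ennreal (real N - 1) * Hcal H \<nu> \<nu>')" if "\<nu>' \<in> borel_probs" for \<nu>'
      by (simp only: Hcal_iterated[OF measurable_costs(3) _ that] \<nu> \<nu>N E2[OF section_H_measurable(1)[OF that]])
    have lin': "Hcal H \<nu>' \<nu>N = ?e * (Hcal H \<nu>1 \<nu>' + ennreal (real N - 1) * Hcal H \<nu> \<nu>')" if "\<nu>' \<in> borel_probs" for \<nu>'
      using Hcal_commute[OF measurable_costs(3) sym_H that \<nu>N] lin[OF that] by simp
    have HN: "Hcal H \<nu>N \<nu>N = ennreal ((h11 + 2 * (real N - 1) * h10 + (real N - 1)\<^sup>2 * h00) / (real N)\<^sup>2)"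
    proof -
      have n1: "0 \<le> real N - 1" using N by simp
      have "Hcal H \<nu>N \<nu>N = ?e * (?e * (ennreal h11 + ennreal (real N - 1) * ennreal h10)
          + ennreal (real N - 1) * (?e * (ennreal h10 + ennreal (real N - 1) * ennreal h00)))"
        unfolding lin[OF \<nu>N] lin'[OF \<nu>(1)] lin'[OF \<nu>(2)] r comm ..
      also have "\<dots> = ennreal ((1 / real N) * ((1 / real N) * (h11 + (real N - 1) * h10)
          + (real N - 1) * ((1 / real N) * (h10 + (real N - 1) * h00))))"
        using n1 r by (simp only: ennreal_mult[symmetric] ennreal_plus[symmetric] mult_nonneg_nonneg add_nonneg_nonneg divide_nonneg_nonneg of_nat_0_le_iff zero_le_one)
      also have "(1 / real N) * ((1 / real N) * (h11 + (real N - 1) * h10)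
          + (real N - 1) * ((1 / real N) * (h10 + (real N - 1) * h00)))
        = (h11 + 2 * (real N - 1) * h10 + (real N - 1)\<^sup>2 * h00) / (real N)\<^sup>2"
        using N by (simp add: field_simps power2_eq_square)
      finally show ?thesis .
    qed
    have CN: "type_cost \<gamma>N = ennreal ((C1 + (real N - 1) * C0) / real N)"
    proof -
      have n1: "0 \<le> real N - 1" using N by simp
      have "type_cost \<gamma>N = ?e * (ennreal C1 + ennreal (real N - 1) * ennreal C0)"
        unfolding E[OF type_cost_measurable] r ..
      also have "\<dots> = ennreal ((1 / real N) * (C1 + (real N - 1) * C0))"
        using n1 r by (simp only: ennreal_mult[symmetric] ennreal_plus[symmetric] mult_nonneg_nonneg add_nonneg_nonneg divide_nonneg_nonneg of_nat_0_le_iff zero_le_one)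
      finally show ?thesis by simp
    qed
    have n1: "0 \<le> real N - 1" using N by simp
    have "ennreal (C0 + h00) \<le> ennreal ((C1 + (real N - 1) * C0) / real N + (h11 + 2 * (real N - 1) * h10 + (real N - 1)\<^sup>2 * h00) / (real N)\<^sup>2)"
      using le unfolding J Jcal_eq_type_cost[OF \<gamma>Nb] \<nu>N_def[symmetric] HN CN r
      using n1 r by (subst (asm) (1 2) ennreal_plus[symmetric]) auto
    then have "C0 + h00 \<le> (C1 + (real N - 1) * C0) / real N + (h11 + 2 * (real N - 1) * h10 + (real N - 1)\<^sup>2 * h00) / (real N)\<^sup>2"
      using n1 r by (subst (asm) ennreal_le_iff) auto
    then have "(real N)\<^sup>2 * (C0 + h00) \<le> (real N)\<^sup>2 * ((C1 + (real N - 1) * C0) / real N + (h11 + 2 * (real N - 1) * h10 + (real N - 1)\<^sup>2 * h00) / (real N)\<^sup>2)"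
      by (rule mult_left_mono) simp
    also have "\<dots> = real N * (C1 + (real N - 1) * C0) + (h11 + 2 * (real N - 1) * h10 + (real N - 1)\<^sup>2 * h00)"
    proof -
      have "(real N)\<^sup>2 * (s / real N + t / (real N)\<^sup>2) = real N * s + t" for s t :: real
        using N by (simp add: field_simps power2_eq_square)
      then show ?thesis .
    qed
    finally have "(real N)\<^sup>2 * (C0 + h00) \<le> real N * (C1 + (real N - 1) * C0) + (h11 + 2 * (real N - 1) * h10 + (real N - 1)\<^sup>2 * h00)" .
    then show ?thesis by (simp add: algebra_simps power2_eq_square)
  qed
  define D where "D = C0 + 2 * h00 - C1 - 2 * h10"
  have "0 < D"
  proof -
    have "ennreal (C1 + 2 * h10) < ennreal (C0 + 2 * h00)"
      using lt r by (simp add: ennreal_mult)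
    then show ?thesis unfolding D_def using r by (subst (asm) ennreal_less_iff) auto
  qed
  then obtain n where n: "(h00 + h11 - 2 * h10) < real n * D" using reals_Archimedean3 by blast
  have "real n * D \<le> real (Suc n) * D" using \<open>0 < D\<close> by (intro mult_right_mono) auto
  then show False using bound[of "Suc n"] n unfolding D_def by simp
qed

end

text \<open>Players whose type and strategy lie in \<open>A\<close> redraw their strategy from a kernel depending on
  their type.\<close>

lemma plan_replacement:
  fixes \<gamma> :: "('a::second_countable_topology \<times> 'b::second_countable_topology) measure"
  assumes \<gamma>: "\<gamma> \<in> plans \<mu>" and A: "A \<in> sets borel"
    and k: "k \<in> measurable borel (subprob_algebra borel)" "\<And>x. k x \<in> borel_probs"
  obtains \<gamma>1 where "\<gamma>1 \<in> plans \<mu>"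
    "\<And>f. f \<in> borel_measurable borel \<Longrightarrow>
      (\<integral>\<^sup>+w. f w \<partial>\<gamma>1) = (\<integral>\<^sup>+w. (if w \<in> A then \<integral>\<^sup>+z. f (fst w, z) \<partial>k (fst w) else f w) \<partial>\<gamma>)"
proof -
  have \<gamma>b: "\<gamma> \<in> borel_probs" and \<gamma>\<mu>: "distr \<gamma> borel fst = \<mu>" using \<gamma> by (auto simp: plans_def)
  define B where "B w = (if w \<in> A then distr (k (fst w)) borel (Pair (fst w)) else return borel w)" for w
  have pc: "Pair x \<in> measurable borel borel" for x :: 'a
    by (intro borel_measurable_continuous_onI continuous_intros)
  have Bb: "B w \<in> borel_probs" for w
    unfolding B_def by (cases "w \<in> A") (simp_all only: if_True if_False distr_borel_probs[OF k(2) pc] return_borel_probs)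
  have Bm: "B \<in> measurable borel (subprob_algebra borel)"
    unfolding B_def
  proof (rule measurable_If_set)
    show "(\<lambda>w::'a \<times> 'b. distr (k (fst w)) borel (Pair (fst w))) \<in> measurable borel (subprob_algebra borel)"
    proof (rule measurable_distr2)
      show "(\<lambda>w::'a \<times> 'b. k (fst w)) \<in> measurable borel (subprob_algebra borel)"
        by (rule measurable_compose[OF measurable_fst_snd_borel(1) k(1)])
      have "(\<lambda>p::('a \<times> 'b) \<times> 'b. (fst (fst p), snd p)) \<in> measurable borel borel"
        by (intro borel_measurable_continuous_onI continuous_intros)
      then show "(\<lambda>(w::'a \<times> 'b, z::'b). (fst w, z)) \<in> measurable (borel \<Otimes>\<^sub>M borel) borel"
        unfolding borel_prod by (simp add: case_prod_beta')
    qed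
    show "A \<inter> space borel \<in> sets borel" using A by simp
  qed (rule return_measurable)
  have Bm': "B \<in> measurable \<gamma> (subprob_algebra borel)" by (rule borel_probs_measurable[OF \<gamma>b Bm])
  define \<gamma>1 where "\<gamma>1 = \<gamma> \<bind> B"
  have int: "(\<integral>\<^sup>+w. f w \<partial>\<gamma>1) = (\<integral>\<^sup>+w. (if w \<in> A then \<integral>\<^sup>+z. f (fst w, z) \<partial>k (fst w) else f w) \<partial>\<gamma>)"
    if f: "f \<in> borel_measurable borel" for f
  proof -
    have "(\<integral>\<^sup>+v. f v \<partial>B w) = (if w \<in> A then \<integral>\<^sup>+z. f (fst w, z) \<partial>k (fst w) else f w)" for w
      unfolding B_def using f
      by (simp add: nn_integral_return nn_integral_distr[OF borel_probs_measurable[OF k(2) pc]])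
    then show ?thesis unfolding \<gamma>1_def nn_integral_bind[OF f Bm'] by simp
  qed
  have sp: "space \<gamma> \<noteq> {}" using borel_probsD(3)[OF \<gamma>b] by simp
  have b1: "\<gamma>1 \<in> borel_probs"
    unfolding borel_probs_def
  proof (intro CollectI conjI)
    interpret prob_space \<gamma> by (rule borel_probsD[OF \<gamma>b])
    show "prob_space \<gamma>1" unfolding \<gamma>1_def
      by (rule prob_space_bind[OF _ Bm']) (use borel_probsD(1)[OF Bb] in auto)
    show "sets \<gamma>1 = sets borel" unfolding \<gamma>1_def
      by (rule sets_bind[OF _ sp]) (use borel_probsD(2)[OF Bb] in auto)
  qed
  have "distr \<gamma>1 borel fst = \<mu>"
  proof (rule measure_eqI)
    show "sets (distr \<gamma>1 borel fst) = sets \<mu>" unfolding \<gamma>\<mu>[symmetric] by simp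
    fix S assume "S \<in> sets (distr \<gamma>1 borel (fst :: 'a \<times> 'b \<Rightarrow> 'a))"
    then have S: "S \<in> sets borel" by simp
    have im: "(\<lambda>w::'a \<times> 'b. indicator S (fst w) :: ennreal) \<in> borel_measurable borel"
      by (rule measurable_compose[OF measurable_fst_snd_borel(1) borel_measurable_indicator[OF S]])
    have eq: "emeasure (distr M borel fst) S = (\<integral>\<^sup>+w. indicator S (fst w) \<partial>M)" if M: "M \<in> borel_probs" for M :: "('a \<times> 'b) measure"
    proof -
      have "emeasure (distr M borel fst) S = (\<integral>\<^sup>+x. indicator S x \<partial>distr M borel fst)" using S by simp
      also have "\<dots> = (\<integral>\<^sup>+w. indicator S (fst w) \<partial>M)"
        by (rule nn_integral_distr) (use S borel_probs_measurable[OF M measurable_fst_snd_borel(1)] in auto)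
      finally show ?thesis .
    qed
    have "(if w \<in> A then \<integral>\<^sup>+z. indicator S (fst (fst w, z)) \<partial>k (fst w) else indicator S (fst w)) = (indicator S (fst w) :: ennreal)" for w :: "'a \<times> 'b"
      using borel_probsD[OF k(2)[of "fst w"]] by simp
    then show "emeasure (distr \<gamma>1 borel fst) S = emeasure \<mu> S"
      unfolding eq[OF b1] \<gamma>\<mu>[symmetric] eq[OF \<gamma>b] int[OF im] by simp
  qed
  with b1 have "\<gamma>1 \<in> plans \<mu>" by (simp add: plans_def)
  then show thesis using int by (rule that)
qed

lemma measurable_family_kernel:
  assumes "measurable_family k"
  shows "k \<in> measurable borel (subprob_algebra borel)" "\<And>y. k y \<in> borel_probs"
proof -
  show b: "\<And>y. k y \<in> borel_probs" using assms by (simp add: measurable_family_def)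
  show "k \<in> measurable borel (subprob_algebra borel)"
  proof (rule measurable_subprob_algebra)
    show "subprob_space (k y)" for y by (rule prob_space_imp_subprob_space[OF borel_probsD(1)[OF b]])
    show "sets (k y) = sets borel" for y by (rule borel_probsD(2)[OF b])
    show "(\<lambda>y. emeasure (k y) B) \<in> borel_measurable borel" if "B \<in> sets borel" for B
      using assms that by (simp add: measurable_family_def)
  qed
qed

lemma kernel_integral_measurable:
  fixes f :: "'p::second_countable_topology \<times> 'q::second_countable_topology \<Rightarrow> ennreal"
  assumes f: "f \<in> borel_measurable borel" and k: "k \<in> measurable borel (subprob_algebra borel)"
  shows "(\<lambda>p. \<integral>\<^sup>+z. f (p, z) \<partial>k p) \<in> borel_measurable borel"
proof (rule nn_integral_measurable_subprob_algebra2[OF _ k])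
  show "(\<lambda>(p, z). f (p, z)) \<in> borel_measurable (borel \<Otimes>\<^sub>M borel)"
    unfolding borel_prod using f by simp
qed

lemma AE_less_rationals:
  fixes f g :: "'a \<Rightarrow> ennreal"
  assumes "\<not> (AE z in M. g z \<le> f z)"
  obtains a b :: real where "0 \<le> a" "a < b" "\<not> (AE z in M. \<not> (f z \<le> ennreal a \<and> ennreal b < g z))"
proof -
  have "\<exists>p q :: rat. 0 \<le> p \<and> p < q \<and> \<not> (AE z in M. \<not> (f z \<le> ennreal (of_rat p) \<and> ennreal (of_rat q) < g z))"
  proof (rule ccontr)
    assume "\<not> ?thesis"
    then have "AE z in M. \<forall>p q :: rat. 0 \<le> p \<and> p < q \<longrightarrow> \<not> (f z \<le> ennreal (of_rat p) \<and> ennreal (of_rat q) < g z)"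
      unfolding AE_all_countable by auto
    then have "AE z in M. g z \<le> f z"
    proof eventually_elim
      case (elim z)
      show ?case
      proof (rule ccontr)
        assume "\<not> g z \<le> f z"
        then obtain s where s: "f z < s" "s < g z" using dense[of "f z" "g z"] by (auto simp: not_le)
        then obtain f' s' where r: "f z = ennreal f'" "s = ennreal s'" "0 \<le> f'" "0 \<le> s'"
          by (cases "f z"; cases s) auto
        then have lt: "f' < s'" using s(1) by (simp add: ennreal_less_iff)
        obtain p where p: "f' < of_rat p" "of_rat p < s'" using of_rat_dense[OF lt] by auto
        obtain q where q: "(of_rat p :: real) < of_rat q" "(of_rat q :: real) < s'" using of_rat_dense[OF p(2)] by auto
        have "0 \<le> (of_rat p :: real)" using p(1) r(3) by linarith
        then have "0 \<le> p" "p < q" using q(1) by (auto simp: of_rat_less zero_le_of_rat_iff)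
        moreover have "f z \<le> ennreal (of_rat p)" unfolding r using p(1) by (intro ennreal_leI) simp
        moreover have "ennreal (of_rat q) < g z"
          using s(2) q(2) unfolding r by (meson ennreal_leI le_less_trans less_imp_le)
        ultimately show False using elim by blast
      qed
    qed
    then show False using assms by blast
  qed
  then show thesis using that by (metis of_rat_less zero_le_of_rat_iff)
qed

context game_costs
begin

text \<open>If the cost field of a minimiser exceeded its minimum on a set of positive mass, moving this
  mass close to a measurable selection of minimisers would lower the energy to first order. The
  kernels \<open>\<kappa> n\<close> spread the selected points so that the moved mass has finite self-interaction;
  without them the second-order term could be infinite.\<close>

lemma minimiser_cournot_nash:
  assumes \<gamma>: "\<gamma> \<in> plans \<mu>" and fin: "Jcal c L H \<gamma> < top"
    and min: "\<And>\<gamma>'. \<gamma>' \<in> plans \<mu> \<Longrightarrow> Jcal c L H \<gamma> \<le> Jcal c L H \<gamma>'"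
    and C: "\<And>n. C n < top" and \<kappa>: "\<And>n. measurable_family (\<kappa> n)"
    and \<kappa>H: "\<And>n y y'. Hcal H (\<kappa> n y) (\<kappa> n y') \<le> C n * (1 + L y + L y')"
    and \<kappa>lim: "\<And>x y \<nu>. \<nu> \<in> borel_probs \<Longrightarrow> Phi c L H x y \<nu> < \<infinity> \<Longrightarrow>
      (\<lambda>n. \<integral>\<^sup>+z. Phi c L H x z \<nu> \<partial>\<kappa> n y) \<longlonglongrightarrow> Phi c L H x y \<nu>"
  shows "cournot_nash c L H \<mu> \<gamma>"
proof (rule ccontr)
  assume neg: "\<not> cournot_nash c L H \<mu> \<gamma>"
  have \<gamma>b: "\<gamma> \<in> borel_probs" using \<gamma> by (simp add: plans_def)
  interpret prob_space \<gamma> by (rule borel_probsD[OF \<gamma>b])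
  note m\<gamma> = borel_probs_measurable[OF \<gamma>b]
  define \<nu> where "\<nu> = snd_marginal \<gamma>"
  have \<nu>: "\<nu> \<in> borel_probs" unfolding \<nu>_def by (rule snd_marginal_borel_probs[OF \<gamma>b])
  define \<Phi> where "\<Phi> z = Phi c L H (fst z) (snd z) \<nu>" for z
  define m where "m x = (INF y. Phi c L H x y \<nu>)" for x
  have lsc\<Phi>: "lsc \<Phi>" unfolding \<Phi>_def[abs_def] by (rule lsc_Phi[OF \<nu>])
  have \<Phi>m: "\<Phi> \<in> borel_measurable borel" by (rule lsc_measurable[OF lsc\<Phi>])
  have mm: "m \<in> borel_measurable borel" unfolding m_def by (rule lsc_measurable[OF lsc_inf_Phi(1)[OF \<nu>]])
  have "\<not> (AE z in \<gamma>. \<Phi> z \<le> m (fst z))"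
    using neg unfolding cournot_nash_iff_AE[OF \<gamma>] \<Phi>_def m_def \<nu>_def .
  then obtain a b :: real where ab: "0 \<le> a" "a < b" "\<not> (AE z in \<gamma>. \<not> (m (fst z) \<le> ennreal a \<and> ennreal b < \<Phi> z))"
    by (rule AE_less_rationals)
  define a' where "a' = (a + b) / 2"
  have a': "a < a'" "a' < b" "0 \<le> a'" using ab by (auto simp: a'_def)
  have La: "L y \<le> ennreal a" if "\<Phi> (x, y) \<le> ennreal a" for x y
    by (rule order_trans[OF _ that]) (simp add: \<Phi>_def Phi_def add_increasing2 add_increasing)
  obtain K where K: "compact K" "\<And>y. L y \<le> ennreal a \<Longrightarrow> y \<in> K" using compact_sublevel_L[of "ennreal a"] by auto
  obtain T where T: "T \<in> measurable borel borel"
    and Tsel: "\<And>x. \<exists>y\<in>K. (x, y) \<in> {z. \<Phi> z \<le> ennreal a} \<Longrightarrow> T x \<in> K \<and> (x, T x) \<in> {z. \<Phi> z \<le> ennreal a}"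
    using closed_compact_selection[OF lsc_closed_le[OF lsc\<Phi>] K(1)] by metis
  have Ta: "\<Phi> (x, T x) \<le> ennreal a" if "m x \<le> ennreal a" for x
  proof -
    obtain y where "Phi c L H x y \<nu> = m x" using lsc_inf_Phi(2)[OF \<nu>] unfolding m_def by blast
    then have "\<Phi> (x, y) \<le> ennreal a" using that by (simp add: \<Phi>_def)
    then show ?thesis using Tsel[of x] K(2) La by blast
  qed
  define k where "k n x = \<kappa> n (T x)" for n x
  have km: "k n \<in> measurable borel (subprob_algebra borel)" and kb: "k n x \<in> borel_probs" for n x
    unfolding k_def using measurable_compose[OF T measurable_family_kernel(1)[OF \<kappa>]] measurable_family_kernel(2)[OF \<kappa>] by auto
  \<comment> \<open>The field felt by a player of type \<open>x\<close> after the move; it is eventually below \<open>a'\<close> where the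
    selected strategy has a field of at most \<open>a\<close>, so some \<open>n\<close> serves a set of positive mass.\<close>
  define u where "u n x = (\<integral>\<^sup>+z. \<Phi> (x, z) \<partial>k n x)" for n x
  have um: "u n \<in> borel_measurable borel" for n
    unfolding u_def by (rule kernel_integral_measurable[OF \<Phi>m km])
  define A where "A n = {z. m (fst z) \<le> ennreal a \<and> ennreal b < \<Phi> z \<and> u n (fst z) \<le> ennreal a'}" for n
  have mfst: "(\<lambda>z::'a \<times> 'b. m (fst z)) \<in> borel_measurable borel" "(\<lambda>z::'a \<times> 'b. u n (fst z)) \<in> borel_measurable borel" for n
    by (rule measurable_compose[OF measurable_fst_snd_borel(1) mm], rule measurable_compose[OF measurable_fst_snd_borel(1) um])
  have Am: "A n \<in> sets borel" for n
  proof -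
    have "{z \<in> space borel. m (fst z) \<le> ennreal a \<and> ennreal b < \<Phi> z \<and> u n (fst z) \<le> ennreal a'} \<in> sets borel"
      using mfst \<Phi>m by measurable
    then show ?thesis by (simp add: A_def)
  qed
  have "\<exists>n. emeasure \<gamma> (A n) \<noteq> 0"
  proof (rule ccontr)
    assume "\<not> ?thesis"
    then have "A n \<in> null_sets \<gamma>" for n using Am borel_probsD(2)[OF \<gamma>b] by (auto simp: null_sets_def)
    then have "AE z in \<gamma>. \<forall>n. z \<notin> A n" unfolding AE_all_countable by (auto intro: AE_not_in)
    then have "AE z in \<gamma>. \<not> (m (fst z) \<le> ennreal a \<and> ennreal b < \<Phi> z)"
    proof eventually_elim
      case (elim z)
      show ?case
      proof
        assume h: "m (fst z) \<le> ennreal a \<and> ennreal b < \<Phi> z"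
        have "\<Phi> (fst z, T (fst z)) \<le> ennreal a" by (rule Ta) (use h in auto)
        then have le: "Phi c L H (fst z) (T (fst z)) \<nu> \<le> ennreal a" by (simp add: \<Phi>_def)
        then have "Phi c L H (fst z) (T (fst z)) \<nu> < \<infinity>" using ennreal_less_top[of a] by (auto intro: le_less_trans)
        then have "(\<lambda>n. u n (fst z)) \<longlonglongrightarrow> Phi c L H (fst z) (T (fst z)) \<nu>"
          using \<kappa>lim[OF \<nu>] unfolding u_def k_def \<Phi>_def by simp
        moreover have "Phi c L H (fst z) (T (fst z)) \<nu> < ennreal a'"
          using le a' ab by (auto simp: ennreal_less_iff intro: le_less_trans)
        ultimately have "\<forall>\<^sub>F n in sequentially. u n (fst z) < ennreal a'" by (rule order_tendstoD)
        then obtain n where "u n (fst z) < ennreal a'" by (auto simp: eventually_sequentially)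
        then have "z \<in> A n" using h by (simp add: A_def)
        then show False using elim by blast
      qed
    qed
    then show False using ab(3) by blast
  qed
  then obtain n where n: "emeasure \<gamma> (A n) \<noteq> 0" by blast
  define S where "S = A n"
  have Sm: "S \<in> sets borel" "S \<in> sets \<gamma>" using Am borel_probsD(2)[OF \<gamma>b] by (auto simp: S_def)
  obtain \<gamma>1 where \<gamma>1: "\<gamma>1 \<in> plans \<mu>"
    and int1: "\<And>f. f \<in> borel_measurable borel \<Longrightarrow>
      (\<integral>\<^sup>+w. f w \<partial>\<gamma>1) = (\<integral>\<^sup>+w. (if w \<in> S then \<integral>\<^sup>+z. f (fst w, z) \<partial>k n (fst w) else f w) \<partial>\<gamma>)"
    using plan_replacement[OF \<gamma> Sm(1) km kb] by blast
  have b1: "\<gamma>1 \<in> borel_probs" using \<gamma>1 by (simp add: plans_def)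
  define \<nu>1 where "\<nu>1 = snd_marginal \<gamma>1"
  have \<nu>1: "\<nu>1 \<in> borel_probs" unfolding \<nu>1_def by (rule snd_marginal_borel_probs[OF b1])
  \<comment> \<open>The field of the unmoved mass, and the values of the field before and after the move.\<close>
  define I0 where "I0 = (\<integral>\<^sup>+w. \<Phi> w * indicator (- S) w \<partial>\<gamma>)"
  have split: "(\<integral>\<^sup>+w. \<Phi> w * indicator (- S) w + r * indicator S w \<partial>\<gamma>) = I0 + r * emeasure \<gamma> S" for r
  proof -
    have 1: "(\<lambda>w. \<Phi> w * indicator (- S) w) \<in> borel_measurable \<gamma>" "(\<lambda>w. r * indicator S w) \<in> borel_measurable \<gamma>"
      by (intro m\<gamma> borel_measurable_times_ennreal \<Phi>m borel_measurable_const borel_measurable_indicator borel_comp Sm(1))+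
    show ?thesis unfolding I0_def nn_integral_add[OF 1] by (simp add: nn_integral_cmult_indicator[OF Sm(2)])
  qed
  have up: "(\<integral>\<^sup>+w. \<Phi> w \<partial>\<gamma>1) \<le> I0 + ennreal a' * emeasure \<gamma> S"
    unfolding int1[OF \<Phi>m] split[symmetric]
    by (rule nn_integral_mono) (auto simp: S_def A_def u_def)
  have lo: "I0 + ennreal b * emeasure \<gamma> S \<le> (\<integral>\<^sup>+w. \<Phi> w \<partial>\<gamma>)"
    unfolding split[symmetric] by (rule nn_integral_mono) (auto simp: S_def A_def indicator_def)
  have tc: "type_cost \<gamma> < top" "Hcal H \<nu> \<nu> < top"
    using fin unfolding Jcal_eq_type_cost[OF \<gamma>b] \<nu>_def by auto
  have \<Phi>fin: "(\<integral>\<^sup>+w. \<Phi> w \<partial>\<gamma>) < top"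
    unfolding \<Phi>_def nn_integral_Phi[OF \<gamma>b \<nu>] \<nu>_def[symmetric] using tc by (simp add: ennreal_mult_less_top)
  have I0fin: "I0 < top"
    using le_less_trans[OF order_trans[OF _ lo] \<Phi>fin, of I0] by simp
  have \<Phi>1fin: "(\<integral>\<^sup>+w. \<Phi> w \<partial>\<gamma>1) < top"
    by (rule le_less_trans[OF up]) (use I0fin in \<open>simp add: ennreal_mult_less_top emeasure_eq_measure\<close>)
  have H1: "Hcal H \<nu>1 \<nu> < top" "Hcal H \<nu> \<nu>1 < top"
  proof -
    have "type_cost \<gamma>1 + 2 * Hcal H \<nu>1 \<nu> < top"
      using \<Phi>1fin unfolding \<Phi>_def nn_integral_Phi[OF b1 \<nu>] \<nu>1_def .
    then show "Hcal H \<nu>1 \<nu> < top" by (auto simp: ennreal_mult_less_top)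
    then show "Hcal H \<nu> \<nu>1 < top" using Hcal_commute[OF measurable_costs(3) sym_H \<nu> \<nu>1] by simp
  qed
  \<comment> \<open>\<open>Rt y\<close> is the interaction of the strategy \<open>y\<close> with the moved mass.\<close>
  define g where "g p = indicator S (snd p) * (\<integral>\<^sup>+z'. H (fst p, z') \<partial>k n (fst (snd p)))" for p :: "'b \<times> ('a \<times> 'b)"
  have gm: "g \<in> borel_measurable borel"
  proof -
    have 1: "(\<lambda>p::'b \<times> ('a \<times> 'b). fst (snd p)) \<in> measurable borel borel" "(\<lambda>p::'b \<times> ('a \<times> 'b). snd p) \<in> measurable borel borel"
      "(\<lambda>q::('b \<times> ('a \<times> 'b)) \<times> 'b. (fst (fst q), snd q)) \<in> measurable borel borel"
      by (intro borel_measurable_continuous_onI continuous_intros)+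
    have f: "(\<lambda>q::('b \<times> ('a \<times> 'b)) \<times> 'b. H (fst (fst q), snd q)) \<in> borel_measurable borel"
      by (rule measurable_compose[OF 1(3) measurable_costs(3)])
    have k: "(\<lambda>p::'b \<times> ('a \<times> 'b). k n (fst (snd p))) \<in> measurable borel (subprob_algebra borel)"
      by (rule measurable_compose[OF 1(1) km])
    note kernel_integral_measurable[OF f k]
    then show ?thesis unfolding g_def
      by (intro borel_measurable_times_ennreal measurable_compose[OF 1(2) borel_measurable_indicator[OF Sm(1)]]) simp
  qed
  define Rt where "Rt y = (\<integral>\<^sup>+w. g (y, w) \<partial>\<gamma>)" for y
  have Rtm: "Rt \<in> borel_measurable borel"
    unfolding Rt_def by (rule borel_measurable_section_integral[OF gm \<gamma>b])
  have gmy: "(\<lambda>w. g (y, w)) \<in> borel_measurable borel" for y by (rule section_measurable[OF gm])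
  have Hs: "(\<lambda>w::'a \<times> 'b. H (y, snd w)) \<in> borel_measurable borel" for y
    by (rule measurable_compose[OF measurable_fst_snd_borel(2) section_measurable[OF measurable_costs(3)]])
  have h1: "(\<integral>\<^sup>+y'. H (y, y') \<partial>\<nu>1) = (\<integral>\<^sup>+w. (if w \<in> S then \<integral>\<^sup>+z. H (y, z) \<partial>k n (fst w) else H (y, snd w)) \<partial>\<gamma>)" for y
    unfolding \<nu>1_def nn_integral_snd_marginal[OF b1 section_measurable[OF measurable_costs(3)]] int1[OF Hs] snd_conv ..
  have h1_le: "(\<integral>\<^sup>+y'. H (y, y') \<partial>\<nu>1) \<le> (\<integral>\<^sup>+y'. H (y, y') \<partial>\<nu>) + Rt y" for y
  proof -
    have "(\<integral>\<^sup>+y'. H (y, y') \<partial>\<nu>1) \<le> (\<integral>\<^sup>+w. H (y, snd w) + g (y, w) \<partial>\<gamma>)"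
      unfolding h1 by (rule nn_integral_mono) (auto simp: g_def)
    also have "\<dots> = (\<integral>\<^sup>+y'. H (y, y') \<partial>\<nu>) + Rt y"
      unfolding \<nu>_def Rt_def nn_integral_snd_marginal[OF \<gamma>b section_measurable[OF measurable_costs(3)]]
      by (rule nn_integral_add[OF m\<gamma>[OF Hs] m\<gamma>[OF gmy]])
    finally show ?thesis .
  qed
  have Rt_le: "Rt y \<le> (\<integral>\<^sup>+y'. H (y, y') \<partial>\<nu>1)" for y
    unfolding h1 Rt_def by (rule nn_integral_mono) (auto simp: g_def)
  have self: "(\<integral>\<^sup>+w. indicator S w * (\<integral>\<^sup>+z. Rt z \<partial>k n (fst w)) \<partial>\<gamma>) \<le> C n * (1 + ennreal a + ennreal a)"
  proof -
    have LT: "L (T (fst w)) \<le> ennreal a" if "w \<in> S" for w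
      using that Ta[of "fst w"] La by (auto simp: S_def A_def)
    have "indicator S w * (\<integral>\<^sup>+z. Rt z \<partial>k n (fst w)) \<le> C n * (1 + ennreal a + ennreal a)" for w
    proof (cases "w \<in> S")
      case True
      have "(\<integral>\<^sup>+z. Rt z \<partial>k n (fst w)) = (\<integral>\<^sup>+w'. \<integral>\<^sup>+z. g (z, w') \<partial>k n (fst w) \<partial>\<gamma>)"
        unfolding Rt_def by (rule nn_integral_swap_borel[OF gm kb \<gamma>b])
      also have "\<dots> \<le> (\<integral>\<^sup>+w'. C n * (1 + ennreal a + ennreal a) \<partial>\<gamma>)"
      proof (rule nn_integral_mono)
        fix w'
        show "(\<integral>\<^sup>+z. g (z, w') \<partial>k n (fst w)) \<le> C n * (1 + ennreal a + ennreal a)"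
        proof (cases "w' \<in> S")
          case True': True
          have "(\<integral>\<^sup>+z. g (z, w') \<partial>k n (fst w)) = Hcal H (k n (fst w)) (k n (fst w'))"
            unfolding Hcal_iterated[OF measurable_costs(3) kb kb] using True' by (simp add: g_def)
          also have "\<dots> \<le> C n * (1 + L (T (fst w)) + L (T (fst w')))" unfolding k_def by (rule \<kappa>H)
          also have "\<dots> \<le> C n * (1 + ennreal a + ennreal a)"
            using LT[OF True] LT[OF True'] by (intro mult_left_mono add_mono) auto
          finally show ?thesis .
        qed (simp add: g_def)
      qed
      also have "\<dots> = C n * (1 + ennreal a + ennreal a)" using borel_probsD(3,4)[OF \<gamma>b] by simp
      finally show ?thesis using True by simp
    qed simp
    then have "(\<integral>\<^sup>+w. indicator S w * (\<integral>\<^sup>+z. Rt z \<partial>k n (fst w)) \<partial>\<gamma>) \<le> (\<integral>\<^sup>+w. C n * (1 + ennreal a + ennreal a) \<partial>\<gamma>)"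
      by (intro nn_integral_mono)
    then show ?thesis using borel_probsD(3,4)[OF \<gamma>b] by simp
  qed
  have Rts: "(\<lambda>w::'a \<times> 'b. Rt (snd w)) \<in> borel_measurable borel"
    by (rule measurable_compose[OF measurable_fst_snd_borel(2) Rtm])
  have kRt: "(\<lambda>w::'a \<times> 'b. indicator S w * (\<integral>\<^sup>+z. Rt z \<partial>k n (fst w))) \<in> borel_measurable borel"
  proof -
    have "(\<lambda>x. \<integral>\<^sup>+z. Rt (snd (x, z)) \<partial>k n x) \<in> borel_measurable borel"
      by (rule kernel_integral_measurable[OF measurable_compose[OF measurable_fst_snd_borel(2) Rtm] km])
    then show ?thesis
      by (intro borel_measurable_times_ennreal borel_measurable_indicator Sm measurable_compose[OF measurable_fst_snd_borel(1)]) simp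
  qed
  have H\<nu>\<nu>1: "Hcal H \<nu> \<nu>1 = (\<integral>\<^sup>+w. \<integral>\<^sup>+y'. H (snd w, y') \<partial>\<nu>1 \<partial>\<gamma>)"
    unfolding Hcal_iterated[OF measurable_costs(3) \<nu> \<nu>1] unfolding \<nu>_def
    by (rule nn_integral_snd_marginal[OF \<gamma>b section_H_measurable(1)[OF \<nu>1]])
  have e1: "Hcal H \<nu>1 \<nu>1 \<le> Hcal H \<nu>1 \<nu> + (\<integral>\<^sup>+y. Rt y \<partial>\<nu>1)"
  proof -
    have "Hcal H \<nu>1 \<nu>1 \<le> (\<integral>\<^sup>+y. (\<integral>\<^sup>+y'. H (y, y') \<partial>\<nu>) + Rt y \<partial>\<nu>1)"
      unfolding Hcal_iterated[OF measurable_costs(3) \<nu>1 \<nu>1] by (rule nn_integral_mono) (rule h1_le)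
    also have "\<dots> = Hcal H \<nu>1 \<nu> + (\<integral>\<^sup>+y. Rt y \<partial>\<nu>1)"
      unfolding Hcal_iterated[OF measurable_costs(3) \<nu>1 \<nu>]
      by (rule nn_integral_add) (intro borel_probs_measurable[OF \<nu>1] section_H_measurable(1)[OF \<nu>] Rtm)+
    finally show ?thesis .
  qed
  have e2: "(\<integral>\<^sup>+y. Rt y \<partial>\<nu>1) \<le> Hcal H \<nu> \<nu>1 + C n * (1 + ennreal a + ennreal a)"
  proof -
    have "(\<integral>\<^sup>+y. Rt y \<partial>\<nu>1) = (\<integral>\<^sup>+w. (if w \<in> S then \<integral>\<^sup>+z. Rt z \<partial>k n (fst w) else Rt (snd w)) \<partial>\<gamma>)"
      unfolding \<nu>1_def nn_integral_snd_marginal[OF b1 Rtm] int1[OF Rts] snd_conv ..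
    also have "\<dots> \<le> (\<integral>\<^sup>+w. Rt (snd w) + indicator S w * (\<integral>\<^sup>+z. Rt z \<partial>k n (fst w)) \<partial>\<gamma>)"
      by (rule nn_integral_mono) auto
    also have "\<dots> = (\<integral>\<^sup>+w. Rt (snd w) \<partial>\<gamma>) + (\<integral>\<^sup>+w. indicator S w * (\<integral>\<^sup>+z. Rt z \<partial>k n (fst w)) \<partial>\<gamma>)"
      by (rule nn_integral_add[OF m\<gamma>[OF Rts] m\<gamma>[OF kRt]])
    also have "\<dots> \<le> Hcal H \<nu> \<nu>1 + C n * (1 + ennreal a + ennreal a)"
    proof (rule add_mono[OF _ self])
      show "(\<integral>\<^sup>+w. Rt (snd w) \<partial>\<gamma>) \<le> Hcal H \<nu> \<nu>1"
        unfolding H\<nu>\<nu>1 by (rule nn_integral_mono) (rule Rt_le)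
    qed
    finally show ?thesis .
  qed
  have "C n * (1 + ennreal a + ennreal a) < top"
    using C[of n] by (simp add: ennreal_mult_less_top)
  then have "Hcal H \<nu>1 \<nu> + (Hcal H \<nu> \<nu>1 + C n * (1 + ennreal a + ennreal a)) < top"
    using H1 by simp
  then have "Hcal H \<nu>1 \<nu>1 < top"
    using order_trans[OF e1 add_left_mono[OF e2]] by (rule le_less_trans[rotated])
  then have "(\<integral>\<^sup>+w. \<Phi> w \<partial>\<gamma>) \<le> (\<integral>\<^sup>+w. \<Phi> w \<partial>\<gamma>1)"
    unfolding \<Phi>_def \<nu>_def using minimiser_first_order[OF \<gamma> fin min \<gamma>1] by (simp add: \<nu>1_def)
  then have "I0 + ennreal b * emeasure \<gamma> S \<le> I0 + ennreal a' * emeasure \<gamma> S"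
    using lo up by (meson order_trans)
  then have "ennreal b * emeasure \<gamma> S \<le> ennreal a' * emeasure \<gamma> S"
    using I0fin by (auto simp: ennreal_add_left_cancel_le)
  then have "ennreal (b * prob S) \<le> ennreal (a' * prob S)"
    using a' by (simp add: emeasure_eq_measure ennreal_mult)
  moreover have "0 < prob S" using n by (simp add: S_def emeasure_eq_measure zero_less_measure_iff)
  ultimately show False using a' by (simp add: ennreal_le_iff)
qed

end

section \<open>Convergence of minimising equilibria\<close>

lemma AE_le_if_nn_integral_le:
  assumes "f \<in> borel_measurable M" "g \<in> borel_measurable M"
    and "AE z in M. f z \<le> g z" "(\<integral>\<^sup>+z. g z \<partial>M) \<le> (\<integral>\<^sup>+z. f z \<partial>M)" "(\<integral>\<^sup>+z. f z \<partial>M) < \<infinity>"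
  shows "AE z in M. g z \<le> f z"
proof -
  have "(\<integral>\<^sup>+z. g z - f z \<partial>M) = (\<integral>\<^sup>+z. g z \<partial>M) - (\<integral>\<^sup>+z. f z \<partial>M)"
    using assms by (intro nn_integral_diff) auto
  also have "\<dots> = 0" by (rule diff_eq_0_ennreal) (use assms in \<open>auto intro: le_less_trans\<close>)
  finally have "AE z in M. g z - f z = 0"
    using assms(1,2) by (subst (asm) nn_integral_0_iff_AE) auto
  then show ?thesis by eventually_elim (simp add: diff_eq_0_iff_ennreal)
qed

lemma indep_vars_inj_reindex:
  assumes M: "prob_space M" and ind: "prob_space.indep_vars M M' X I" and f: "inj_on f J" "f ` J \<subseteq> I"
  shows "prob_space.indep_vars M (\<lambda>j. M' (f j)) (\<lambda>j. X (f j)) J"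
proof -
  interpret prob_space M by fact
  have "indep_vars (\<lambda>j. PiM {f j} M') (\<lambda>j \<omega>. restrict (\<lambda>i. X i \<omega>) {f j}) J"
    by (rule indep_vars_restrict[OF ind]) (use f in \<open>auto simp: disjoint_family_on_def inj_on_def\<close>)
  then have "indep_vars (\<lambda>j. M' (f j)) (\<lambda>j \<omega>. (\<lambda>g. g (f j)) (restrict (\<lambda>i. X i \<omega>) {f j})) J"
    by (rule indep_vars_compose2) (rule measurable_component_singleton, simp)
  then show ?thesis by simp
qed

lemma iid_pair_law:
  fixes M :: "'a measure"
  assumes M: "prob_space M" and kl: "k \<noteq> (l::nat)"
  defines "W \<equiv> PiM (UNIV::nat set) (\<lambda>_. M)"
  shows "distr W (M \<Otimes>\<^sub>M M) (\<lambda>w. (w k, w l)) = M \<Otimes>\<^sub>M M"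
proof -
  note iid = PiM_iid_coordinates[OF M, folded W_def]
  interpret W: prob_space W by (rule iid(1))
  have "W.indep_var (PiM {k} (\<lambda>_. M)) (\<lambda>w. restrict (\<lambda>i. w i) {k}) (PiM {l} (\<lambda>_. M)) (\<lambda>w. restrict (\<lambda>i. w i) {l})"
    by (rule W.indep_var_restrict[OF iid(2)]) (use kl in auto)
  then have "W.indep_var M ((\<lambda>g. g k) \<circ> (\<lambda>w. restrict (\<lambda>i. w i) {k})) M ((\<lambda>g. g l) \<circ> (\<lambda>w. restrict (\<lambda>i. w i) {l}))"
    by (rule W.indep_var_compose) (rule measurable_component_singleton, simp)+
  then have "W.indep_var M (\<lambda>w. w k) M (\<lambda>w. w l)" by (simp add: comp_def)
  then show ?thesis unfolding W.indep_var_distribution_eq by (simp add: iid(3))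
qed

lemma nash_equilibrium_cong:
  assumes "\<And>i. i \<in> {1..N} \<Longrightarrow> x i = x' i"
  shows "nash_equilibrium c L H x N \<nu> \<longleftrightarrow> nash_equilibrium c L H x' N \<nu>"
  unfolding nash_equilibrium_def player_cost_def using assms by auto

lemma profile_plan_cong:
  assumes "\<And>i. i \<in> {1..N} \<Longrightarrow> x i = x' i"
  shows "profile_plan N x \<nu> = profile_plan N x' \<nu>"
  unfolding profile_plan_def average_def using assms by (auto intro!: arg_cong2[where f="measure_of UNIV"] ext sum.cong arg_cong2[where f="(/)"])

context game_costs
begin

lemma Inf_le_liminf_potential:
  assumes typical: "typical_sequence \<mu> x"
  shows "(INF \<gamma>\<in>plans \<mu>. Jcal c L H \<gamma>) \<le> liminf (\<lambda>N. potential (Suc N) x (y N))"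
proof (rule ccontr)
  assume "\<not> ?thesis"
  then have lt: "liminf (\<lambda>N. potential (Suc N) x (y N)) < (INF \<gamma>\<in>plans \<mu>. Jcal c L H \<gamma>)" by simp
  obtain r where r: "strict_mono r" "((\<lambda>N. potential (Suc N) x (y N)) \<circ> r) \<longlonglongrightarrow> liminf (\<lambda>N. potential (Suc N) x (y N))"
    using liminf_subseq_lim by blast
  have "strict_mono (\<lambda>n. Suc (r n))" using r(1) by (auto simp: strict_mono_def)
  moreover have "(\<lambda>n. potential (Suc (r n)) x (y (r n))) \<longlonglongrightarrow> liminf (\<lambda>N. potential (Suc N) x (y N))"
    using r(2) by (simp add: comp_def)
  moreover have "liminf (\<lambda>N. potential (Suc N) x (y N)) < top" using lt by (rule less_le_trans) simp
  ultimately obtain \<gamma> where "\<gamma> \<in> plans \<mu>" "Jcal c L H \<gamma> \<le> liminf (\<lambda>N. potential (Suc N) x (y N))"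
    using potential_cluster[OF typical, of "\<lambda>n. Suc (r n)" "\<lambda>n. y (r n)"] by auto
  then have "(INF \<gamma>\<in>plans \<mu>. Jcal c L H \<gamma>) \<le> liminf (\<lambda>N. potential (Suc N) x (y N))"
    by (meson INF_lower order_trans)
  with lt show False by simp
qed

text \<open>Minimisers of the potential are equilibria, and if their potentials come close to the minimal
  total cost along a subsequence, they cluster at a minimiser of the total cost.\<close>

lemma equilibria_converge_to_minimiser:
  assumes typical: "typical_sequence \<mu> x" and fin: "\<And>N. 1 \<le> N \<Longrightarrow> potential N x y < top"
    and lim: "liminf (\<lambda>N. potential (Suc N) x y) \<le> (INF \<gamma>\<in>plans \<mu>. Jcal c L H \<gamma>)"
    and I: "(INF \<gamma>\<in>plans \<mu>. Jcal c L H \<gamma>) < \<infinity>"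
  shows "\<exists>\<nu>. (\<forall>N\<ge>1. nash_equilibrium c L H x N (\<nu> N)) \<and> (\<exists>r \<gamma>. strict_mono r \<and>
      narrow_conv (\<lambda>k. profile_plan (r k) x (\<nu> (r k))) \<gamma> \<and> \<gamma> \<in> plans \<mu> \<and>
      Jcal c L H \<gamma> = (INF \<gamma>\<in>plans \<mu>. Jcal c L H \<gamma>))"
proof -
  have "\<forall>N. \<exists>y. 1 \<le> N \<longrightarrow> (\<forall>z. potential N x y \<le> potential N x z)"
    using potential_minimiser_exists by metis
  then obtain Y where Y: "\<And>N z. 1 \<le> N \<Longrightarrow> potential N x (Y N) \<le> potential N x z" by metis
  define \<nu> where "\<nu> N i = return borel (Y N i)" for N i
  have nash: "nash_equilibrium c L H x N (\<nu> N)" if N: "1 \<le> N" for N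
    unfolding \<nu>_def
    by (rule potential_minimiser_nash[OF le_less_trans[OF Y[OF N] fin[OF N]] Y[OF N]])
  have le: "liminf (\<lambda>N. potential (Suc N) x (Y (Suc N))) \<le> (INF \<gamma>\<in>plans \<mu>. Jcal c L H \<gamma>)"
    by (rule order_trans[OF Liminf_mono lim]) (auto intro!: always_eventually Y)
  obtain r where r: "strict_mono r" "((\<lambda>N. potential (Suc N) x (Y (Suc N))) \<circ> r) \<longlonglongrightarrow> liminf (\<lambda>N. potential (Suc N) x (Y (Suc N)))"
    using liminf_subseq_lim by blast
  define s where "s n = Suc (r n)" for n
  have s: "strict_mono s" using r(1) by (auto simp: strict_mono_def s_def)
  have slim: "(\<lambda>n. potential (s n) x (Y (s n))) \<longlonglongrightarrow> liminf (\<lambda>N. potential (Suc N) x (Y (Suc N)))"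
    using r(2) by (simp add: comp_def s_def)
  have ltop: "liminf (\<lambda>N. potential (Suc N) x (Y (Suc N))) < top"
    using le_less_trans[OF le I] by simp
  have s1: "1 \<le> s n" for n by (simp add: s_def)
  obtain q \<gamma> where q: "strict_mono q" "\<gamma> \<in> plans \<mu>" "narrow_conv (\<lambda>n. pure_plan (s (q n)) x (Y (s (q n)))) \<gamma>"
      "Jcal c L H \<gamma> \<le> liminf (\<lambda>N. potential (Suc N) x (Y (Suc N)))"
    by (rule potential_cluster[OF typical s s1 slim ltop])
  have "Jcal c L H \<gamma> = (INF \<gamma>\<in>plans \<mu>. Jcal c L H \<gamma>)"
    by (intro antisym order_trans[OF q(4) le] INF_lower q(2))
  moreover have "strict_mono (s \<circ> q)" using s q(1) by (rule strict_mono_o)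
  moreover have "narrow_conv (\<lambda>k. profile_plan ((s \<circ> q) k) x (\<nu> ((s \<circ> q) k))) \<gamma>"
    using q(3) by (simp add: \<nu>_def[abs_def])
  ultimately show ?thesis using nash q(2) by blast
qed

text \<open>With independent types and strategies the diagonal is missing from the interaction, so the
  expected potential is at most the total cost.\<close>

lemma expected_potential:
  assumes \<gamma>: "\<gamma> \<in> borel_probs" and N: "1 \<le> N"
  defines "W \<equiv> PiM (UNIV::nat set) (\<lambda>_. \<gamma>)"
  shows "(\<lambda>w. potential N (\<lambda>i. fst (w (i - 1))) (\<lambda>i. snd (w (i - 1)))) \<in> borel_measurable W"
    and "(\<integral>\<^sup>+w. potential N (\<lambda>i. fst (w (i - 1))) (\<lambda>i. snd (w (i - 1))) \<partial>W) \<le> Jcal c L H \<gamma>"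
proof -
  note iid = PiM_iid_coordinates[OF borel_probsD(1)[OF \<gamma>], folded W_def]
  interpret W: prob_space W by (rule iid(1))
  note \<nu> = snd_marginal_borel_probs[OF \<gamma>]
  have wm: "(\<lambda>w. w i) \<in> measurable W \<gamma>" for i unfolding W_def by (rule measurable_component_singleton) simp
  have tcm: "(\<lambda>z. c z + L (snd z)) \<in> borel_measurable \<gamma>" by (rule borel_probs_measurable[OF \<gamma> type_cost_measurable])
  have tm: "(\<lambda>w. c (fst (w i), snd (w i)) + L (snd (w i))) \<in> borel_measurable W" for i
    using measurable_compose[OF wm tcm] by simp
  have s: "sets (\<gamma> \<Otimes>\<^sub>M \<gamma>) = sets (borel \<Otimes>\<^sub>M borel)"
    using borel_probsD(2)[OF \<gamma>] borel_probsD(2)[OF \<gamma>] by (rule sets_pair_measure_cong)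
  have Hpb: "(\<lambda>p::('a \<times> 'b) \<times> ('a \<times> 'b). H (snd (fst p), snd (snd p))) \<in> borel_measurable borel"
    by (rule measurable_compose[OF _ measurable_costs(3)]) (intro borel_measurable_continuous_onI continuous_intros)
  have Hp: "(\<lambda>p. H (snd (fst p), snd (snd p))) \<in> borel_measurable (\<gamma> \<Otimes>\<^sub>M \<gamma>)"
    unfolding measurable_cong_sets[OF s refl] borel_prod by (rule Hpb)
  have pm: "(\<lambda>w. (w i, w j)) \<in> measurable W (\<gamma> \<Otimes>\<^sub>M \<gamma>)" for i j by (intro measurable_Pair wm)
  have hm: "(\<lambda>w. H (snd (w i), snd (w j))) \<in> borel_measurable W" for i j
    using measurable_compose[OF pm Hp] by simp
  show meas: "(\<lambda>w. potential N (\<lambda>i. fst (w (i - 1))) (\<lambda>i. snd (w (i - 1)))) \<in> borel_measurable W"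
    unfolding potential_def
    by (intro borel_measurable_add borel_measurable_times_ennreal borel_measurable_const borel_measurable_sum
        measurable_compose[OF pm Hp, simplified] hm tm)
  have t: "(\<integral>\<^sup>+w. c (fst (w i), snd (w i)) + L (snd (w i)) \<partial>W) = type_cost \<gamma>" for i
  proof -
    have "type_cost \<gamma> = (\<integral>\<^sup>+z. c z + L (snd z) \<partial>distr W \<gamma> (\<lambda>w. w i))" by (simp only: iid(3))
    also have "\<dots> = (\<integral>\<^sup>+w. c (w i) + L (snd (w i)) \<partial>W)" by (rule nn_integral_distr[OF wm]) (use tcm in simp)
    finally show ?thesis by simp
  qed
  have h: "(\<integral>\<^sup>+w. H (snd (w i), snd (w j)) \<partial>W) = Hcal H (snd_marginal \<gamma>) (snd_marginal \<gamma>)" if "i \<noteq> j" for i j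
  proof -
    interpret G: sigma_finite_measure \<gamma> by (rule borel_probsD[OF \<gamma>])
    have "(\<integral>\<^sup>+w. H (snd (w i), snd (w j)) \<partial>W) = (\<integral>\<^sup>+p. H (snd (fst p), snd (snd p)) \<partial>distr W (\<gamma> \<Otimes>\<^sub>M \<gamma>) (\<lambda>w. (w i, w j)))"
      by (subst nn_integral_distr[OF pm]) (use Hp in simp_all)
    also have "distr W (\<gamma> \<Otimes>\<^sub>M \<gamma>) (\<lambda>w. (w i, w j)) = \<gamma> \<Otimes>\<^sub>M \<gamma>"
      unfolding W_def by (rule iid_pair_law[OF borel_probsD(1)[OF \<gamma>] that])
    also have "(\<integral>\<^sup>+p. H (snd (fst p), snd (snd p)) \<partial>(\<gamma> \<Otimes>\<^sub>M \<gamma>)) = (\<integral>\<^sup>+z. \<integral>\<^sup>+z'. H (snd z, snd z') \<partial>\<gamma> \<partial>\<gamma>)"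
      using G.nn_integral_fst[OF Hp] by simp
    also have "\<dots> = Hcal H (snd_marginal \<gamma>) (snd_marginal \<gamma>)"
      unfolding Hcal_iterated[OF measurable_costs(3) \<nu> \<nu>] nn_integral_snd_marginal[OF \<gamma> section_H_measurable(1)[OF \<nu>]]
      unfolding nn_integral_snd_marginal[OF \<gamma> section_measurable[OF measurable_costs(3)]] ..
    finally show ?thesis .
  qed
  have "(\<integral>\<^sup>+w. potential N (\<lambda>i. fst (w (i - 1))) (\<lambda>i. snd (w (i - 1))) \<partial>W)
      = ennreal (1 / real N) * (\<integral>\<^sup>+w. (\<Sum>i\<in>{1..N}. c (fst (w (i - 1)), snd (w (i - 1))) + L (snd (w (i - 1)))) \<partial>W)
      + ennreal (1 / (real N)\<^sup>2) * (\<integral>\<^sup>+w. (\<Sum>i\<in>{1..N}. \<Sum>j\<in>{1..N} - {i}. H (snd (w (i - 1)), snd (w (j - 1)))) \<partial>W)"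
    unfolding potential_def
    by (subst nn_integral_add, intro borel_measurable_times_ennreal borel_measurable_const borel_measurable_sum tm,
        intro borel_measurable_times_ennreal borel_measurable_const borel_measurable_sum hm,
        subst nn_integral_cmult, intro borel_measurable_sum tm,
        subst nn_integral_cmult, intro borel_measurable_sum hm, rule refl)
  also have "(\<integral>\<^sup>+w. (\<Sum>i\<in>{1..N}. c (fst (w (i - 1)), snd (w (i - 1))) + L (snd (w (i - 1)))) \<partial>W)
      = (\<Sum>i\<in>{1..N}. type_cost \<gamma>)"
    by (subst nn_integral_sum[OF tm]) (simp only: t)
  also have "(\<integral>\<^sup>+w. (\<Sum>i\<in>{1..N}. \<Sum>j\<in>{1..N} - {i}. H (snd (w (i - 1)), snd (w (j - 1)))) \<partial>W)
      = (\<Sum>i\<in>{1..N}. \<Sum>j\<in>{1..N} - {i}. Hcal H (snd_marginal \<gamma>) (snd_marginal \<gamma>))"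
  proof (subst nn_integral_sum)
    show "(\<Sum>i\<in>{1..N}. \<integral>\<^sup>+w. (\<Sum>j\<in>{1..N} - {i}. H (snd (w (i - 1)), snd (w (j - 1)))) \<partial>W)
        = (\<Sum>i\<in>{1..N}. \<Sum>j\<in>{1..N} - {i}. Hcal H (snd_marginal \<gamma>) (snd_marginal \<gamma>))"
    proof (rule sum.cong[OF refl])
      fix i assume "i \<in> {1..N}"
      then show "(\<integral>\<^sup>+w. (\<Sum>j\<in>{1..N} - {i}. H (snd (w (i - 1)), snd (w (j - 1)))) \<partial>W)
          = (\<Sum>j\<in>{1..N} - {i}. Hcal H (snd_marginal \<gamma>) (snd_marginal \<gamma>))"
        by (subst nn_integral_sum[OF hm]) (intro sum.cong[OF refl] h, auto)
    qed
  qed (intro borel_measurable_sum hm)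
  also have "ennreal (1 / real N) * (\<Sum>i\<in>{1..N}. type_cost \<gamma>) = type_cost \<gamma>"
    using N by (simp add: mult.assoc[symmetric] ennreal_of_nat_eq_real_of_nat ennreal_mult[symmetric])
  also have "ennreal (1 / (real N)\<^sup>2) * (\<Sum>i\<in>{1..N}. \<Sum>j\<in>{1..N} - {i}. Hcal H (snd_marginal \<gamma>) (snd_marginal \<gamma>))
      \<le> ennreal (1 / (real N)\<^sup>2) * (\<Sum>i\<in>{1..N}. \<Sum>j\<in>{1..N}. Hcal H (snd_marginal \<gamma>) (snd_marginal \<gamma>))"
    by (intro mult_left_mono sum_mono sum_mono2) auto
  also have "\<dots> = Hcal H (snd_marginal \<gamma>) (snd_marginal \<gamma>)"
    using N by (simp add: mult.assoc[symmetric] ennreal_of_nat_eq_real_of_nat ennreal_mult[symmetric] power2_eq_square)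
  finally show "(\<integral>\<^sup>+w. potential N (\<lambda>i. fst (w (i - 1))) (\<lambda>i. snd (w (i - 1))) \<partial>W) \<le> Jcal c L H \<gamma>"
    unfolding Jcal_eq_type_cost[OF \<gamma>] by (simp add: add_left_mono)
qed

text \<open>The potential of independent pairs with an optimal law \<open>\<gamma>\<close> has an expected lower limit of at most
  the minimal energy, by Fatou's lemma, whereas almost surely it is at least this large. So it is
  almost surely equal to it.\<close>

lemma AE_equilibria_converge:
  fixes X :: "nat \<Rightarrow> 'w \<Rightarrow> 'a"
  assumes \<mu>: "\<mu> \<in> borel_probs" and P: "prob_space P" and ind: "prob_space.indep_vars P (\<lambda>_. borel) X {1..}"
    and law: "\<And>i. 1 \<le> i \<Longrightarrow> distr P borel (X i) = \<mu>"
    and I: "(INF \<gamma>\<in>plans \<mu>. Jcal c L H \<gamma>) < \<infinity>"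
  shows "AE \<omega> in P. \<exists>\<nu>. (\<forall>N\<ge>1. nash_equilibrium c L H (\<lambda>i. X i \<omega>) N (\<nu> N)) \<and> (\<exists>r \<gamma>. strict_mono r \<and>
      narrow_conv (\<lambda>k. profile_plan (r k) (\<lambda>i. X i \<omega>) (\<nu> (r k))) \<gamma> \<and> \<gamma> \<in> plans \<mu> \<and>
      Jcal c L H \<gamma> = (INF \<gamma>\<in>plans \<mu>. Jcal c L H \<gamma>))"
proof -
  let ?I = "INF \<gamma>\<in>plans \<mu>. Jcal c L H \<gamma>"
  let ?Q = "\<lambda>x. \<exists>\<nu>. (\<forall>N\<ge>1. nash_equilibrium c L H x N (\<nu> N)) \<and> (\<exists>r \<gamma>. strict_mono r \<and>
      narrow_conv (\<lambda>k. profile_plan (r k) x (\<nu> (r k))) \<gamma> \<and> \<gamma> \<in> plans \<mu> \<and> Jcal c L H \<gamma> = ?I)"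
  obtain \<gamma> where \<gamma>: "\<gamma> \<in> plans \<mu>" "Jcal c L H \<gamma> = ?I" by (rule Jcal_minimiser_exists[OF \<mu> I])
  have \<gamma>b: "\<gamma> \<in> borel_probs" and \<gamma>\<mu>: "distr \<gamma> borel fst = \<mu>" using \<gamma>(1) by (auto simp: plans_def)
  define W where "W = PiM (UNIV::nat set) (\<lambda>_. \<gamma>)"
  note iid = PiM_iid_coordinates[OF borel_probsD(1)[OF \<gamma>b], folded W_def]
  note E = expected_potential[OF \<gamma>b, folded W_def, unfolded \<gamma>(2)]
  interpret W: prob_space W by (rule iid(1))
  have fstm: "fst \<in> measurable \<gamma> borel" by (rule borel_probs_measurable[OF \<gamma>b measurable_fst_snd_borel(1)])
  have wm: "(\<lambda>w. w i) \<in> measurable W \<gamma>" for i unfolding W_def by (rule measurable_component_singleton) simp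
  have indW: "W.indep_vars (\<lambda>_. borel) (\<lambda>i w. fst (w (i - 1))) {1..}"
  proof -
    have "W.indep_vars (\<lambda>i. \<gamma>) (\<lambda>i w. w (i - 1)) {1..}"
      by (rule indep_vars_inj_reindex[OF iid(1) iid(2), where f="\<lambda>i. i - 1"]) (auto simp: inj_on_def)
    then show ?thesis by (rule W.indep_vars_compose2) (rule fstm)
  qed
  have lawW: "distr W borel (\<lambda>w. fst (w (i - 1))) = \<mu>" for i
  proof -
    have "distr W borel (\<lambda>w. fst (w (i - 1))) = distr (distr W \<gamma> (\<lambda>w. w (i - 1))) borel fst"
      by (subst distr_distr[OF fstm wm]) (simp add: comp_def)
    then show ?thesis by (simp only: iid(3) \<gamma>\<mu>)
  qed
  \<comment> \<open>Players are numbered from 1, coordinates from 0.\<close>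
  let ?x = "\<lambda>w i. fst (w (i - 1)) :: 'a" and ?y = "\<lambda>w i. snd (w (i - 1)) :: 'b"
  have typW: "AE w in W. typical_sequence \<mu> (?x w)"
    by (rule AE_typical_sequence[OF iid(1) indW lawW \<mu>])
  have fin: "AE w in W. \<forall>N. potential (Suc N) (?x w) (?y w) < top"
    unfolding AE_all_countable
  proof
    fix N
    have "(\<integral>\<^sup>+w. potential (Suc N) (?x w) (?y w) \<partial>W) \<noteq> \<infinity>" using E(2)[of "Suc N"] I by (auto simp: top_unique)
    then have "AE w in W. potential (Suc N) (?x w) (?y w) \<noteq> \<infinity>"
      by (intro nn_integral_PInf_AE E(1)) simp
    then show "AE w in W. potential (Suc N) (?x w) (?y w) < top" by (simp add: less_top)
  qed
  define F where "F w = liminf (\<lambda>N. potential (Suc N) (?x w) (?y w))" for w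
  have Fm: "F \<in> borel_measurable W" unfolding F_def by (intro borel_measurable_liminf E(1)) simp
  have Fge: "AE w in W. ?I \<le> F w" using typW by eventually_elim (auto simp: F_def intro: Inf_le_liminf_potential)
  have "(\<integral>\<^sup>+w. F w \<partial>W) \<le> liminf (\<lambda>N. \<integral>\<^sup>+w. potential (Suc N) (?x w) (?y w) \<partial>W)"
    unfolding F_def by (intro nn_integral_liminf E(1)) simp
  also have "\<dots> \<le> liminf (\<lambda>N::nat. ?I)" by (intro Liminf_mono always_eventually allI E(2)) simp
  also have "\<dots> = ?I" by (simp add: Liminf_const)
  finally have FI: "(\<integral>\<^sup>+w. F w \<partial>W) \<le> ?I" .
  have Fle: "AE w in W. F w \<le> ?I"
    by (rule AE_le_if_nn_integral_le[OF _ Fm Fge]) (use FI I in \<open>auto simp: W.emeasure_space_1\<close>)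
  have "AE w in W. ?Q (?x w)"
    using typW fin Fle
  proof eventually_elim
    case (elim w)
    show ?case
    proof (rule equilibria_converge_to_minimiser[OF elim(1) _ _ I])
      show "potential N (?x w) (?y w) < top" if "1 \<le> N" for N
        using elim(2)[rule_format, of "N - 1"] that by simp
      show "liminf (\<lambda>N. potential (Suc N) (?x w) (?y w)) \<le> ?I" using elim(3) by (simp add: F_def)
    qed
  qed
  moreover define Q where "Q x = ?Q (\<lambda>i. x (i - 1))" for x :: "nat \<Rightarrow> 'a"
  ultimately have QW: "AE w in PiM UNIV (\<lambda>_. \<gamma>). Q (\<lambda>i. fst (w i))" unfolding W_def by simp
  have "AE \<omega> in P. Q (\<lambda>i. X (Suc i) \<omega>)"
    by (rule AE_types_from_coupling[OF P ind _ \<gamma>(1) QW]) (rule law)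
  then show ?thesis
  proof eventually_elim
    case (elim \<omega>)
    have "nash_equilibrium c L H (\<lambda>i. X (Suc (i - 1)) \<omega>) N \<nu> = nash_equilibrium c L H (\<lambda>i. X i \<omega>) N \<nu>" for N \<nu>
      by (rule nash_equilibrium_cong) simp
    moreover have "profile_plan N (\<lambda>i. X (Suc (i - 1)) \<omega>) \<nu> = profile_plan N (\<lambda>i. X i \<omega>) \<nu>" for N and \<nu> :: "nat \<Rightarrow> 'b measure"
      by (rule profile_plan_cong) simp
    ultimately show ?case using elim by (simp only: Q_def)
  qed
qed

end

section \<open>Limits of arbitrary equilibria for bounded continuous interactions\<close>

locale bounded_game = game_costs c L H
  for c :: "'a::polish_space \<times> 'b::polish_space \<Rightarrow> ennreal" and L :: "'b \<Rightarrow> ennreal" and H :: "'b \<times> 'b \<Rightarrow> ennreal" +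
  fixes B :: real
  assumes cont_H: "continuous_on UNIV H" and bound_H: "H z \<le> ennreal B" and B_nonneg: "0 \<le> B"
begin

definition mean_field :: "'b measure \<Rightarrow> 'b \<Rightarrow> real" where
  "mean_field \<nu> y = enn2real (\<integral>\<^sup>+y'. H (y, y') \<partial>\<nu>)"

lemma mean_field:
  assumes \<nu>: "\<nu> \<in> borel_probs"
  shows "(\<integral>\<^sup>+y'. H (y, y') \<partial>\<nu>) = ennreal (mean_field \<nu> y)" "0 \<le> mean_field \<nu> y" "mean_field \<nu> y \<le> B"
proof -
  have "(\<integral>\<^sup>+y'. H (y, y') \<partial>\<nu>) \<le> (\<integral>\<^sup>+y'. ennreal B \<partial>\<nu>)" by (intro nn_integral_mono bound_H)
  also have "\<dots> = ennreal B" using borel_probsD(3,4)[OF \<nu>] by simp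
  finally have le: "(\<integral>\<^sup>+y'. H (y, y') \<partial>\<nu>) \<le> ennreal B" .
  then have fin: "(\<integral>\<^sup>+y'. H (y, y') \<partial>\<nu>) < top" by (rule le_less_trans) simp
  then show eq: "(\<integral>\<^sup>+y'. H (y, y') \<partial>\<nu>) = ennreal (mean_field \<nu> y)" unfolding mean_field_def by simp
  show "0 \<le> mean_field \<nu> y" by (simp add: mean_field_def)
  show "mean_field \<nu> y \<le> B" using le B_nonneg unfolding eq by (simp add: ennreal_le_iff)
qed

lemma Phi_mean_field:
  "\<nu> \<in> borel_probs \<Longrightarrow> Phi c L H x y \<nu> = c (x, y) + L y + ennreal (2 * mean_field \<nu> y)"
  unfolding Phi_def using mean_field(2)[of \<nu> y] by (simp add: mean_field(1) ennreal_mult)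

lemma mean_field_lower:
  assumes \<nu>: "\<nu> \<in> borel_probs" and e: "0 < e"
  shows "\<exists>U. open U \<and> y0 \<in> U \<and> (\<forall>y\<in>U. mean_field \<nu> y0 - e < mean_field \<nu> y)"
proof (cases "mean_field \<nu> y0 - e < 0")
  case True
  have "mean_field \<nu> y0 - e < mean_field \<nu> y" for y using True mean_field(2)[OF \<nu>, of y] by linarith
  then show ?thesis by (intro exI[of _ UNIV]) auto
next
  case False
  let ?a = "ennreal (mean_field \<nu> y0 - e)"
  have "open {y. ?a < (\<integral>\<^sup>+y'. H (y, y') \<partial>\<nu>)}" by (rule lsc_openD[OF lsc_section_integral[OF lsc_H \<nu>]])
  then show ?thesis
    using False e mean_field(2)[OF \<nu>]
    by (intro exI[of _ "{y. ?a < (\<integral>\<^sup>+y'. H (y, y') \<partial>\<nu>)}"]) (auto simp: mean_field(1)[OF \<nu>] ennreal_less_iff)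
qed

text \<open>Upper semicontinuity of the mean field, jointly in the point and the measure, is lower
  semicontinuity for the kernel \<open>B + 1 - H\<close>.\<close>

lemma mean_field_upper:
  assumes conv: "narrow_conv \<nu> \<nu>'" and \<nu>: "\<And>n. \<nu> n \<in> borel_probs" "\<nu>' \<in> borel_probs" and e: "0 < e" "e \<le> 1"
  shows "\<exists>U. open U \<and> y0 \<in> U \<and> (\<forall>\<^sub>F n in sequentially. \<forall>y\<in>U. mean_field (\<nu> n) y \<le> mean_field \<nu>' y0 + e)"
proof -
  \<comment> \<open>The additional 1 leaves room for \<open>e\<close>: the bound below stays nonnegative even if the field is \<open>B\<close>.\<close>
  let ?b = "ennreal (B + 1)"
  let ?K = "\<lambda>p. ?b - H p"
  have K: "lsc ?K"
    unfolding lsc_def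
  proof
    fix a
    have "a < ?b - h \<longleftrightarrow> a + h < ?b" if "h \<le> ennreal B" for h
    proof -
      have "h < top" using that by (rule le_less_trans) simp
      then obtain r where r: "h = ennreal r" "0 \<le> r" by (cases h) auto
      have rB: "r \<le> B" using that B_nonneg unfolding r by (simp add: ennreal_le_iff)
      show ?thesis
        using r rB by (cases a) (auto simp: ennreal_minus ennreal_plus[symmetric] ennreal_less_iff simp del: ennreal_plus)
    qed
    then have "{p. a < ?b - H p} = {p. a + H p < ?b}" using bound_H by blast
    also have "open \<dots>" by (intro open_Collect_less continuous_on_add_ennreal continuous_on_const cont_H)
    finally show "open {p. a < ?b - H p}" .
  qed
  have int: "(\<integral>\<^sup>+y'. ?K (y, y') \<partial>\<rho>) = ennreal (B + 1 - mean_field \<rho> y)" if \<rho>: "\<rho> \<in> borel_probs" for \<rho> y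
  proof -
    have "(\<integral>\<^sup>+y'. ?b - H (y, y') \<partial>\<rho>) = (\<integral>\<^sup>+y'. ?b \<partial>\<rho>) - (\<integral>\<^sup>+y'. H (y, y') \<partial>\<rho>)"
    proof (rule nn_integral_diff)
      show "(\<lambda>y'. H (y, y')) \<in> borel_measurable \<rho>"
        by (rule borel_probs_measurable[OF \<rho> section_measurable[OF measurable_costs(3)]])
      have "H p \<le> ?b" for p by (rule order_trans[OF bound_H]) (simp add: ennreal_leI)
      then show "AE y' in \<rho>. H (y, y') \<le> ?b" by simp
    qed (simp_all add: mean_field(1)[OF \<rho>])
    also have "\<dots> = ennreal (B + 1 - mean_field \<rho> y)"
      using borel_probsD(3,4)[OF \<rho>] mean_field[OF \<rho>, of y] B_nonneg
      by (simp add: mean_field(1)[OF \<rho>] ennreal_minus del: ennreal_plus)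
    finally show ?thesis .
  qed
  have "ennreal (B + 1 - mean_field \<nu>' y0 - e) < (\<integral>\<^sup>+y'. ?K (y0, y') \<partial>\<nu>')"
    unfolding int[OF \<nu>(2)] using mean_field[OF \<nu>(2), of y0] e by (subst ennreal_less_iff) auto
  then obtain U where U: "open U" "y0 \<in> U"
      "\<forall>\<^sub>F n in sequentially. \<forall>y\<in>U. ennreal (B + 1 - mean_field \<nu>' y0 - e) \<le> (\<integral>\<^sup>+y'. ?K (y, y') \<partial>\<nu> n)"
    using narrow_conv_section_liminf[OF K conv \<nu>] by blast
  have "\<forall>\<^sub>F n in sequentially. \<forall>y\<in>U. mean_field (\<nu> n) y \<le> mean_field \<nu>' y0 + e"
    using U(3)
  proof (eventually_elim, intro ballI)
    fix n y assume h: "\<forall>y\<in>U. ennreal (B + 1 - mean_field \<nu>' y0 - e) \<le> (\<integral>\<^sup>+y'. ?K (y, y') \<partial>\<nu> n)" and "y \<in> U"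
    then have "ennreal (B + 1 - mean_field \<nu>' y0 - e) \<le> ennreal (B + 1 - mean_field (\<nu> n) y)"
      using int[OF \<nu>(1)] by simp
    moreover have "0 \<le> B + 1 - mean_field (\<nu> n) y" using mean_field(3)[OF \<nu>(1), of n y] by simp
    ultimately have "B + 1 - mean_field \<nu>' y0 - e \<le> B + 1 - mean_field (\<nu> n) y" by (simp only: ennreal_le_iff)
    then show "mean_field (\<nu> n) y \<le> mean_field \<nu>' y0 + e" by simp
  qed
  with U show ?thesis by blast
qed

text \<open>The optimal cost of a type depends on the limit measure, which in turn depends on the
  realisation, so that the law of large numbers cannot be applied to it directly. It is approximated
  from above by countably many functions of the type: the strategies are grouped into the pieces
  that small balls cut out of a sublevel set of \<open>L\<close>, and on each piece the mean field is
  replaced by a rational constant.\<close>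

definition piece :: "nat \<Rightarrow> 'b \<times> rat \<Rightarrow> 'b set" where
  "piece T p = {y. L y \<le> ennreal (real T + 1)} \<inter> cball (fst p) (of_rat (snd p))"

definition piece_cost :: "nat \<Rightarrow> 'b \<times> rat \<Rightarrow> 'a \<Rightarrow> ennreal" where
  "piece_cost T p x = (INF y. if y \<in> piece T p then c (x, y) + L y else top)"

definition simple_cost :: "nat \<Rightarrow> (('b \<times> rat) \<times> rat) list \<Rightarrow> 'a \<Rightarrow> ennreal" where
  "simple_cost T ps x = min (of_nat T) (INF (p, q)\<in>set ps. piece_cost T p x + ennreal (of_rat q))"

lemma compact_piece: "compact (piece T p)"
  unfolding piece_def by (intro compact_Int_closed compact_L) auto

lemma lsc_piece_cost: "lsc (piece_cost T p)"
proof -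
  let ?G = "\<lambda>z. if z \<in> UNIV \<times> piece T p then c z + L (snd z) else top"
  have "lsc ?G"
    by (rule lsc_extend_top[OF lsc_type_cost]) (intro closed_Times closed_UNIV compact_imp_closed[OF compact_piece])
  moreover have "\<exists>K. compact K \<and> (\<forall>x y. ?G (x, y) \<le> a \<longrightarrow> y \<in> K)" if "a < top" for a
    using that compact_piece[of T p] by (intro exI[of _ "piece T p"]) (auto simp: top_unique)
  ultimately have "lsc (\<lambda>x. INF y. ?G (x, y))" by (rule lsc_partial_INF(1))
  then show ?thesis by (simp add: piece_cost_def[abs_def])
qed

lemma simple_cost_measurable: "simple_cost T ps \<in> borel_measurable borel"
proof -
  have "(\<lambda>x. INF pq\<in>set ps. piece_cost T (fst pq) x + ennreal (of_rat (snd pq))) \<in> borel_measurable borel"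
    by (intro borel_measurable_INF borel_measurable_add lsc_measurable[OF lsc_piece_cost] borel_measurable_const)
      (simp add: countable_finite)
  then show ?thesis
    unfolding simple_cost_def by (simp add: case_prod_beta')
qed

lemma simple_cost_le: "simple_cost T ps x \<le> ennreal (real T)"
  by (simp add: simple_cost_def ennreal_of_nat_eq_real_of_nat)

lemma simple_cost_upper:
  assumes "\<nu> \<in> borel_probs" "\<And>p q y. (p, q) \<in> set ps \<Longrightarrow> y \<in> piece T p \<Longrightarrow> 2 * mean_field \<nu> y \<le> of_rat q"
  shows "min (of_nat T) (INF y. Phi c L H x y \<nu>) \<le> simple_cost T ps x"
  unfolding simple_cost_def
proof (rule min.mono[OF order_refl INF_greatest], clarify)
  fix p q assume pq: "(p, q) \<in> set ps"
  have le: "(INF y. Phi c L H x y \<nu>) \<le> (if y \<in> piece T p then c (x, y) + L y else top) + ennreal (of_rat q)" for y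
  proof (cases "y \<in> piece T p")
    case True
    have "(INF y. Phi c L H x y \<nu>) \<le> Phi c L H x y \<nu>" by (rule INF_lower) simp
    also have "\<dots> \<le> c (x, y) + L y + ennreal (of_rat q)"
      unfolding Phi_mean_field[OF assms(1)] by (intro add_left_mono ennreal_leI assms(2)[OF pq True])
    finally show ?thesis using True by simp
  qed simp
  show "(INF y. Phi c L H x y \<nu>) \<le> piece_cost T p x + ennreal (of_rat q)"
  proof -
    let ?I = "INF y. Phi c L H x y \<nu>"
    have "?I - ennreal (of_rat q) \<le> piece_cost T p x"
      unfolding piece_cost_def by (rule INF_greatest) (use le in \<open>simp add: ennreal_minus_le_iff add.commute\<close>)
    then show ?thesis by (simp add: ennreal_minus_le_iff add.commute)
  qed
qed

lemma simple_cost_lower: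
  assumes \<nu>: "\<nu> \<in> borel_probs" and e: "0 \<le> e"
    and cover: "\<And>y. L y \<le> ennreal (real T + 1) \<Longrightarrow> \<exists>(p, q)\<in>set ps. y \<in> piece T p \<and> of_rat q \<le> 2 * mean_field \<nu> y + e"
  shows "simple_cost T ps x \<le> min (of_nat T) (INF y. Phi c L H x y \<nu>) + ennreal e"
proof (cases "(INF y. Phi c L H x y \<nu>) < of_nat T")
  case False
  then have "simple_cost T ps x \<le> min (of_nat T) (INF y. Phi c L H x y \<nu>)"
    unfolding simple_cost_def by (auto simp: min_def)
  then show ?thesis by (rule order_trans) simp
next
  case True
  obtain y where y: "Phi c L H x y \<nu> = (INF y. Phi c L H x y \<nu>)" using lsc_inf_Phi(2)[OF \<nu>] by blast
  have "L y \<le> Phi c L H x y \<nu>" unfolding Phi_def by (simp add: add_increasing2 add_increasing)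
  also have "\<dots> \<le> ennreal (real T + 1)"
    using True unfolding y by (intro order_trans[OF less_imp_le[OF True]]) (simp add: ennreal_of_nat_eq_real_of_nat ennreal_leI)
  finally obtain p q where pq: "(p, q) \<in> set ps" "y \<in> piece T p" "of_rat q \<le> 2 * mean_field \<nu> y + e"
    using cover by blast
  have "simple_cost T ps x \<le> piece_cost T p x + ennreal (of_rat q)"
    unfolding simple_cost_def by (rule min.coboundedI2) (rule INF_lower2[OF pq(1)], simp)
  also have "\<dots> \<le> (c (x, y) + L y) + ennreal (2 * mean_field \<nu> y + e)"
    unfolding piece_cost_def using pq(2,3) by (intro add_mono INF_lower2[of y] ennreal_leI) auto
  also have "\<dots> = Phi c L H x y \<nu> + ennreal e"
    unfolding Phi_mean_field[OF \<nu>] using mean_field(2)[OF \<nu>, of y] e by (simp add: add.assoc)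
  also have "\<dots> = min (of_nat T) (INF y. Phi c L H x y \<nu>) + ennreal e" using True y by (simp add: min_absorb2)
  finally show ?thesis .
qed

text \<open>Around every strategy in the sublevel set there is a small ball on which the mean field of \<open>\<nu>'\<close>
  does not fall much below its value at that strategy, whereas those of the late \<open>\<nu> n\<close> do not rise
  much above it; finitely many such balls suffice by compactness. Centres in a dense set and rational radii leave only countably many of them.\<close>

lemma pieces_exist:
  assumes dense: "\<And>X::'b set. open X \<Longrightarrow> X \<noteq> {} \<Longrightarrow> \<exists>d\<in>D. d \<in> X"
    and conv: "narrow_conv \<nu> \<nu>'" and \<nu>: "\<And>n. \<nu> n \<in> borel_probs" "\<nu>' \<in> borel_probs" and e: "0 < e" "e \<le> 1"
  shows "\<exists>ps. set ps \<subseteq> (D \<times> UNIV) \<times> UNIV \<and>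
    (\<forall>\<^sub>F n in sequentially. \<forall>(p, q)\<in>set ps. \<forall>y\<in>piece T p. 2 * mean_field (\<nu> n) y \<le> of_rat q) \<and>
    (\<forall>y. L y \<le> ennreal (real T + 1) \<longrightarrow> (\<exists>(p, q)\<in>set ps. y \<in> piece T p \<and> of_rat q \<le> 2 * mean_field \<nu>' y + e))"
proof -
  define K where "K = {y. L y \<le> ennreal (real T + 1)}"
  have cK: "compact K" unfolding K_def by (rule compact_L) simp
  have "\<forall>y0. \<exists>d \<rho> q. d \<in> D \<and> y0 \<in> ball d (of_rat \<rho>) \<and>
      (\<forall>\<^sub>F n in sequentially. \<forall>y\<in>cball d (of_rat \<rho>). 2 * mean_field (\<nu> n) y \<le> of_rat q) \<and>
      (\<forall>y\<in>cball d (of_rat \<rho>). of_rat q \<le> 2 * mean_field \<nu>' y + e)"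
  proof
    fix y0
    obtain U where U: "open U" "y0 \<in> U" "\<forall>\<^sub>F n in sequentially. \<forall>y\<in>U. mean_field (\<nu> n) y \<le> mean_field \<nu>' y0 + e / 8"
      using mean_field_upper[OF conv \<nu>, of "e / 8"] e by auto
    obtain V where V: "open V" "y0 \<in> V" "\<forall>y\<in>V. mean_field \<nu>' y0 - e / 8 < mean_field \<nu>' y"
      using mean_field_lower[OF \<nu>(2), of "e / 8"] e by auto
    obtain \<delta> where \<delta>: "0 < \<delta>" "ball y0 \<delta> \<subseteq> U \<inter> V"
      using U V by (meson IntI openE open_Int)
    obtain d where d: "d \<in> D" "d \<in> ball y0 (\<delta> / 4)" using dense[of "ball y0 (\<delta> / 4)"] \<delta> by auto
    obtain \<rho> where \<rho>: "\<delta> / 4 < of_rat \<rho>" "of_rat \<rho> < \<delta> / 2" using of_rat_dense[of "\<delta> / 4" "\<delta> / 2"] \<delta> by auto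
    \<comment> \<open>Doubling the field doubles the error \<open>e / 8\<close>; the interval of length \<open>e / 4\<close> provides a rational.\<close>
    obtain q where q: "2 * mean_field \<nu>' y0 + e / 4 < of_rat q" "of_rat q < 2 * mean_field \<nu>' y0 + e / 2"
      using of_rat_dense[of "2 * mean_field \<nu>' y0 + e / 4" "2 * mean_field \<nu>' y0 + e / 2"] e by auto
    have sub: "cball d (of_rat \<rho>) \<subseteq> U \<inter> V"
    proof
      fix y assume "y \<in> cball d (of_rat \<rho>)"
      then have "dist y0 y < \<delta>" using d(2) \<rho>(2) \<delta>(1) dist_triangle[of y0 y d] by auto
      then show "y \<in> U \<inter> V" using \<delta>(2) by auto
    qed
    have "y0 \<in> ball d (of_rat \<rho>)" using d(2) \<rho>(1) by (simp add: dist_commute)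
    moreover have "\<forall>\<^sub>F n in sequentially. \<forall>y\<in>cball d (of_rat \<rho>). 2 * mean_field (\<nu> n) y \<le> of_rat q"
      using U(3)
    proof (eventually_elim, intro ballI)
      fix n y assume "\<forall>y\<in>U. mean_field (\<nu> n) y \<le> mean_field \<nu>' y0 + e / 8" "y \<in> cball d (of_rat \<rho>)"
      then have "mean_field (\<nu> n) y \<le> mean_field \<nu>' y0 + e / 8" using sub by blast
      then show "2 * mean_field (\<nu> n) y \<le> of_rat q" using q(1) by linarith
    qed
    moreover have "\<forall>y\<in>cball d (of_rat \<rho>). of_rat q \<le> 2 * mean_field \<nu>' y + e"
    proof
      fix y assume "y \<in> cball d (of_rat \<rho>)"
      then have "mean_field \<nu>' y0 - e / 8 < mean_field \<nu>' y" using sub V(3) by blast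
      then show "of_rat q \<le> 2 * mean_field \<nu>' y + e" using q(2) e by linarith
    qed
    ultimately show "\<exists>d \<rho> q. d \<in> D \<and> y0 \<in> ball d (of_rat \<rho>) \<and>
      (\<forall>\<^sub>F n in sequentially. \<forall>y\<in>cball d (of_rat \<rho>). 2 * mean_field (\<nu> n) y \<le> of_rat q) \<and>
      (\<forall>y\<in>cball d (of_rat \<rho>). of_rat q \<le> 2 * mean_field \<nu>' y + e)"
      using d(1) by blast
  qed
  then obtain d \<rho> q where all: "\<forall>y0. d y0 \<in> D \<and> y0 \<in> ball (d y0) (of_rat (\<rho> y0)) \<and>
      (\<forall>\<^sub>F n in sequentially. \<forall>y\<in>cball (d y0) (of_rat (\<rho> y0)). 2 * mean_field (\<nu> n) y \<le> of_rat (q y0)) \<and>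
      (\<forall>y\<in>cball (d y0) (of_rat (\<rho> y0)). of_rat (q y0) \<le> 2 * mean_field \<nu>' y + e)"
    unfolding choice_iff by (elim exE)
  have dq: "d y0 \<in> D" "y0 \<in> ball (d y0) (of_rat (\<rho> y0))"
      "\<forall>\<^sub>F n in sequentially. \<forall>y\<in>cball (d y0) (of_rat (\<rho> y0)). 2 * mean_field (\<nu> n) y \<le> of_rat (q y0)"
      "\<And>y. y \<in> cball (d y0) (of_rat (\<rho> y0)) \<Longrightarrow> of_rat (q y0) \<le> 2 * mean_field \<nu>' y + e" for y0
    using spec[OF all, of y0] by blast+
  have "K \<subseteq> (\<Union>y0\<in>K. ball (d y0) (of_rat (\<rho> y0)))" using dq(2) by blast
  then obtain F where F: "F \<subseteq> K" "finite F" "K \<subseteq> (\<Union>y0\<in>F. ball (d y0) (of_rat (\<rho> y0)))"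
    by (rule compactE_image[OF cK, rotated]) auto
  obtain ys where ys: "set ys = F" using finite_list[OF F(2)] by blast
  define ps where "ps = map (\<lambda>y0. ((d y0, \<rho> y0), q y0)) ys"
  show ?thesis
  proof (intro exI[of _ ps] conjI allI impI)
    show "set ps \<subseteq> (D \<times> UNIV) \<times> UNIV" using dq(1) by (auto simp: ps_def)
    have "\<forall>\<^sub>F n in sequentially. \<forall>y0\<in>F. \<forall>y\<in>cball (d y0) (of_rat (\<rho> y0)). 2 * mean_field (\<nu> n) y \<le> of_rat (q y0)"
      by (intro eventually_ball_finite[OF F(2)] ballI dq(3))
    then show "\<forall>\<^sub>F n in sequentially. \<forall>(p, q)\<in>set ps. \<forall>y\<in>piece T p. 2 * mean_field (\<nu> n) y \<le> of_rat q"
      by eventually_elim (auto simp: ps_def ys piece_def)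
    show "\<exists>(p, q)\<in>set ps. y \<in> piece T p \<and> of_rat q \<le> 2 * mean_field \<nu>' y + e" if "L y \<le> ennreal (real T + 1)" for y
    proof -
      have "y \<in> K" using that by (simp only: K_def mem_Collect_eq)
      then obtain y0 where y0: "y0 \<in> F" "y \<in> ball (d y0) (of_rat (\<rho> y0))" using F(3) by blast
      then have "y \<in> cball (d y0) (of_rat (\<rho> y0))" by auto
      then show ?thesis using y0 that dq(4)[of y y0]
        by (intro bexI[of _ "((d y0, \<rho> y0), q y0)"]) (auto simp: ps_def ys piece_def)
    qed
  qed
qed

text \<open>In an equilibrium every player is optimal against the mean field of all players up to the
  self-interaction, which is at most \<open>2 B / N\<close>. Truncating the costs makes all of this bounded.\<close>

lemma nash_truncated_field:
  assumes N: "1 \<le> N" and nash: "nash_equilibrium c L H x N \<nu>"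
  defines "\<gamma> \<equiv> profile_plan N x \<nu>"
  shows "(\<integral>\<^sup>+z. min T (Phi c L H (fst z) (snd z) (snd_marginal \<gamma>)) \<partial>\<gamma>)
    \<le> ennreal (1 / real N) * (\<Sum>i=1..N. min T (INF y. Phi c L H (x i) y (snd_marginal \<gamma>))) + ennreal (2 * B / real N)"
proof -
  let ?e = "ennreal (1 / real N)"
  have \<nu>: "\<nu> i \<in> borel_probs" if "i \<in> {1..N}" for i using nash that by (auto simp: nash_equilibrium_def)
  have \<gamma>: "\<gamma> \<in> borel_probs" unfolding \<gamma>_def by (rule profile_plan_borel_probs[OF N \<nu>])
  note \<nu>' = snd_marginal_borel_probs[OF \<gamma>]
  let ?\<Phi> = "\<lambda>x y. Phi c L H x y (snd_marginal \<gamma>)"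
  have \<Phi>m: "(\<lambda>z. min T (?\<Phi> (fst z) (snd z))) \<in> borel_measurable borel"
    by (intro borel_measurable_min borel_measurable_const lsc_measurable[OF lsc_Phi[OF \<nu>']])
  have field: "(\<integral>\<^sup>+y'. H (z, y') \<partial>snd_marginal \<gamma>) = ?e * (\<Sum>j=1..N. \<integral>\<^sup>+y'. H (z, y') \<partial>\<nu> j)" for z
  proof -
    have m: "(\<lambda>w. H (z, snd w)) \<in> borel_measurable (borel :: ('a \<times> 'b) measure)"
      by (rule measurable_compose[OF measurable_fst_snd_borel(2) section_measurable[OF measurable_costs(3)]])
    have "(\<integral>\<^sup>+y'. H (z, y') \<partial>snd_marginal \<gamma>) = (\<integral>\<^sup>+w. H (z, snd w) \<partial>\<gamma>)"
      by (rule nn_integral_snd_marginal[OF \<gamma> section_measurable[OF measurable_costs(3)]])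
    also have "\<dots> = ?e * (\<Sum>j=1..N. \<integral>\<^sup>+y'. H (z, snd (x j, y')) \<partial>\<nu> j)"
      unfolding \<gamma>_def by (rule nn_integral_profile_plan[OF N \<nu> m])
    finally show ?thesis by simp
  qed
  have two: "2 * ?e = 2 / of_nat N" unfolding ennreal_2_over_nat[OF N] using ennreal_mult[of 2 "1 / real N"] by simp
  have split: "(\<Sum>j=1..N. \<integral>\<^sup>+y'. H (z, y') \<partial>\<nu> j) = (\<integral>\<^sup>+y'. H (z, y') \<partial>\<nu> i) + (\<Sum>j\<in>{1..N} - {i}. \<integral>\<^sup>+y'. H (z, y') \<partial>\<nu> j)"
    if "i \<in> {1..N}" for i z using that by (intro sum.remove) auto
  have le1: "player_field x N i \<nu> z \<le> ?\<Phi> (x i) z" if i: "i \<in> {1..N}" for i z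
    unfolding player_field_def Phi_def field two[symmetric] mult.assoc split[OF i]
    by (intro add_left_mono mult_left_mono) (auto simp: add_increasing)
  have le2: "?\<Phi> (x i) z \<le> player_field x N i \<nu> z + ennreal (2 * B / real N)" if i: "i \<in> {1..N}" for i z
  proof -
    let ?s = "\<Sum>j\<in>{1..N} - {i}. \<integral>\<^sup>+y'. H (z, y') \<partial>\<nu> j"
    have "(\<integral>\<^sup>+y'. H (z, y') \<partial>\<nu> i) \<le> ennreal B"
      using mean_field(1,3)[OF \<nu>[OF i], of z] by (simp add: ennreal_leI)
    then have "2 * (?e * ((\<integral>\<^sup>+y'. H (z, y') \<partial>\<nu> i) + ?s)) \<le> 2 * (?e * (ennreal B + ?s))"
      by (intro mult_left_mono add_right_mono) auto
    also have "\<dots> = 2 * ?e * ?s + ennreal (2 * B / real N)"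
    proof -
      have "2 * (?e * ennreal B) = ennreal (2 * B / real N)"
        using ennreal_mult[of 2 "B / real N"] ennreal_mult[of "1 / real N" B] B_nonneg by simp
      then show ?thesis by (simp add: distrib_left mult.assoc add.commute)
    qed
    finally show ?thesis
      unfolding player_field_def Phi_def field two[symmetric] split[OF i] by (simp add: add.assoc add_left_mono)
  qed
  have best: "(\<integral>\<^sup>+z. player_field x N i \<nu> z \<partial>\<nu> i) \<le> (INF y. ?\<Phi> (x i) y)" if i: "i \<in> {1..N}" for i
  proof (rule INF_greatest)
    fix y
    have "(\<integral>\<^sup>+z. player_field x N i \<nu> z \<partial>\<nu> i) \<le> player_field x N i \<nu> y"
      using nash_iff_field[of N \<nu> x, OF \<nu>] nash i by blast
    also note le1[OF i]
    finally show "(\<integral>\<^sup>+z. player_field x N i \<nu> z \<partial>\<nu> i) \<le> ?\<Phi> (x i) y" .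
  qed
  have player: "(\<integral>\<^sup>+z. min T (?\<Phi> (x i) z) \<partial>\<nu> i) \<le> min T (INF y. ?\<Phi> (x i) y) + ennreal (2 * B / real N)" if i: "i \<in> {1..N}" for i
  proof -
    note p = borel_probsD(3,4)[OF \<nu>[OF i]]
    have "(\<integral>\<^sup>+z. min T (?\<Phi> (x i) z) \<partial>\<nu> i) \<le> (\<integral>\<^sup>+z. T \<partial>\<nu> i)" by (rule nn_integral_mono) simp
    then have 1: "(\<integral>\<^sup>+z. min T (?\<Phi> (x i) z) \<partial>\<nu> i) \<le> T" using p by simp
    have fm: "player_field x N i \<nu> \<in> borel_measurable (\<nu> i)"
      unfolding player_field_def
      by (intro borel_probs_measurable[OF \<nu>[OF i]] borel_measurable_add borel_measurable_times_ennreal borel_measurable_const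
          borel_measurable_sum section_measurable measurable_costs borel_measurable_section_integral \<nu>) auto
    have "(\<integral>\<^sup>+z. min T (?\<Phi> (x i) z) \<partial>\<nu> i) \<le> (\<integral>\<^sup>+z. player_field x N i \<nu> z + ennreal (2 * B / real N) \<partial>\<nu> i)"
      by (rule nn_integral_mono) (rule min.coboundedI2[OF le2[OF i]])
    also have "\<dots> = (\<integral>\<^sup>+z. player_field x N i \<nu> z \<partial>\<nu> i) + ennreal (2 * B / real N)"
      using p by (subst nn_integral_add[OF fm]) auto
    also have "\<dots> \<le> (INF y. ?\<Phi> (x i) y) + ennreal (2 * B / real N)" by (intro add_right_mono best i)
    finally have 2: "(\<integral>\<^sup>+z. min T (?\<Phi> (x i) z) \<partial>\<nu> i) \<le> (INF y. ?\<Phi> (x i) y) + ennreal (2 * B / real N)" .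
    show ?thesis
      using 1 2 by (cases "T \<le> (INF y. ?\<Phi> (x i) y)") (auto simp: min_def intro: order_trans)
  qed
  have "(\<integral>\<^sup>+z. min T (?\<Phi> (fst z) (snd z)) \<partial>\<gamma>) = ?e * (\<Sum>i=1..N. \<integral>\<^sup>+z. min T (?\<Phi> (x i) z) \<partial>\<nu> i)"
    unfolding \<gamma>_def by (subst nn_integral_profile_plan[OF N \<nu> \<Phi>m[unfolded \<gamma>_def]]) simp_all
  also have "\<dots> \<le> ?e * (\<Sum>i=1..N. min T (INF y. ?\<Phi> (x i) y) + ennreal (2 * B / real N))"
    by (intro mult_left_mono sum_mono player) auto
  also have "\<dots> = ?e * (\<Sum>i=1..N. min T (INF y. ?\<Phi> (x i) y)) + ?e * (of_nat N * ennreal (2 * B / real N))"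
    by (simp add: sum.distrib distrib_left)
  also have "?e * (of_nat N * ennreal (2 * B / real N)) = ennreal (2 * B / real N)"
    using N by (simp add: mult.assoc[symmetric] ennreal_of_nat_eq_real_of_nat ennreal_mult[symmetric])
  finally show ?thesis .
qed

text \<open>The truncated cost of the limit is at most the lower limit of the truncated costs along the
  sequence, hence of the averages of truncated optimal costs. These are bounded by averages of a
  simple cost, which converge by the law of large numbers to its \<open>\<mu>\<close>-integral, and this integral
  exceeds that of the truncated optimal cost of the limit by at most \<open>e\<close>.\<close>

lemma equilibria_limit_cournot_nash:
  fixes \<nu> :: "nat \<Rightarrow> nat \<Rightarrow> 'b measure"
  assumes \<mu>: "\<mu> \<in> borel_probs" and typical: "typical_sequence \<mu> x"
    and dense: "\<And>X::'b set. open X \<Longrightarrow> X \<noteq> {} \<Longrightarrow> \<exists>d\<in>D. d \<in> X"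
    and lln: "\<And>T ps. set ps \<subseteq> (D \<times> UNIV) \<times> UNIV \<Longrightarrow>
      (\<lambda>N. (\<Sum>i=1..N. enn2real (simple_cost T ps (x i))) / real N) \<longlonglongrightarrow> (\<integral>x. enn2real (simple_cost T ps x) \<partial>\<mu>)"
    and nash: "\<And>N. 1 \<le> N \<Longrightarrow> nash_equilibrium c L H x N (\<nu> N)"
    and \<gamma>: "\<gamma> \<in> borel_probs" and conv: "narrow_conv (\<lambda>N. profile_plan N x (\<nu> N)) \<gamma>"
  shows "\<gamma> \<in> plans \<mu> \<and> cournot_nash c L H \<mu> \<gamma>"
proof -
  have \<nu>b: "\<nu> N i \<in> borel_probs" if "1 \<le> N" "i \<in> {1..N}" for N i
    using nash[OF that(1)] that(2) by (auto simp: nash_equilibrium_def)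
  \<comment> \<open>The plan of the game without players has mass 0, hence the shift.\<close>
  define M where "M n = profile_plan (Suc n) x (\<nu> (Suc n))" for n
  have "M n \<in> plans (empirical (Suc n) x)" for n
    unfolding M_def by (rule profile_plan_in_plans[OF _ \<nu>b]) auto
  then have Mb: "M n \<in> borel_probs" and Me: "distr (M n) borel fst = empirical (Suc n) x" for n by (auto simp: plans_def)
  have Mconv: "narrow_conv M \<gamma>"
    using conv unfolding narrow_conv_def M_def by (auto intro: LIMSEQ_Suc)
  have "narrow_conv (\<lambda>n. distr (M n) borel fst) (distr \<gamma> borel fst)"
    by (rule narrow_conv_distr[OF Mconv Mb \<gamma>]) (intro continuous_intros)
  moreover have "strict_mono Suc" by (simp add: strict_mono_def)
  ultimately have "distr \<gamma> borel fst = \<mu>"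
    using typical distr_borel_probs[OF \<gamma> measurable_fst_snd_borel(1)]
    unfolding typical_sequence_def Me by blast
  then have \<gamma>p: "\<gamma> \<in> plans \<mu>" and \<gamma>\<mu>: "distr \<gamma> borel fst = \<mu>" using \<gamma> by (auto simp: plans_def)
  define \<nu>' where "\<nu>' = snd_marginal \<gamma>"
  note \<nu>'b = snd_marginal_borel_probs[OF \<gamma>, folded \<nu>'_def]
  note Sb = snd_marginal_borel_probs[OF Mb]
  note Sconv = narrow_conv_snd_marginal[OF Mconv Mb \<gamma>, folded \<nu>'_def]
  define m where "m x = (INF y. Phi c L H x y \<nu>')" for x
  have mm: "m \<in> borel_measurable borel" unfolding m_def by (rule lsc_measurable[OF lsc_inf_Phi(1)[OF \<nu>'b]])
  have key: "(\<integral>\<^sup>+z. min (of_nat T) (Phi c L H (fst z) (snd z) \<nu>') \<partial>\<gamma>) \<le> (\<integral>\<^sup>+x. min (of_nat T) (m x) \<partial>\<mu>)" for T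
  proof -
    let ?K = "\<lambda>p. c (fst p) + L (snd (fst p)) + ennreal 2 * H (snd (fst p), snd p)"
    have K: "lsc ?K"
      by (intro lsc_add lsc_cmult lsc_compose[OF lsc_c] lsc_compose[OF lsc_L] lsc_compose[OF lsc_H] continuous_intros) simp
    have intK: "(\<integral>\<^sup>+y. ?K (z, y) \<partial>\<rho>) = Phi c L H (fst z) (snd z) \<rho>" if \<rho>: "\<rho> \<in> borel_probs" for z \<rho>
    proof -
      have Hm: "(\<lambda>y. H (snd z, y)) \<in> borel_measurable \<rho>"
        by (rule borel_probs_measurable[OF \<rho> section_measurable[OF measurable_costs(3)]])
      show ?thesis unfolding Phi_def using borel_probsD(3,4)[OF \<rho>] Hm
        by (simp add: nn_integral_add nn_integral_cmult)
    qed
    have low: "(\<integral>\<^sup>+z. min (of_nat T) (Phi c L H (fst z) (snd z) \<nu>') \<partial>\<gamma>)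
        \<le> liminf (\<lambda>n. \<integral>\<^sup>+z. min (of_nat T) (Phi c L H (fst z) (snd z) (snd_marginal (M n))) \<partial>M n)"
      using narrow_conv_interaction_liminf[OF K Sconv Sb \<nu>'b Mconv Mb \<gamma>, of "of_nat T"]
      unfolding intK[OF \<nu>'b] intK[OF Sb] .
    have eps: "(\<integral>\<^sup>+z. min (of_nat T) (Phi c L H (fst z) (snd z) \<nu>') \<partial>\<gamma>) \<le> (\<integral>\<^sup>+x. min (of_nat T) (m x) \<partial>\<mu>) + ennreal e"
      if e: "0 < e" "e \<le> 1" for e :: real
    proof -
      have "\<exists>ps. set ps \<subseteq> (D \<times> UNIV) \<times> UNIV \<and>
        (\<forall>\<^sub>F n in sequentially. \<forall>(p, q)\<in>set ps. \<forall>y\<in>piece T p. 2 * mean_field (snd_marginal (M n)) y \<le> of_rat q) \<and>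
        (\<forall>y. L y \<le> ennreal (real T + 1) \<longrightarrow> (\<exists>(p, q)\<in>set ps. y \<in> piece T p \<and> of_rat q \<le> 2 * mean_field \<nu>' y + e))"
        by (rule pieces_exist[OF _ Sconv Sb \<nu>'b e]) (rule dense)
      then obtain ps where ps: "set ps \<subseteq> (D \<times> UNIV) \<times> UNIV"
        "\<forall>\<^sub>F n in sequentially. \<forall>(p, q)\<in>set ps. \<forall>y\<in>piece T p. 2 * mean_field (snd_marginal (M n)) y \<le> of_rat q"
        "\<And>y. L y \<le> ennreal (real T + 1) \<Longrightarrow> \<exists>(p, q)\<in>set ps. y \<in> piece T p \<and> of_rat q \<le> 2 * mean_field \<nu>' y + e"
        by blast
      define g where "g x = enn2real (simple_cost T ps x)" for x
      have sg: "simple_cost T ps x = ennreal (g x)" for x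
        unfolding g_def using simple_cost_le[of T ps x] by (simp add: le_less_trans)
      have g: "0 \<le> g x" "g x \<le> real T" for x
        using simple_cost_le[of T ps x] unfolding sg by (auto simp: g_def ennreal_le_iff)
      have gm: "g \<in> borel_measurable borel"
        unfolding g_def by (rule measurable_compose[OF simple_cost_measurable]) simp
      have "\<forall>\<^sub>F n in sequentially. (\<integral>\<^sup>+z. min (of_nat T) (Phi c L H (fst z) (snd z) (snd_marginal (M n))) \<partial>M n)
          \<le> ennreal ((\<Sum>i=1..Suc n. g (x i)) / real (Suc n)) + ennreal (2 * B / real (Suc n))"
        using ps(2)
      proof eventually_elim
        case (elim n)
        have up: "min (of_nat T) (INF y. Phi c L H x' y (snd_marginal (M n))) \<le> ennreal (g x')" for x'
          unfolding sg[symmetric] by (rule simple_cost_upper[OF Sb]) (use elim in blast)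
        have "(\<integral>\<^sup>+z. min (of_nat T) (Phi c L H (fst z) (snd z) (snd_marginal (M n))) \<partial>M n)
            \<le> ennreal (1 / real (Suc n)) * (\<Sum>i=1..Suc n. min (of_nat T) (INF y. Phi c L H (x i) y (snd_marginal (M n))))
              + ennreal (2 * B / real (Suc n))"
          unfolding M_def by (rule nash_truncated_field[OF _ nash]) auto
        also have "\<dots> \<le> ennreal (1 / real (Suc n)) * (\<Sum>i=1..Suc n. ennreal (g (x i))) + ennreal (2 * B / real (Suc n))"
          by (intro add_right_mono mult_left_mono sum_mono up) auto
        also have "ennreal (1 / real (Suc n)) * (\<Sum>i=1..Suc n. ennreal (g (x i))) = ennreal ((\<Sum>i=1..Suc n. g (x i)) / real (Suc n))"
          using g(1) by (subst sum_ennreal) (auto simp: ennreal_mult[symmetric] sum_nonneg simp del: sum.cl_ivl_Suc)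
        finally show ?case .
      qed
      then have "liminf (\<lambda>n. \<integral>\<^sup>+z. min (of_nat T) (Phi c L H (fst z) (snd z) (snd_marginal (M n))) \<partial>M n)
          \<le> liminf (\<lambda>n. ennreal ((\<Sum>i=1..Suc n. g (x i)) / real (Suc n)) + ennreal (2 * B / real (Suc n)))"
        by (rule Liminf_mono)
      also have "\<dots> = ennreal (\<integral>x. g x \<partial>\<mu>) + 0"
      proof (rule lim_imp_Liminf)
        have 1: "(\<lambda>n. ennreal ((\<Sum>i=1..Suc n. g (x i)) / real (Suc n))) \<longlonglongrightarrow> ennreal (\<integral>x. g x \<partial>\<mu>)"
          using LIMSEQ_Suc[OF lln[OF ps(1), of T]] unfolding g_def by (rule tendsto_ennrealI)
        have "(\<lambda>n. 2 * B * inverse (real (Suc n))) \<longlonglongrightarrow> 2 * B * 0"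
          by (intro tendsto_intros LIMSEQ_inverse_real_of_nat)
        then have 2: "(\<lambda>n. ennreal (2 * B / real (Suc n))) \<longlonglongrightarrow> ennreal 0"
          by (intro tendsto_ennrealI) (simp add: divide_inverse)
        show "(\<lambda>n. ennreal ((\<Sum>i=1..Suc n. g (x i)) / real (Suc n)) + ennreal (2 * B / real (Suc n))) \<longlonglongrightarrow> ennreal (\<integral>x. g x \<partial>\<mu>) + 0"
          using tendsto_add[OF 1 2] by simp
      qed simp
      also have "ennreal (\<integral>x. g x \<partial>\<mu>) + 0 = (\<integral>\<^sup>+x. ennreal (g x) \<partial>\<mu>)"
      proof -
        interpret prob_space \<mu> by (rule borel_probsD[OF \<mu>])
        have "integrable \<mu> g"
          by (rule integrable_const_bound[where B="real T"]) (use g borel_probs_measurable[OF \<mu> gm] in auto)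
        then show ?thesis using g(1) by (subst nn_integral_eq_integral) auto
      qed
      also have "\<dots> \<le> (\<integral>\<^sup>+x. min (of_nat T) (m x) + ennreal e \<partial>\<mu>)"
      proof (rule nn_integral_mono)
        fix x'
        show "ennreal (g x') \<le> min (of_nat T) (m x') + ennreal e"
          unfolding sg[symmetric] m_def by (rule simple_cost_lower[OF \<nu>'b _ ps(3)]) (use e in auto)
      qed
      also have "\<dots> = (\<integral>\<^sup>+x. min (of_nat T) (m x) \<partial>\<mu>) + ennreal e"
        using borel_probsD(3,4)[OF \<mu>] mm
        by (subst nn_integral_add) (auto intro!: borel_probs_measurable[OF \<mu>])
      finally show ?thesis using low by (rule order_trans[rotated])
    qed
    show ?thesis
    proof (rule ennreal_le_epsilon)
      fix e :: real assume "0 < e"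
      then have "(\<integral>\<^sup>+z. min (of_nat T) (Phi c L H (fst z) (snd z) \<nu>') \<partial>\<gamma>) \<le> (\<integral>\<^sup>+x. min (of_nat T) (m x) \<partial>\<mu>) + ennreal (min e 1)"
        by (intro eps) auto
      also have "\<dots> \<le> (\<integral>\<^sup>+x. min (of_nat T) (m x) \<partial>\<mu>) + ennreal e" by (intro add_left_mono ennreal_leI) simp
      finally show "(\<integral>\<^sup>+z. min (of_nat T) (Phi c L H (fst z) (snd z) \<nu>') \<partial>\<gamma>) \<le> (\<integral>\<^sup>+x. min (of_nat T) (m x) \<partial>\<mu>) + ennreal e" .
    qed
  qed
  have "AE z in \<gamma>. \<forall>T::nat. min (of_nat T) (Phi c L H (fst z) (snd z) \<nu>') \<le> min (of_nat T) (m (fst z))"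
    unfolding AE_all_countable
  proof
    fix T :: nat
    have mf: "(\<lambda>z::'a \<times> 'b. min (of_nat T) (m (fst z))) \<in> borel_measurable borel"
      by (intro borel_measurable_min borel_measurable_const measurable_compose[OF measurable_fst_snd_borel(1) mm])
    have eq: "(\<integral>\<^sup>+z. min (of_nat T) (m (fst z)) \<partial>\<gamma>) = (\<integral>\<^sup>+x. min (of_nat T) (m x) \<partial>\<mu>)"
      unfolding \<gamma>\<mu>[symmetric] using mm
      by (subst nn_integral_distr) (auto intro: borel_probs_measurable[OF \<gamma> measurable_fst_snd_borel(1)])
    show "AE z in \<gamma>. min (of_nat T) (Phi c L H (fst z) (snd z) \<nu>') \<le> min (of_nat T) (m (fst z))"
    proof (rule AE_le_if_nn_integral_le)
      show "(\<lambda>z. min (of_nat T) (m (fst z))) \<in> borel_measurable \<gamma>" by (rule borel_probs_measurable[OF \<gamma> mf])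
      show "(\<lambda>z. min (of_nat T) (Phi c L H (fst z) (snd z) \<nu>')) \<in> borel_measurable \<gamma>"
        by (intro borel_probs_measurable[OF \<gamma>] borel_measurable_min borel_measurable_const lsc_measurable[OF lsc_Phi[OF \<nu>'b]])
      have "m (fst z) \<le> Phi c L H (fst z) (snd z) \<nu>'" for z unfolding m_def by (rule INF_lower) simp
      then show "AE z in \<gamma>. min (of_nat T) (m (fst z)) \<le> min (of_nat T) (Phi c L H (fst z) (snd z) \<nu>')"
        by (intro AE_I2 min.mono) auto
      show "(\<integral>\<^sup>+z. min (of_nat T) (Phi c L H (fst z) (snd z) \<nu>') \<partial>\<gamma>) \<le> (\<integral>\<^sup>+z. min (of_nat T) (m (fst z)) \<partial>\<gamma>)"
        unfolding eq by (rule key)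
      have "(\<integral>\<^sup>+z. min (of_nat T) (m (fst z)) \<partial>\<gamma>) \<le> (\<integral>\<^sup>+z. of_nat T \<partial>\<gamma>)" by (rule nn_integral_mono) simp
      also have "\<dots> < \<infinity>" using borel_probsD(3,4)[OF \<gamma>] by (simp add: of_nat_less_top)
      finally show "(\<integral>\<^sup>+z. min (of_nat T) (m (fst z)) \<partial>\<gamma>) < \<infinity>" .
    qed
  qed
  then have "AE z in \<gamma>. Phi c L H (fst z) (snd z) \<nu>' \<le> m (fst z)"
  proof eventually_elim
    case (elim z)
    show ?case
    proof (cases "m (fst z) = top")
      case False
      then obtain T :: nat where T: "m (fst z) < of_nat T" using ennreal_Ex_less_of_nat[of "m (fst z)"] by (auto simp: less_top)
      have "min (of_nat T) (Phi c L H (fst z) (snd z) \<nu>') \<le> m (fst z)"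
        using elim[rule_format, of T] T by (simp add: min_absorb2)
      then show ?thesis using T by (auto simp: min_le_iff_disj)
    qed simp
  qed
  then show ?thesis using \<gamma>p unfolding cournot_nash_iff_AE[OF \<gamma>p] m_def \<nu>'_def by blast
qed

lemma AE_limits_cournot_nash:
  fixes X :: "nat \<Rightarrow> 'w \<Rightarrow> 'a"
  assumes \<mu>: "\<mu> \<in> borel_probs" and P: "prob_space P" and ind: "prob_space.indep_vars P (\<lambda>_. borel) X {1..}"
    and law: "\<And>i. 1 \<le> i \<Longrightarrow> distr P borel (X i) = \<mu>"
  shows "AE \<omega> in P. \<forall>\<nu> :: nat \<Rightarrow> nat \<Rightarrow> 'b measure. \<forall>\<gamma> \<in> borel_probs.
    (\<forall>N\<ge>1. nash_equilibrium c L H (\<lambda>i. X i \<omega>) N (\<nu> N)) \<and> narrow_conv (\<lambda>N. profile_plan N (\<lambda>i. X i \<omega>) (\<nu> N)) \<gamma> \<longrightarrow>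
    \<gamma> \<in> plans \<mu> \<and> cournot_nash c L H \<mu> \<gamma>"
proof -
  obtain D :: "'b set" where D: "countable D" "\<And>X. open X \<Longrightarrow> X \<noteq> {} \<Longrightarrow> \<exists>d\<in>D. d \<in> X"
    using countable_dense_setE by blast
  define \<P> where "\<P> = lists ((D \<times> (UNIV :: rat set)) \<times> (UNIV :: rat set))"
  have c\<P>: "countable \<P>" unfolding \<P>_def by (intro countable_lists countable_SIGMA D(1)) auto
  have bound: "0 \<le> enn2real (simple_cost T ps x)" "enn2real (simple_cost T ps x) \<le> real T" for T ps x
    using simple_cost_le[of T ps x] by (auto simp: enn2real_leI)
  have gm: "(\<lambda>x. enn2real (simple_cost T ps x)) \<in> borel_measurable borel" for T ps
    by (rule measurable_compose[OF simple_cost_measurable]) simp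
  have "AE \<omega> in P. \<forall>T. \<forall>ps\<in>\<P>. (\<lambda>N. (\<Sum>i=1..N. enn2real (simple_cost T ps (X i \<omega>))) / real N) \<longlonglongrightarrow> (\<integral>x. enn2real (simple_cost T ps x) \<partial>\<mu>)"
    unfolding AE_all_countable AE_ball_countable[OF c\<P>]
    by (intro allI ballI bounded_SLLN[OF P ind law gm bound])
  moreover have "AE \<omega> in P. typical_sequence \<mu> (\<lambda>i. X i \<omega>)"
    by (rule AE_typical_sequence[OF P ind _ \<mu>]) (rule law)
  ultimately show ?thesis
  proof eventually_elim
    case (elim \<omega>)
    show ?case
    proof (intro allI ballI impI)
      fix \<nu> :: "nat \<Rightarrow> nat \<Rightarrow> 'b measure" and \<gamma> :: "('a \<times> 'b) measure"
      assume \<gamma>: "\<gamma> \<in> borel_probs" and h: "(\<forall>N\<ge>1. nash_equilibrium c L H (\<lambda>i. X i \<omega>) N (\<nu> N)) \<and> narrow_conv (\<lambda>N. profile_plan N (\<lambda>i. X i \<omega>) (\<nu> N)) \<gamma>"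
      show "\<gamma> \<in> plans \<mu> \<and> cournot_nash c L H \<mu> \<gamma>"
      proof (rule equilibria_limit_cournot_nash[OF \<mu> elim(2) D(2)])
        show "(\<lambda>N. (\<Sum>i=1..N. enn2real (simple_cost T ps (X i \<omega>))) / real N) \<longlonglongrightarrow> (\<integral>x. enn2real (simple_cost T ps x) \<partial>\<mu>)"
          if "set ps \<subseteq> (D \<times> UNIV) \<times> UNIV" for T ps
          using elim(1) that by (auto simp: \<P>_def in_lists_conv_set)
      qed (use \<gamma> h in auto)
    qed
  qed
qed

end

theorem theorem4p13:
  fixes c :: "'a::polish_space \<times> 'b::polish_space \<Rightarrow> ennreal"
    and L :: "'b \<Rightarrow> ennreal"
    and H :: "'b \<times> 'b \<Rightarrow> ennreal"
    and \<mu> :: "'a measure"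
    and P :: "'w measure"
    and X :: "nat \<Rightarrow> 'w \<Rightarrow> 'a"
    and C :: "nat \<Rightarrow> ennreal"
    and \<kappa> :: "nat \<Rightarrow> 'b \<Rightarrow> 'b measure"
  assumes "\<mu> \<in> borel_probs" and "atomless \<mu>"
    and "lsc c" and "lsc L" and "lsc H"
    and "\<forall>y y'. H (y, y') = H (y', y)"
    and "\<forall>a::real. 0 < a \<longrightarrow> compact {y. L y \<le> ennreal a}"
    and "prob_space P"
    and "prob_space.indep_vars P (\<lambda>_. borel) X {1..}"
    and "\<forall>i\<ge>1. distr P borel (X i) = \<mu>"
    and "(INF \<gamma>\<in>plans \<mu>. Jcal c L H \<gamma>) < \<infinity>"
    and "\<forall>n. 0 < C n \<and> C n < \<infinity>"
    and "\<forall>n. measurable_family (\<kappa> n)"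
    and "\<forall>n y y'. Hcal H (\<kappa> n y) (\<kappa> n y') \<le> C n * (1 + L y + L y')"
    and "\<forall>x y. \<forall>\<nu>\<in>borel_probs. Phi c L H x y \<nu> < \<infinity> \<longrightarrow>
           (\<lambda>n. \<integral>\<^sup>+z. Phi c L H x z \<nu> \<partial>\<kappa> n y) \<longlonglongrightarrow> Phi c L H x y \<nu>"
  shows "(AE \<omega> in P. \<exists>\<nu> :: nat \<Rightarrow> nat \<Rightarrow> 'b measure.
            (\<forall>N\<ge>1. nash_equilibrium c L H (\<lambda>i. X i \<omega>) N (\<nu> N)) \<and>
            (\<exists>r \<gamma>. strict_mono r \<and>
               narrow_conv (\<lambda>k. profile_plan (r k) (\<lambda>i. X i \<omega>) (\<nu> (r k))) \<gamma> \<and>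
               cournot_nash c L H \<mu> \<gamma>)) \<and>
         (continuous_on UNIV H \<and> (\<exists>B::real. \<forall>z. H z \<le> ennreal B) \<longrightarrow>
          (AE \<omega> in P. \<forall>\<nu> :: nat \<Rightarrow> nat \<Rightarrow> 'b measure. \<forall>\<gamma> \<in> borel_probs.
            (\<forall>N\<ge>1. nash_equilibrium c L H (\<lambda>i. X i \<omega>) N (\<nu> N)) \<and>
            narrow_conv (\<lambda>N. profile_plan N (\<lambda>i. X i \<omega>) (\<nu> N)) \<gamma> \<longrightarrow>
            \<gamma> \<in> plans \<mu> \<and> cournot_nash c L H \<mu> \<gamma>))"
proof -
  have law: "\<And>i. 1 \<le> i \<Longrightarrow> distr P borel (X i) = \<mu>" using assms(10) by simp
  interpret game_costs c L H by unfold_locales (use assms in auto)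
  have conv: "AE \<omega> in P. \<exists>\<nu> :: nat \<Rightarrow> nat \<Rightarrow> 'b measure.
      (\<forall>N\<ge>1. nash_equilibrium c L H (\<lambda>i. X i \<omega>) N (\<nu> N)) \<and>
      (\<exists>r \<gamma>. strict_mono r \<and> narrow_conv (\<lambda>k. profile_plan (r k) (\<lambda>i. X i \<omega>) (\<nu> (r k))) \<gamma> \<and>
        \<gamma> \<in> plans \<mu> \<and> Jcal c L H \<gamma> = (INF \<gamma>\<in>plans \<mu>. Jcal c L H \<gamma>))"
    by (rule AE_equilibria_converge[OF assms(1,8,9) _ assms(11)]) (rule law)
  have cn: "cournot_nash c L H \<mu> \<gamma>"
    if "\<gamma> \<in> plans \<mu>" "Jcal c L H \<gamma> = (INF \<gamma>\<in>plans \<mu>. Jcal c L H \<gamma>)" for \<gamma>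
  proof (rule minimiser_cournot_nash[where C=C and \<kappa>=\<kappa>])
    show "Jcal c L H \<gamma> < top" unfolding that(2) using assms(11) by simp
    show "Jcal c L H \<gamma> \<le> Jcal c L H \<gamma>'" if "\<gamma>' \<in> plans \<mu>" for \<gamma>'
      unfolding \<open>Jcal c L H \<gamma> = _\<close> using that by (rule INF_lower)
  qed (use that assms(12-15) in auto)
  from conv have first: "AE \<omega> in P. \<exists>\<nu> :: nat \<Rightarrow> nat \<Rightarrow> 'b measure.
      (\<forall>N\<ge>1. nash_equilibrium c L H (\<lambda>i. X i \<omega>) N (\<nu> N)) \<and>
      (\<exists>r \<gamma>. strict_mono r \<and> narrow_conv (\<lambda>k. profile_plan (r k) (\<lambda>i. X i \<omega>) (\<nu> (r k))) \<gamma> \<and>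
        cournot_nash c L H \<mu> \<gamma>)"
    by (rule eventually_mono) (use cn in blast)
  have second: "AE \<omega> in P. \<forall>\<nu> :: nat \<Rightarrow> nat \<Rightarrow> 'b measure. \<forall>\<gamma> \<in> borel_probs.
      (\<forall>N\<ge>1. nash_equilibrium c L H (\<lambda>i. X i \<omega>) N (\<nu> N)) \<and>
      narrow_conv (\<lambda>N. profile_plan N (\<lambda>i. X i \<omega>) (\<nu> N)) \<gamma> \<longrightarrow>
      \<gamma> \<in> plans \<mu> \<and> cournot_nash c L H \<mu> \<gamma>"
    if H: "continuous_on UNIV H" "\<And>z. H z \<le> ennreal B" for B :: real
  proof -
    interpret bounded_game c L H "max B 0"
    proof unfold_locales
      show "H z \<le> ennreal (max B 0)" for z by (rule order_trans[OF H(2)]) (simp add: ennreal_leI)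
    qed (use H in auto)
    show ?thesis by (rule AE_limits_cournot_nash[OF assms(1,8,9)]) (rule law)
  qed
  show ?thesis using first second by blast
qed


end
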